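(* Let $X_1,X_2,\dots$ be i.i.d. with density $p$ as described in the context, $h\in\mathfrak{R}$, and let $a_n\to\infty$. Define $t=t(n)$ by $m(t)=a_n$ and assume $$\lim_{n\to\infty}\frac{\psi(t)^2}{\sqrt{n\psi'(t)}}=0 .$$ Let $Y_1^n=(Y_1,\dots,Y_n)$ be a random vector distributed as $(X_1,\dots,X_n)$ conditioned on $S_1^n=X_1+\dots+X_n=na_n$, let $P_{a_n}$ be its probability law, and let $p_{a_n}$ be the density of $Y_1$ (the conditional density of $X_1$ given $S_1^n=na_n$). Put $g_{a_n}=\pi^{a_n}$, the tilted density at point $a_n$. Then $$p_{a_n}(Y_1)=g_{a_n}(Y_1)\,(1+R_n),$$ where $R_n$ is a function of $Y_1^n$ such that $P_{a_n}\left(|R_n|>\delta/\sqrt n\right)\to0$ as $n\to\infty$ for any positive $\delta$.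
   Context: Density: $p$ is a uniformly bounded probability density, $p(x)=c\exp(-(g(x)-q(x)))$ for $x\in\mathbb{R}_+$ (and $p=0$ on negative reals), with $c>0$ a normalizing constant. The function $g$ is positive, $g(x)/x\to\infty$ as $x\to\infty$, and $h:=g'$. There is a constant $\vartheta>0$ such that for all large $x$, $\sup_{|v-x|<\vartheta x}|q(v)|\le 1/\sqrt{x h(x)}$. Regularity classes: $l\in R_0$ if $l(x)=\exp\left(\int_1^x\frac{\epsilon(u)}{u}du\right)$ for $x\ge1$, where $\epsilon$ is twice differentiable and $\epsilon(x)\to0$ as $x\to\infty$. For $\beta>0$, $h\in R_\beta$ if for $x$ large enough $h(x)=x^\beta l(x)$ with $l\in R_0$ whose function $\epsilon$ satisfies $\limsup_{x\to\infty}x|\epsilon'(x)|<\infty$ and $\limsup_{x\to\infty}x^2|\epsilon''(x)|<\infty$. A function $l\in R_0$ belongs to $\widetilde{R_0}$ if $l(x)\to\infty$ as $x\to\infty$, $\lim_{x\to\infty}\frac{x\epsilon'(x)}{\epsilon(x)}=0$, $\lim_{x\to\infty}\frac{x^2\epsilon''(x)}{\epsilon(x)}=0$, and $\liminf_{x\to\infty}x^\eta\epsilon(x)>0$ for some $\eta\in(0,1/4)$. $h\in R_\infty$ if $h$ is increasing and strictly monotone and its inverse $\psi$ belongs to $\widetilde{R_0}$. Here $\psi(u):=h^{\leftarrow}(u):=\inf\{x:h(x)\ge u\}$ (this notation is used for all $h$). $\mathfrak{R}:=R_\beta\cup R_\infty$ (any $\beta>0$). $\Phi(t)=\int_0^\infty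 e^{tx}p(x)\,dx$; $m(t)=\frac{d}{dt}\log\Phi(t)$. The tilted density is $\pi^{a}(x)=\frac{e^{tx}p(x)}{\Phi(t)}$ with $t$ the unique solution of $m(t)=a$. *)

theory Defs
  imports "HOL-Probability.Probability"
begin

section \<open>Conditioning an i.i.d. sample on its sum\<close>

text \<open>Joint density at (y_1, ..., y_{n-1}, s) of (X_1, ..., X_{n-1}, X_1 + ... + X_n)
  for i.i.d. X_i with density p.\<close>

definition joint_density :: "(real \<Rightarrow> real) \<Rightarrow> nat \<Rightarrow> real \<Rightarrow> (nat \<Rightarrow> real) \<Rightarrow> ennreal" where
  "joint_density p n s y = ennreal ((\<Prod>i\<in>{1..<n}. p (y i)) * p (s - (\<Sum>i\<in>{1..<n}. y i)))"

text \<open>Density of X_1 + ... + X_n at s, i.e. the n-fold convolution of p, for n at least 1.\<close>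

definition sum_density :: "(real \<Rightarrow> real) \<Rightarrow> nat \<Rightarrow> real \<Rightarrow> ennreal" where
  "sum_density p n s = (\<integral>\<^sup>+ y. joint_density p n s y \<partial>(\<Pi>\<^sub>M i\<in>{1..<n}. lborel))"

text \<open>The law of (X_1, ..., X_n) conditioned on X_1 + ... + X_n = s.  The conditioning event is
  null, so conditioning is by the ratio of densities: the first n - 1 coordinates have density
  joint density / density of the sum, and the last coordinate is what remains of s.
  That this is a regular conditional distribution is \<open>cond_law_disintegration\<close> below.\<close>

definition cond_law :: "(real \<Rightarrow> real) \<Rightarrow> nat \<Rightarrow> real \<Rightarrow> (nat \<Rightarrow> real) measure" where
  "cond_law p n s =
     distr (density (\<Pi>\<^sub>M i\<in>{1..<n}. lborel) (\<lambda>y. joint_density p n s y / sum_density p n s))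
       (\<Pi>\<^sub>M i\<in>{1..n}. borel)
       (\<lambda>y. y(n := s - (\<Sum>i\<in>{1..<n}. y i)))"

lemma PiM_density_lborel:
  fixes f :: "real \<Rightarrow> ennreal"
  assumes [measurable]: "f \<in> borel_measurable borel" and "finite I"
    and 1: "(\<integral>\<^sup>+ x. f x \<partial>lborel) = 1"
  shows "(\<Pi>\<^sub>M i\<in>I. density lborel f) = density (\<Pi>\<^sub>M i\<in>I. lborel) (\<lambda>y. \<Prod>i\<in>I. f (y i))"
proof -
  have "prob_space (density lborel f)"
    by (rule prob_spaceI) (simp add: emeasure_density 1)
  then interpret D: product_prob_space "\<lambda>_::'a. density lborel f" I
    by (intro product_prob_spaceI) auto
  interpret L: product_sigma_finite "\<lambda>_::'a. lborel :: real measure" ..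
  show ?thesis
  proof (rule sym, rule D.PiM_eqI)
    show "finite I" by fact
    show "sets (density (\<Pi>\<^sub>M i\<in>I. lborel) (\<lambda>y. \<Prod>i\<in>I. f (y i))) = sets (\<Pi>\<^sub>M i\<in>I. density lborel f)"
      by (simp cong: sets_PiM_cong)
    fix A :: "'a \<Rightarrow> real set" assume A: "\<And>i. i \<in> I \<Longrightarrow> A i \<in> sets (density lborel f)"
    have Am: "Pi\<^sub>E I A \<in> sets (\<Pi>\<^sub>M i\<in>I. lborel)"
      using A \<open>finite I\<close> by (intro sets_PiM_I_finite) auto
    have "emeasure (density (\<Pi>\<^sub>M i\<in>I. lborel) (\<lambda>y. \<Prod>i\<in>I. f (y i))) (Pi\<^sub>E I A)
        = (\<integral>\<^sup>+ y. (\<Prod>i\<in>I. f (y i)) * indicator (Pi\<^sub>E I A) y \<partial>(\<Pi>\<^sub>M i\<in>I. lborel))"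
      using Am \<open>finite I\<close> by (subst emeasure_density) auto
    also have "\<dots> = (\<integral>\<^sup>+ y. (\<Prod>i\<in>I. f (y i) * indicator (A i) (y i)) \<partial>(\<Pi>\<^sub>M i\<in>I. lborel))"
    proof (rule nn_integral_cong)
      fix y :: "'a \<Rightarrow> real" assume y: "y \<in> space (\<Pi>\<^sub>M i\<in>I. lborel)"
      have "indicator (Pi\<^sub>E I A) y = (\<Prod>i\<in>I. indicator (A i) (y i) :: ennreal)"
        using y \<open>finite I\<close> by (auto simp: indicator_def space_PiM PiE_iff prod_zero_iff)
      then show "(\<Prod>i\<in>I. f (y i)) * indicator (Pi\<^sub>E I A) y = (\<Prod>i\<in>I. f (y i) * indicator (A i) (y i))"
        by (simp add: prod.distrib)
    qed
    also have "\<dots> = (\<Prod>i\<in>I. \<integral>\<^sup>+ x. f x * indicator (A i) x \<partial>lborel)"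
      using A \<open>finite I\<close> by (intro L.product_nn_integral_prod) auto
    also have "\<dots> = (\<Prod>i\<in>I. emeasure (density lborel f) (A i))"
      using A by (intro prod.cong) (auto simp: emeasure_density)
    finally show "emeasure (density (\<Pi>\<^sub>M i\<in>I. lborel) (\<lambda>y. \<Prod>i\<in>I. f (y i))) (Pi\<^sub>E I A)
        = (\<Prod>i\<in>I. emeasure (density lborel f) (A i))" .
  qed
qed

context
  fixes p :: "real \<Rightarrow> real" and n :: nat
  assumes p_meas [measurable]: "p \<in> borel_measurable borel"
begin

lemma joint_density_measurable [measurable]:
  "(\<lambda>(s, y). joint_density p n s y) \<in> borel_measurable (borel \<Otimes>\<^sub>M (\<Pi>\<^sub>M i\<in>{1..<n}. lborel))"
  unfolding joint_density_def by measurable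

lemma joint_density_measurable2 [measurable]:
  "joint_density p n s \<in> borel_measurable (\<Pi>\<^sub>M i\<in>{1..<n}. lborel)"
  unfolding joint_density_def by measurable

lemma sum_density_measurable [measurable]: "sum_density p n \<in> borel_measurable borel"
proof -
  interpret L: product_sigma_finite "\<lambda>_::nat. lborel :: real measure" ..
  interpret sigma_finite_measure "\<Pi>\<^sub>M i\<in>{1..<n}. lborel :: real measure"
    by (rule L.sigma_finite) simp
  show ?thesis
    unfolding sum_density_def by measurable
qed

lemma complete_measurable:
  assumes "n \<ge> 1"
  shows "(\<lambda>(s, y). y(n := s - (\<Sum>i\<in>{1..<n}. y i)))
    \<in> (borel \<Otimes>\<^sub>M (\<Pi>\<^sub>M i\<in>{1..<n}. lborel)) \<rightarrow>\<^sub>M (\<Pi>\<^sub>M i\<in>{1..n}. (borel :: real measure))"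
proof -
  have *: "{1..n} = insert n {1..<n}" using assms by auto
  show ?thesis
    unfolding * by measurable
qed

lemma cond_law_emeasure:
  assumes n: "n \<ge> 1" and A: "A \<in> sets (\<Pi>\<^sub>M i\<in>{1..n}. borel)"
  shows "emeasure (cond_law p n s) A =
    (\<integral>\<^sup>+ y. joint_density p n s y * indicator A (y(n := s - (\<Sum>i\<in>{1..<n}. y i)))
       \<partial>(\<Pi>\<^sub>M i\<in>{1..<n}. lborel)) / sum_density p n s"
proof -
  have c [measurable]: "(\<lambda>y. y(n := s - (\<Sum>i\<in>{1..<n}. y i))) \<in> (\<Pi>\<^sub>M i\<in>{1..<n}. lborel) \<rightarrow>\<^sub>M (\<Pi>\<^sub>M i\<in>{1..n}. (borel :: real measure))"
    using measurable_compose[OF measurable_Pair1' complete_measurable[OF n], of s] by simp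
  have [measurable]: "A \<in> sets (\<Pi>\<^sub>M i\<in>{1..n}. borel)" by fact
  have "emeasure (cond_law p n s) A =
    (\<integral>\<^sup>+ y. indicator A y \<partial>cond_law p n s)"
    using A by (simp add: cond_law_def)
  also have "\<dots> = (\<integral>\<^sup>+ y. joint_density p n s y * indicator A (y(n := s - (\<Sum>i\<in>{1..<n}. y i))) / sum_density p n s
       \<partial>(\<Pi>\<^sub>M i\<in>{1..<n}. lborel))"
    unfolding cond_law_def
    by (subst nn_integral_distr, measurable, subst nn_integral_density, measurable)
       (simp add: divide_ennreal_def mult_ac)
  also have "\<dots> = (\<integral>\<^sup>+ y. joint_density p n s y * indicator A (y(n := s - (\<Sum>i\<in>{1..<n}. y i)))
       \<partial>(\<Pi>\<^sub>M i\<in>{1..<n}. lborel)) / sum_density p n s"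
    by (rule nn_integral_divide) measurable
  finally show ?thesis .
qed

lemma cond_law_prob_space:
  assumes n: "n \<ge> 1" and "0 < sum_density p n s" "sum_density p n s < \<infinity>"
  shows "prob_space (cond_law p n s)"
proof (rule prob_spaceI)
  have c: "(\<lambda>y. y(n := s - (\<Sum>i\<in>{1..<n}. y i))) \<in> (\<Pi>\<^sub>M i\<in>{1..<n}. lborel) \<rightarrow>\<^sub>M (\<Pi>\<^sub>M i\<in>{1..n}. (borel :: real measure))"
    using measurable_compose[OF measurable_Pair1' complete_measurable[OF n], of s] by simp
  have sp: "space (cond_law p n s) = space (\<Pi>\<^sub>M i\<in>{1..n}. borel)"
    by (simp add: cond_law_def)
  have "emeasure (cond_law p n s) (space (cond_law p n s)) = sum_density p n s / sum_density p n s"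
    unfolding sp
    unfolding cond_law_emeasure[OF n sets.top] sum_density_def
    by (intro arg_cong2[where f="(/)"] nn_integral_cong refl)
       (simp only: measurable_space[OF c] indicator_simps mult_1_right)
  then show "emeasure (cond_law p n s) (space (cond_law p n s)) = 1"
    using assms by (simp add: ennreal_divide_self)
qed

lemma iid_disintegration:
  assumes "prob_space M" and n: "n \<ge> 1"
    and indep: "prob_space.indep_vars M (\<lambda>_. borel) X {1..}"
    and X: "\<And>i. i \<ge> 1 \<Longrightarrow> distributed M lborel (X i) (\<lambda>x. ennreal (p x))"
    and p0: "\<And>x. 0 \<le> p x"
    and A: "A \<in> sets (\<Pi>\<^sub>M i\<in>{1..n}. borel)" and B: "B \<in> sets borel"
  shows "emeasure M {\<omega>\<in>space M. (\<lambda>i\<in>{1..n}. X i \<omega>) \<in> A \<and> (\<Sum>i\<in>{1..n}. X i \<omega>) \<in> B} =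
    (\<integral>\<^sup>+ s. (\<integral>\<^sup>+ y. joint_density p n s y * indicator A (y(n := s - (\<Sum>i\<in>{1..<n}. y i)))
       \<partial>(\<Pi>\<^sub>M i\<in>{1..<n}. lborel)) * indicator B s \<partial>lborel)"
proof -
  interpret prob_space M by fact
  interpret L: product_sigma_finite "\<lambda>_::nat. lborel :: real measure" ..
  interpret P: sigma_finite_measure "\<Pi>\<^sub>M i\<in>{1..<n}. lborel :: real measure"
    by (rule L.sigma_finite) simp
  interpret PL: pair_sigma_finite "\<Pi>\<^sub>M i\<in>{1..<n}. lborel :: real measure" "lborel :: real measure" ..
  define S where "S = (\<lambda>y::nat \<Rightarrow> real. \<Sum>i\<in>{1..n}. y i)"
  define T where "T = (\<lambda>y::nat \<Rightarrow> real. \<Sum>i\<in>{1..<n}. y i)"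
  define F where "F = (\<lambda>y. \<Prod>i\<in>{1..n}. ennreal (p (y i)))"
  have I: "{1..n} = insert n {1..<n}" using n by auto
  have [measurable]: "A \<in> sets (\<Pi>\<^sub>M i\<in>{1..n}. borel)" "B \<in> sets borel" by fact+
  have [measurable]: "A \<in> sets (\<Pi>\<^sub>M i\<in>{1..n}. lborel)"
    using A by (simp cong: sets_PiM_cong)
  have rv [measurable]: "\<And>i. i \<in> {1..n} \<Longrightarrow> X i \<in> borel_measurable M"
    using distributed_measurable[OF X] by simp
  have int1: "(\<integral>\<^sup>+ x. ennreal (p x) \<partial>lborel) = 1"
  proof -
    have "prob_space (density lborel (\<lambda>x. ennreal (p x)))"
      using prob_space_distr[OF distributed_measurable[OF X[OF order_refl]]]
      by (simp only: distributed_distr_eq_density[OF X[OF order_refl]])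
    from prob_space.emeasure_space_1[OF this] show ?thesis
      by (simp add: emeasure_density)
  qed
  have "indep_vars (\<lambda>_. borel) X {1..n}"
    by (rule indep_vars_subset[OF indep]) auto
  then have "distr M (\<Pi>\<^sub>M i\<in>{1..n}. borel) (\<lambda>\<omega>. \<lambda>i\<in>{1..n}. X i \<omega>) = (\<Pi>\<^sub>M i\<in>{1..n}. distr M borel (X i))"
    using n by (subst (asm) indep_vars_iff_distr_eq_PiM') auto
  also have "\<dots> = (\<Pi>\<^sub>M i\<in>{1..n}. density lborel (\<lambda>x. ennreal (p x)))"
  proof (intro PiM_cong refl)
    fix i assume "i \<in> {1..n}"
    then have "distributed M lborel (X i) (\<lambda>x. ennreal (p x))" by (intro X) auto
    then have "distr M lborel (X i) = density lborel (\<lambda>x. ennreal (p x))"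
      by (rule distributed_distr_eq_density)
    moreover have "distr M lborel (X i) = distr M borel (X i)"
      by (intro distr_cong) auto
    ultimately show "distr M borel (X i) = density lborel (\<lambda>x. ennreal (p x))" by simp
  qed
  also have "\<dots> = density (\<Pi>\<^sub>M i\<in>{1..n}. lborel) F"
    unfolding F_def by (rule PiM_density_lborel) (use int1 in auto)
  finally have law: "distr M (\<Pi>\<^sub>M i\<in>{1..n}. borel) (\<lambda>\<omega>. \<lambda>i\<in>{1..n}. X i \<omega>) = density (\<Pi>\<^sub>M i\<in>{1..n}. lborel) F" .
  have Sm [measurable]: "S \<in> borel_measurable (\<Pi>\<^sub>M i\<in>{1..n}. lborel)"
    "S \<in> borel_measurable (\<Pi>\<^sub>M i\<in>{1..n}. borel)"
    unfolding S_def by measurable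
  have Tm [measurable]: "T \<in> borel_measurable (\<Pi>\<^sub>M i\<in>{1..<n}. lborel)"
    unfolding T_def by measurable
  have Fm [measurable]: "F \<in> borel_measurable (\<Pi>\<^sub>M i\<in>{1..n}. lborel)"
    unfolding F_def by measurable
  define C where "C = {y\<in>space (\<Pi>\<^sub>M i\<in>{1..n}. borel). y \<in> A \<and> S y \<in> B}"
  have C [measurable]: "C \<in> sets (\<Pi>\<^sub>M i\<in>{1..n}. borel)" unfolding C_def by measurable
  have C2 [measurable]: "C \<in> sets (\<Pi>\<^sub>M i\<in>{1..n}. lborel)"
    using C by (simp cong: sets_PiM_cong)
  have Xm: "(\<lambda>\<omega>. \<lambda>i\<in>{1..n}. X i \<omega>) \<in> M \<rightarrow>\<^sub>M (\<Pi>\<^sub>M i\<in>{1..n}. borel)"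
    by measurable
  have "{\<omega>\<in>space M. (\<lambda>i\<in>{1..n}. X i \<omega>) \<in> A \<and> (\<Sum>i\<in>{1..n}. X i \<omega>) \<in> B}
      = (\<lambda>\<omega>. \<lambda>i\<in>{1..n}. X i \<omega>) -` C \<inter> space M"
    by (auto simp: C_def S_def space_PiM)
  then have "emeasure M {\<omega>\<in>space M. (\<lambda>i\<in>{1..n}. X i \<omega>) \<in> A \<and> (\<Sum>i\<in>{1..n}. X i \<omega>) \<in> B}
      = emeasure (density (\<Pi>\<^sub>M i\<in>{1..n}. lborel) F) C"
    by (simp only: law[symmetric] emeasure_distr[OF Xm C])
  also have "\<dots> = (\<integral>\<^sup>+ y. F y * indicator C y \<partial>(\<Pi>\<^sub>M i\<in>{1..n}. lborel))"
    by (rule emeasure_density) measurable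
  also have "\<dots> = (\<integral>\<^sup>+ y. F y * (indicator A y * indicator B (S y)) \<partial>(\<Pi>\<^sub>M i\<in>{1..n}. lborel))"
    by (intro nn_integral_cong) (auto simp: C_def indicator_def space_PiM)
  also have "\<dots> = (\<integral>\<^sup>+ y. (\<integral>\<^sup>+ u. F (y(n := u)) * (indicator A (y(n := u)) * indicator B (S (y(n := u)))) \<partial>lborel)
       \<partial>(\<Pi>\<^sub>M i\<in>{1..<n}. lborel))"
  proof -
    have "(\<lambda>y. F y * (indicator A y * indicator B (S y))) \<in> borel_measurable (\<Pi>\<^sub>M i\<in>{1..n}. lborel)"
      by measurable
    then show ?thesis
      unfolding I by (intro L.product_nn_integral_insert) auto
  qed
  also have "\<dots> = (\<integral>\<^sup>+ y. (\<integral>\<^sup>+ s. joint_density p n s y * indicator A (y(n := s - T y)) * indicator B s \<partial>lborel)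
       \<partial>(\<Pi>\<^sub>M i\<in>{1..<n}. lborel))"
  proof (rule nn_integral_cong)
    fix y :: "nat \<Rightarrow> real" assume y: "y \<in> space (\<Pi>\<^sub>M i\<in>{1..<n}. lborel)"
    have Fu: "F (y(n := u)) = joint_density p n (T y + u) y" for u
    proof -
      have "F (y(n := u)) = ennreal (p u) * (\<Prod>i\<in>{1..<n}. ennreal (p ((y(n := u)) i)))"
        unfolding F_def I by (subst prod.insert) auto
      also have "(\<Prod>i\<in>{1..<n}. ennreal (p ((y(n := u)) i))) = (\<Prod>i\<in>{1..<n}. ennreal (p (y i)))"
        by (intro prod.cong) auto
      also have "\<dots> = ennreal (\<Prod>i\<in>{1..<n}. p (y i))"
        by (rule prod_ennreal) (rule p0)
      finally show ?thesis
        by (simp add: joint_density_def T_def p0 prod_nonneg ennreal_mult' mult.commute del: fun_upd_apply)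
    qed
    have Su: "S (y(n := u)) = T y + u" for u
    proof -
      have "S (y(n := u)) = u + (\<Sum>i\<in>{1..<n}. (y(n := u)) i)"
        unfolding S_def I by (subst sum.insert) auto
      also have "(\<Sum>i\<in>{1..<n}. (y(n := u)) i) = T y"
        unfolding T_def by (intro sum.cong) auto
      finally show ?thesis by (simp only: add.commute)
    qed
    have m1: "(\<lambda>s. joint_density p n s y) \<in> borel_measurable borel"
      unfolding joint_density_def by measurable
    have m2: "(\<lambda>s. y(n := s - T y)) \<in> borel \<rightarrow>\<^sub>M (\<Pi>\<^sub>M i\<in>{1..n}. (borel :: real measure))"
    proof -
      have "(\<lambda>s. (s, y)) \<in> borel \<rightarrow>\<^sub>M (borel \<Otimes>\<^sub>M (\<Pi>\<^sub>M i\<in>{1..<n}. lborel))"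
        using y by (intro measurable_Pair2') 
      from measurable_compose[OF this complete_measurable[OF n]] show ?thesis
        by (simp add: T_def)
    qed
    have m: "(\<lambda>s. joint_density p n s y * indicator A (y(n := s - T y)) * indicator B s)
        \<in> borel_measurable borel"
      using m1 m2 by measurable
    have "(\<integral>\<^sup>+ s. joint_density p n s y * indicator A (y(n := s - T y)) * indicator B s \<partial>lborel)
      = ennreal \<bar>1\<bar> * (\<integral>\<^sup>+ u. joint_density p n (T y + 1 * u) y * indicator A (y(n := (T y + 1 * u) - T y)) * indicator B (T y + 1 * u) \<partial>lborel)"
      by (rule nn_integral_real_affine[OF m]) simp
    then show "(\<integral>\<^sup>+ u. F (y(n := u)) * (indicator A (y(n := u)) * indicator B (S (y(n := u)))) \<partial>lborel)
      = (\<integral>\<^sup>+ s. joint_density p n s y * indicator A (y(n := s - T y)) * indicator B s \<partial>lborel)"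
      by (simp add: Fu Su mult.assoc)
  qed
  also have "\<dots> = (\<integral>\<^sup>+ s. (\<integral>\<^sup>+ y. joint_density p n s y * indicator A (y(n := s - T y)) * indicator B s
       \<partial>(\<Pi>\<^sub>M i\<in>{1..<n}. lborel)) \<partial>lborel)"
  proof (rule PL.Fubini'[symmetric])
    have "(\<lambda>(s, y). joint_density p n s y * indicator A (y(n := s - T y)) * indicator B s)
      \<in> borel_measurable (borel \<Otimes>\<^sub>M (\<Pi>\<^sub>M i\<in>{1..<n}. lborel))"
    proof -
      have "(\<lambda>z. indicator A (case z of (s, y) \<Rightarrow> y(n := s - T y)) :: ennreal)
          \<in> borel_measurable (borel \<Otimes>\<^sub>M (\<Pi>\<^sub>M i\<in>{1..<n}. lborel))"
        using measurable_compose[OF complete_measurable[OF n] borel_measurable_indicator[OF A]]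
        by (simp add: T_def)
      moreover have "(\<lambda>z. indicator B (fst z) :: ennreal)
          \<in> borel_measurable (borel \<Otimes>\<^sub>M (\<Pi>\<^sub>M i\<in>{1..<n}. (lborel :: real measure)))"
        by (rule measurable_compose[OF measurable_fst borel_measurable_indicator[OF B]])
      ultimately show ?thesis
        using joint_density_measurable unfolding case_prod_beta'
        by (intro borel_measurable_times_ennreal)
    qed
    from measurable_compose[OF measurable_pair_swap' this]
    show "(\<lambda>(y, s). joint_density p n s y * indicator A (y(n := s - T y)) * indicator B s)
      \<in> borel_measurable ((\<Pi>\<^sub>M i\<in>{1..<n}. lborel) \<Otimes>\<^sub>M lborel)"
      by (simp add: case_prod_beta' cong: measurable_cong_sets sets_pair_measure_cong)
  qed
  also have "\<dots> = (\<integral>\<^sup>+ s. (\<integral>\<^sup>+ y. joint_density p n s y * indicator A (y(n := s - T y))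
       \<partial>(\<Pi>\<^sub>M i\<in>{1..<n}. lborel)) * indicator B s \<partial>lborel)"
    by (intro nn_integral_cong) (auto simp: indicator_def)
  finally show ?thesis by (simp add: T_def)
qed

lemma sum_density_distributed:
  assumes "prob_space M" and n: "n \<ge> 1"
    and indep: "prob_space.indep_vars M (\<lambda>_. borel) X {1..}"
    and X: "\<And>i. i \<ge> 1 \<Longrightarrow> distributed M lborel (X i) (\<lambda>x. ennreal (p x))"
    and p0: "\<And>x. 0 \<le> p x"
  shows "distributed M lborel (\<lambda>\<omega>. \<Sum>i\<in>{1..n}. X i \<omega>) (sum_density p n)"
proof -
  interpret prob_space M by fact
  have rv [measurable]: "\<And>i. i \<in> {1..n} \<Longrightarrow> X i \<in> borel_measurable M"
    using distributed_measurable[OF X] by simp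
  have "distr M lborel (\<lambda>\<omega>. \<Sum>i\<in>{1..n}. X i \<omega>) = density lborel (sum_density p n)"
  proof (rule measure_eqI)
    fix B assume "B \<in> sets (distr M lborel (\<lambda>\<omega>. \<Sum>i\<in>{1..n}. X i \<omega>))"
    then have B: "B \<in> sets borel" by simp
    have c: "(\<lambda>y. y(n := s - (\<Sum>i\<in>{1..<n}. y i))) \<in> (\<Pi>\<^sub>M i\<in>{1..<n}. lborel) \<rightarrow>\<^sub>M (\<Pi>\<^sub>M i\<in>{1..n}. (borel :: real measure))" for s
      using measurable_compose[OF measurable_Pair1' complete_measurable[OF n], of s] by simp
    have "emeasure (distr M lborel (\<lambda>\<omega>. \<Sum>i\<in>{1..n}. X i \<omega>)) B
      = emeasure M {\<omega>\<in>space M. (\<lambda>i\<in>{1..n}. X i \<omega>) \<in> space (\<Pi>\<^sub>M i\<in>{1..n}. borel) \<and> (\<Sum>i\<in>{1..n}. X i \<omega>) \<in> B}"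
      using B by (subst emeasure_distr) (auto intro!: arg_cong[where f="emeasure M"] simp: space_PiM)
    also have "\<dots> = (\<integral>\<^sup>+ s. sum_density p n s * indicator B s \<partial>lborel)"
      unfolding sum_density_def
      by (subst iid_disintegration[OF assms sets.top B], assumption, intro nn_integral_cong arg_cong2[where f="(*)"] refl)
         (simp only: measurable_space[OF c] indicator_simps mult_1_right)
    finally show "emeasure (distr M lborel (\<lambda>\<omega>. \<Sum>i\<in>{1..n}. X i \<omega>)) B = emeasure (density lborel (sum_density p n)) B"
      using B by (simp add: emeasure_density)
  qed simp
  then show ?thesis
    by (simp add: distributed_def)
qed

lemma cond_law_disintegration:
  assumes "prob_space M" and n: "n \<ge> 1"
    and indep: "prob_space.indep_vars M (\<lambda>_. borel) X {1..}"
    and X: "\<And>i. i \<ge> 1 \<Longrightarrow> distributed M lborel (X i) (\<lambda>x. ennreal (p x))"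
    and p0: "\<And>x. 0 \<le> p x"
    and A: "A \<in> sets (\<Pi>\<^sub>M i\<in>{1..n}. borel)" and B: "B \<in> sets borel"
  shows "emeasure M {\<omega>\<in>space M. (\<lambda>i\<in>{1..n}. X i \<omega>) \<in> A \<and> (\<Sum>i\<in>{1..n}. X i \<omega>) \<in> B} =
    (\<integral>\<^sup>+ s\<in>B. sum_density p n s * emeasure (cond_law p n s) A \<partial>lborel)"
proof -
  interpret prob_space M by fact
  note d = sum_density_distributed[OF assms(1-5)]
  have "prob_space (density lborel (sum_density p n))"
    using prob_space_distr[OF distributed_measurable[OF d]]
    by (simp only: distributed_distr_eq_density[OF d])
  from prob_space.emeasure_space_1[OF this]
  have "(\<integral>\<^sup>+ s. sum_density p n s \<partial>lborel) \<noteq> \<infinity>" by (simp add: emeasure_density)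
  then have ae: "AE s in lborel. sum_density p n s \<noteq> \<infinity>"
    by (intro nn_integral_PInf_AE) auto
  show ?thesis
  proof (rule trans[OF iid_disintegration[OF assms] nn_integral_cong_AE], assumption,
      use ae in eventually_elim)
    fix s assume fin: "sum_density p n s \<noteq> \<infinity>"
    let ?H = "\<integral>\<^sup>+ y. joint_density p n s y * indicator A (y(n := s - (\<Sum>i\<in>{1..<n}. y i)))
       \<partial>(\<Pi>\<^sub>M i\<in>{1..<n}. lborel)"
    have le: "?H \<le> sum_density p n s"
      unfolding sum_density_def by (intro nn_integral_mono) (auto simp: indicator_def)
    have "sum_density p n s * (?H / sum_density p n s) = ?H"
    proof (cases "sum_density p n s = 0")
      case True with le show ?thesis by simp
    next
      case False with fin show ?thesis
        by (simp add: ennreal_times_divide mult.commute[of "sum_density p n s"] mult_divide_eq_ennreal)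
    qed
    then show "?H * indicator B s = sum_density p n s * emeasure (cond_law p n s) A * indicator B s"
      by (simp add: cond_law_emeasure[OF n A])
  qed
qed

end


section \<open>Exponential tilting\<close>

definition Phi :: "(real \<Rightarrow> real) \<Rightarrow> real \<Rightarrow> real" where
  "Phi p t = (LBINT x:{0..}. exp (t * x) * p x)"

definition tilt_mean :: "(real \<Rightarrow> real) \<Rightarrow> real \<Rightarrow> real" where
  "tilt_mean p = deriv (\<lambda>t. ln (Phi p t))"

definition tilted_density :: "(real \<Rightarrow> real) \<Rightarrow> real \<Rightarrow> real \<Rightarrow> real" where
  "tilted_density p a x = (let t = (THE t. tilt_mean p t = a) in exp (t * x) * p x / Phi p t)"


section \<open>Regularity classes\<close>

text \<open>The function l is in \<open>R0\<close> with index function e; e1 and e2 are the first two derivatives of e,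
  one-sided at 1.\<close>

definition R0_repr ::
    "(real \<Rightarrow> real) \<Rightarrow> (real \<Rightarrow> real) \<Rightarrow> (real \<Rightarrow> real) \<Rightarrow> (real \<Rightarrow> real) \<Rightarrow> bool" where
  "R0_repr l e e1 e2 \<longleftrightarrow>
     (\<forall>x\<ge>1. l x = exp (integral {1..x} (\<lambda>u. e u / u))) \<and>
     (\<forall>x\<ge>1. (e has_real_derivative e1 x) (at x within {1..})) \<and>
     (\<forall>x\<ge>1. (e1 has_real_derivative e2 x) (at x within {1..})) \<and>
     (e \<longlongrightarrow> 0) at_top"

definition R0 :: "(real \<Rightarrow> real) set" where
  "R0 = {l. \<exists>e e1 e2. R0_repr l e e1 e2}"

definition Rbeta :: "real \<Rightarrow> (real \<Rightarrow> real) set" where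
  "Rbeta \<beta> = {h. \<exists>l e e1 e2. R0_repr l e e1 e2 \<and>
     (\<forall>\<^sub>F x in at_top. h x = x powr \<beta> * l x) \<and>
     Limsup at_top (\<lambda>x. ereal (x * \<bar>e1 x\<bar>)) < \<infinity> \<and>
     Limsup at_top (\<lambda>x. ereal (x\<^sup>2 * \<bar>e2 x\<bar>)) < \<infinity>}"

definition R0_tilde :: "(real \<Rightarrow> real) set" where
  "R0_tilde = {l. \<exists>e e1 e2. R0_repr l e e1 e2 \<and>
     filterlim l at_top at_top \<and>
     ((\<lambda>x. x * e1 x / e x) \<longlongrightarrow> 0) at_top \<and>
     ((\<lambda>x. x\<^sup>2 * e2 x / e x) \<longlongrightarrow> 0) at_top \<and>
     (\<exists>\<eta>\<in>{0<..<1/4}. Liminf at_top (\<lambda>x. ereal (x powr \<eta> * e x)) > 0)}"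

text \<open>Functions on the positive half-line are modelled as total functions whose values on the
  nonpositive reals are irrelevant, so the infimum ranges over positive arguments only.\<close>

definition psi :: "(real \<Rightarrow> real) \<Rightarrow> real \<Rightarrow> real" where
  "psi h u = Inf {x. 0 < x \<and> u \<le> h x}"

definition Rinf :: "(real \<Rightarrow> real) set" where
  "Rinf = {h. strict_mono_on {0<..} h \<and> psi h \<in> R0_tilde}"

definition Rclass :: "(real \<Rightarrow> real) set" where
  "Rclass = (\<Union>\<beta>\<in>{0<..}. Rbeta \<beta>) \<union> Rinf"

end

theory Submission
  imports Defs
begin

text \<open>By the i.i.d. structure, \<open>Y 1\<close> has density \<open>\<pi> x * (\<pi>\<^sub>n\<^sub>-\<^sub>1 (n * a - x) / \<pi>\<^sub>n (n * a))\<close>, where \<open>\<pi>\<close> is the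
  tilted density and \<open>\<pi>\<^sub>k\<close> its k-fold convolution power. Since \<open>h = g'\<close> is eventually nondecreasing
  and \<open>q\<close> eventually bounded, \<open>\<pi>\<close> is log-concave up to constant factors; hence, rescaled around its mean
  to unit width, it is bounded by \<open>C * exp (- \<bar>y\<bar>)\<close> uniformly in the tilting parameter. For such
  densities, with characteristic function \<open>\<phi>\<close>, Fourier inversion writes the difference
  of the two convolution powers as an integral of \<open>\<phi> u ^ (n - 1) * (\<phi> u - exp (i * u * y))\<close>.
  Expanding the second factor to second order at \<open>u = 0\<close> shows that the quotient is
  \<open>1 + O ((1 + y\<^sup>2) / n)\<close> uniformly, so that Markov's inequality gives the claim.\<close>

section \<open>Bounded densities and their characteristic functions\<close>

text \<open>The tilting parameter moves with \<open>n\<close>, so the summands form a triangular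
  array and a limit theorem for one fixed density says nothing. Hence all estimates hold for every
  density with mean 0 whose supremum and third absolute moment are at most \<open>K\<close>, with
  constants built from \<open>K\<close> alone. The variance is not normalised: the bound on the
  supremum prevents concentration.

  No exact asymptotics are needed for the quotient, only a lower bound of order
  \<open>1 / sqrt n\<close> for the denominator and an upper bound of order
  \<open>(1 + y^2) / (n * sqrt n)\<close> for the difference. Taking absolute values in the linear
  term \<open>i * u * y\<close> would give only order \<open>1 / n\<close>, hence a relative error
  of order \<open>1 / sqrt n\<close>, exactly the size to be excluded. In the real part this term
  meets only the imaginary part of \<open>\<phi> u ^ (n - 1)\<close>, which centring makes of order
  \<open>n * |u|^3\<close>; this gains the missing factor.

  Conditioning refers to one value of the sum, so inversion is needed at every point, while
  uniqueness of densities gives it only almost everywhere; one more convolution removes the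
  exceptional set.\<close>

lemma (in real_distribution) gauss_smoothing_char:
  "(CLINT z|std_normal_distribution. char M (s * z) * iexp (- (s * z * x)))
    = of_real (LINT y|M. exp (- (s * (y - x))\<^sup>2 / 2))"
proof -
  interpret N: real_distribution std_normal_distribution by (rule real_dist_normal_dist)
  interpret P: pair_prob_space M std_normal_distribution ..
  have [measurable_cong]: "sets std_normal_distribution = sets borel" by simp
  have e: "char M (s * z) * iexp (- (s * z * x)) = (CLINT y|M. iexp (s * z * (y - x)))" for z
  proof -
    have "char M (s * z) * iexp (- (s * z * x)) = (CLINT y|M. iexp (s * z * y) * iexp (- (s * z * x)))"
      unfolding char_def by simp
    also have "\<dots> = (CLINT y|M. iexp (s * z * (y - x)))"
      by (intro Bochner_Integration.integral_cong refl)
        (simp add: exp_add[symmetric] algebra_simps)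
    finally show ?thesis .
  qed
  have "(CLINT z|std_normal_distribution. char M (s * z) * iexp (- (s * z * x)))
      = (CLINT z|std_normal_distribution. CLINT y|M. iexp (s * z * (y - x)))"
    by (simp only: e)
  also have "\<dots> = (CLINT y|M. CLINT z|std_normal_distribution. iexp (s * z * (y - x)))"
  proof (rule P.Fubini_integral)
    show "integrable (M \<Otimes>\<^sub>M std_normal_distribution) (\<lambda>(y, z). iexp (s * z * (y - x)))"
      by (rule P.integrable_const_bound[where B = 1]) (auto simp: case_prod_beta)
  qed
  also have "\<dots> = (CLINT y|M. char std_normal_distribution (s * (y - x)))"
    unfolding char_def by (intro Bochner_Integration.integral_cong refl) (simp add: mult_ac)
  also have "\<dots> = (CLINT y|M. of_real (exp (- (s * (y - x))\<^sup>2 / 2)))"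
    by (simp only: char_std_normal_distribution)
  finally show ?thesis by simp
qed

lemma integral_std_normal_scale:
  fixes F :: "real \<Rightarrow> 'a :: {banach, second_countable_topology}"
  assumes [measurable]: "F \<in> borel_measurable borel" and s: "0 < s"
  shows "integral\<^sup>L std_normal_distribution (\<lambda>z. F (s * z))
    = (LINT u|lborel. (exp (- (u / s)\<^sup>2 / 2) / (s * sqrt (2 * pi))) *\<^sub>R F u)"
proof -
  have "integral\<^sup>L std_normal_distribution (\<lambda>z. F (s * z))
     = (LINT z|lborel. std_normal_density z *\<^sub>R F (s * z))"
    by (subst integral_density) (auto simp: normal_density_nonneg)
  also have "\<dots> = \<bar>1/s\<bar> *\<^sub>R (LINT u|lborel. std_normal_density (0 + 1/s * u) *\<^sub>R F (s * (0 + 1/s * u)))"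
    using s by (intro lborel_integral_real_affine) auto
  also have "\<dots> = (LINT u|lborel. \<bar>1/s\<bar> *\<^sub>R (std_normal_density (0 + 1/s * u) *\<^sub>R F (s * (0 + 1/s * u))))"
    by (rule integral_scaleR_right[symmetric])
  also have "\<dots> = (LINT u|lborel. (exp (- (u / s)\<^sup>2 / 2) / (s * sqrt (2 * pi))) *\<^sub>R F u)"
    using s by (intro Bochner_Integration.integral_cong refl) (simp add: std_normal_density_def)
  finally show ?thesis .
qed

lemma gauss_integral:
  assumes s: "0 < s"
  shows "has_bochner_integral lborel (\<lambda>y::real. exp (- (s * (y - x))\<^sup>2 / 2)) (sqrt (2 * pi) / s)"
proof -
  have "has_bochner_integral lborel (\<lambda>y. sqrt (2 * pi) * std_normal_density y) (sqrt (2 * pi) * 1)"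
    using std_normal_distribution_even_moments[of 0]
    by (intro has_bochner_integral_mult_right)
      (auto simp: has_bochner_integral_iff integrable_normal_density integral_normal_density)
  then have "has_bochner_integral lborel (\<lambda>y. exp (- y\<^sup>2 / 2)) (sqrt (2 * pi))"
    by (simp add: std_normal_density_def real_sqrt_mult)
  then have "has_bochner_integral lborel (\<lambda>y. exp (- (- (s * x) + s * y)\<^sup>2 / 2)) (sqrt (2 * pi) /\<^sub>R \<bar>s\<bar>)"
    using s by (subst (asm) lborel_has_bochner_integral_real_affine_iff[of s _ _ "- (s * x)"]) auto
  moreover have "- (s * x) + s * y = s * (y - x)" for y by (simp add: right_diff_distrib)
  moreover have "sqrt (2 * pi) /\<^sub>R \<bar>s\<bar> = sqrt (2 * pi) / s" using s by (simp add: divide_inverse mult.commute)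
  ultimately show ?thesis by (simp only:)
qed

text \<open>Lets the total mass and the third absolute moment control all moments in
  between.\<close>

lemma power_le_1_cube: "j \<le> 3 \<Longrightarrow> \<bar>x\<bar> ^ j \<le> 1 + \<bar>x :: real\<bar> ^ 3"
proof (cases "\<bar>x\<bar> \<le> 1")
  case True
  then have "\<bar>x\<bar> ^ j \<le> 1" by (intro power_le_one) auto
  then show ?thesis by (simp add: add_increasing2)
next
  case False
  then have "\<bar>x\<bar> ^ j \<le> \<bar>x\<bar> ^ 3" if "j \<le> 3" using that by (intro power_increasing) auto
  then show "j \<le> 3 \<Longrightarrow> ?thesis" by simp
qed

text \<open>As \<open>1 - cos v\<close> is twice the square of \<open>sin (v / 2)\<close>, this is
  the square of \<open>|sin (k * w)| \<le> k * |sin w|\<close>, which follows from the addition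
  formula by induction.\<close>

lemma one_minus_cos_mult: "1 - cos (real k * v) \<le> (real k)\<^sup>2 * (1 - cos v)"
proof -
  have s: "\<bar>sin (real k * w)\<bar> \<le> real k * \<bar>sin w\<bar>" for w
  proof (induction k)
    case (Suc k)
    have "\<bar>sin (real (Suc k) * w)\<bar> = \<bar>sin (real k * w) * cos w + cos (real k * w) * sin w\<bar>"
      by (simp add: algebra_simps sin_add)
    also have "\<dots> \<le> \<bar>sin (real k * w)\<bar> * \<bar>cos w\<bar> + \<bar>cos (real k * w)\<bar> * \<bar>sin w\<bar>"
      by (rule order_trans[OF abs_triangle_ineq]) (simp add: abs_mult)
    also have "\<dots> \<le> \<bar>sin (real k * w)\<bar> * 1 + 1 * \<bar>sin w\<bar>"
      by (intro add_mono mult_mono) auto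
    finally show ?case using Suc by (simp add: algebra_simps)
  qed simp
  have c: "1 - cos v = 2 * (sin (v / 2))\<^sup>2" for v :: real
    using cos_double_sin[of "v / 2"] by simp
  have "(sin (real k * (v / 2)))\<^sup>2 \<le> (real k * \<bar>sin (v / 2)\<bar>)\<^sup>2"
    using s[of "v / 2"] by (metis abs_ge_zero power2_abs power_mono)
  then show ?thesis
    by (simp add: c power_mult_distrib)
qed

locale centered_density =
  fixes K :: real and f :: "real \<Rightarrow> real"
  assumes meas [measurable]: "f \<in> borel_measurable borel"
    and nonneg [simp]: "\<And>x. 0 \<le> f x"
    and le_K: "\<And>x. f x \<le> K"
    and integrable: "integrable lborel f"
    and integral_1: "integral\<^sup>L lborel f = 1"
    and mean_0: "(LINT x|lborel. x * f x) = 0"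
    and integrable_cube: "integrable lborel (\<lambda>x. \<bar>x\<bar> ^ 3 * f x)"
    and cube_le: "(LINT x|lborel. \<bar>x\<bar> ^ 3 * f x) \<le> K"
begin

lemma moment:
  assumes "j \<le> 3"
  shows integrable_moment: "integrable lborel (\<lambda>x. \<bar>x\<bar> ^ j * f x)"
    and moment_le: "(LINT x|lborel. \<bar>x\<bar> ^ j * f x) \<le> 1 + K"
proof -
  have i: "integrable lborel (\<lambda>x. f x + \<bar>x\<bar> ^ 3 * f x)"
    using integrable integrable_cube by simp
  have le: "\<bar>x\<bar> ^ j * f x \<le> f x + \<bar>x\<bar> ^ 3 * f x" for x
    using mult_right_mono[OF power_le_1_cube[OF assms, of x] nonneg[of x]] by (simp add: algebra_simps)
  show 1: "integrable lborel (\<lambda>x. \<bar>x\<bar> ^ j * f x)"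
    by (rule Bochner_Integration.integrable_bound[OF i]) (auto intro!: order_trans[OF le] simp: abs_mult)
  have "(LINT x|lborel. \<bar>x\<bar> ^ j * f x) \<le> (LINT x|lborel. f x + \<bar>x\<bar> ^ 3 * f x)"
    by (rule integral_mono[OF 1 i le])
  also have "\<dots> \<le> 1 + K"
    using integrable integrable_cube integral_1 cube_le by simp
  finally show "(LINT x|lborel. \<bar>x\<bar> ^ j * f x) \<le> 1 + K" .
qed

lemma K_pos: "0 < K"
proof (rule ccontr)
  assume "\<not> 0 < K"
  then have "f = (\<lambda>_. 0)" by (intro ext antisym order_trans[OF le_K]) auto
  then show False using integral_1 by simp
qed

definition D :: "real measure" where "D = density lborel (\<lambda>x. ennreal (f x))"

lemma sets_D [simp, measurable_cong]: "sets D = sets borel"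
  and space_D [simp]: "space D = UNIV"
  by (simp_all add: D_def)

lemma nn_integral_f: "(\<integral>\<^sup>+ x. ennreal (f x) \<partial>lborel) = 1"
  using integrable integral_1 by (subst nn_integral_eq_integral) auto

lemma real_distribution_D: "real_distribution D"
  by (intro real_distribution.intro real_distribution_axioms.intro prob_spaceI)
    (simp_all add: D_def emeasure_density nn_integral_f)

sublocale D: real_distribution D
  by (rule real_distribution_D)

lemma measure_D_UNIV [simp]: "measure D UNIV = 1"
  using D.prob_space by simp

lemma integral_D:
  fixes F :: "real \<Rightarrow> 'a :: {banach, second_countable_topology}"
  assumes [measurable]: "F \<in> borel_measurable borel"
  shows "integral\<^sup>L D F = (LINT x|lborel. f x *\<^sub>R F x)"
  unfolding D_def by (rule integral_density) auto

lemma integrable_D: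
  fixes F :: "real \<Rightarrow> 'a :: {banach, second_countable_topology}"
  assumes [measurable]: "F \<in> borel_measurable borel"
  shows "integrable D F \<longleftrightarrow> integrable lborel (\<lambda>x. f x *\<^sub>R F x)"
  unfolding D_def by (rule integrable_density) auto

section \<open>The characteristic function and its square integral\<close>

definition \<phi> :: "real \<Rightarrow> complex" where "\<phi> = char D"

lemma phi_meas [measurable]: "\<phi> \<in> borel_measurable borel"
  unfolding \<phi>_def by measurable

lemma norm_phi_le_1: "norm (\<phi> u) \<le> 1"
  unfolding \<phi>_def by (rule D.cmod_char_le_1)

text \<open>Up to the factor \<open>s * sqrt (2 * pi)\<close>, the left side is the average over two
  independent copies from \<open>D\<close> of a Gaussian kernel in their difference. Replacing one
  density by \<open>K\<close> bounds the inner average by \<open>K * sqrt (2 * pi) / s\<close>. The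
  Gaussian weight is present because square integrability of \<open>\<phi>\<close> is not yet
  known.\<close>

lemma plancherel_gauss:
  assumes s: "0 < s"
  shows "(LINT u|lborel. exp (- (u / s)\<^sup>2 / 2) * (norm (\<phi> u))\<^sup>2) \<le> 2 * pi * K"
proof -
  interpret N: real_distribution std_normal_distribution by (rule real_dist_normal_dist)
  interpret P: pair_prob_space D std_normal_distribution ..
  have [measurable_cong]: "sets std_normal_distribution = sets borel" by simp
  \<comment> \<open>Only the conjugate factor is expanded into an integral over \<open>D\<close>;
    the other stays a characteristic function, so that \<open>gauss_smoothing_char\<close> applies
    after the order of integration is exchanged.\<close>
  have e: "of_real ((norm (\<phi> v))\<^sup>2) = (CLINT x|D. \<phi> v * iexp (- (v * x)))" for v
  proof -
    have "of_real ((norm (\<phi> v))\<^sup>2) = \<phi> v * cnj (\<phi> v)"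
      by (rule complex_norm_square)
    also have "cnj (\<phi> v) = (CLINT x|D. cnj (iexp (v * x)))"
      unfolding \<phi>_def char_def by (rule Bochner_Integration.integral_cnj[symmetric])
    also have "\<dots> = (CLINT x|D. iexp (- (v * x)))"
      by (intro Bochner_Integration.integral_cong refl) (simp add: exp_cnj)
    finally show ?thesis by simp
  qed
  have b: "(LINT y|D. exp (- (s * (y - x))\<^sup>2 / 2)) \<le> K * (sqrt (2 * pi) / s)" for x
  proof -
    have i: "integrable lborel (\<lambda>y. K * exp (- (s * (y - x))\<^sup>2 / 2))"
      "(LINT y|lborel. K * exp (- (s * (y - x))\<^sup>2 / 2)) = K * (sqrt (2 * pi) / s)"
      using has_bochner_integral_mult_right[OF gauss_integral[OF s, of x], of K]
      by (auto simp: has_bochner_integral_iff)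
    have le: "f y *\<^sub>R exp (- (s * (y - x))\<^sup>2 / 2) \<le> K * exp (- (s * (y - x))\<^sup>2 / 2)" for y
      using le_K[of y] by (auto intro!: mult_right_mono)
    show ?thesis
      unfolding i(2)[symmetric]
      by (subst integral_D, measurable, rule integral_mono[OF _ i(1) le],
          rule Bochner_Integration.integrable_bound[OF i(1)])
        (use le in \<open>auto intro!: mult_right_mono simp: abs_mult le_K K_pos less_imp_le\<close>)
  qed
  have "complex_of_real (LINT z|std_normal_distribution. (norm (\<phi> (s * z)))\<^sup>2)
    = (CLINT z|std_normal_distribution. CLINT x|D. \<phi> (s * z) * iexp (- (s * z * x)))"
    by (simp only: e integral_complex_of_real[symmetric])
  also have "\<dots> = (CLINT x|D. CLINT z|std_normal_distribution. \<phi> (s * z) * iexp (- (s * z * x)))"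
    by (rule P.Fubini_integral, rule P.integrable_const_bound[where B = 1])
      (auto simp: case_prod_beta norm_mult norm_phi_le_1)
  also have "\<dots> = of_real (LINT x|D. LINT y|D. exp (- (s * (y - x))\<^sup>2 / 2))"
    unfolding \<phi>_def D.gauss_smoothing_char by simp
  finally have "(LINT z|std_normal_distribution. (norm (\<phi> (s * z)))\<^sup>2)
      = (LINT x|D. LINT y|D. exp (- (s * (y - x))\<^sup>2 / 2))"
    by (simp only: of_real_eq_iff)
  also have "\<dots> \<le> K * (sqrt (2 * pi) / s)"
  proof (rule D.integral_le_const)
    show "integrable D (\<lambda>x. LINT y|D. exp (- (s * (y - x))\<^sup>2 / 2))"
      by (rule D.integrable_const_bound[where B = 1])
        (auto intro!: D.integral_le_const D.integrable_const_bound[where B = 1] simp: abs_of_nonneg)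
    show "AE x in D. (LINT y|D. exp (- (s * (y - x))\<^sup>2 / 2)) \<le> K * (sqrt (2 * pi) / s)"
      by (intro AE_I2 b)
  qed
  finally have "(LINT z|std_normal_distribution. (norm (\<phi> (s * z)))\<^sup>2) \<le> K * (sqrt (2 * pi) / s)" .
  also have "(LINT z|std_normal_distribution. (norm (\<phi> (s * z)))\<^sup>2)
    = (LINT u|lborel. (exp (- (u / s)\<^sup>2 / 2) * (norm (\<phi> u))\<^sup>2) / (s * sqrt (2 * pi)))"
    by (subst integral_std_normal_scale[OF _ s, of "\<lambda>u. (norm (\<phi> u))\<^sup>2"]) auto
  also have "\<dots> = (LINT u|lborel. exp (- (u / s)\<^sup>2 / 2) * (norm (\<phi> u))\<^sup>2) / (s * sqrt (2 * pi))"
    by simp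
  finally show ?thesis
    using s by (simp add: field_simps)
qed

text \<open>The weights tend to 1 as the width grows and the bound does not depend on the width, so
  Fatou's lemma removes them.\<close>

lemma plancherel: "(\<integral>\<^sup>+ u. ennreal ((norm (\<phi> u))\<^sup>2) \<partial>lborel) \<le> ennreal (2 * pi * K)"
proof -
  define w where "w = (\<lambda>(i::nat) u. exp (- (u / real (Suc i))\<^sup>2 / 2) * (norm (\<phi> u))\<^sup>2)"
  have [measurable]: "w i \<in> borel_measurable borel" for i unfolding w_def by measurable
  have lim: "(\<lambda>i. ennreal (w i u)) \<longlonglongrightarrow> ennreal ((norm (\<phi> u))\<^sup>2)" for u
  proof (rule tendsto_ennrealI)
    have "(\<lambda>i. u / real (Suc i)) \<longlonglongrightarrow> 0"
      by (intro tendsto_divide_0[OF tendsto_const] filterlim_at_top_imp_at_infinity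
          filterlim_compose[OF filterlim_real_sequentially filterlim_Suc])
    then have "(\<lambda>i. w i u) \<longlonglongrightarrow> exp (- 0\<^sup>2 / 2) * (norm (\<phi> u))\<^sup>2"
      unfolding w_def by (intro tendsto_intros) auto
    then show "(\<lambda>i. w i u) \<longlonglongrightarrow> (norm (\<phi> u))\<^sup>2"
      by simp
  qed
  have int: "integrable lborel (w i)" for i
  proof -
    have g: "integrable lborel (\<lambda>u. exp (- (1 / real (Suc i) * (u - 0))\<^sup>2 / 2))"
      using gauss_integral[of "1 / real (Suc i)" 0] by (simp only: has_bochner_integral_iff) simp
    show ?thesis
      unfolding w_def
      by (rule Bochner_Integration.integrable_bound[OF g])
        (auto simp: norm_mult norm_phi_le_1 power_le_one mult_left_le)
  qed
  have "(\<integral>\<^sup>+ u. ennreal ((norm (\<phi> u))\<^sup>2) \<partial>lborel) = (\<integral>\<^sup>+ u. liminf (\<lambda>i. ennreal (w i u)) \<partial>lborel)"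
    by (intro nn_integral_cong) (rule lim_imp_Liminf[OF _ lim, symmetric], simp)
  also have "\<dots> \<le> liminf (\<lambda>i. \<integral>\<^sup>+ u. ennreal (w i u) \<partial>lborel)"
    by (rule nn_integral_liminf) simp
  also have "\<dots> \<le> liminf (\<lambda>i::nat. ennreal (2 * pi * K))"
  proof (intro Liminf_mono always_eventually allI)
    fix i
    have "(\<integral>\<^sup>+ u. ennreal (w i u) \<partial>lborel) = ennreal (LINT u|lborel. w i u)"
      by (rule nn_integral_eq_integral[OF int]) (simp add: w_def)
    also have "\<dots> \<le> ennreal (2 * pi * K)"
      unfolding w_def by (intro ennreal_leI plancherel_gauss) simp
    finally show "(\<integral>\<^sup>+ u. ennreal (w i u) \<partial>lborel) \<le> ennreal (2 * pi * K)" .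
  qed
  also have "\<dots> = ennreal (2 * pi * K)"
    by (simp add: Liminf_const)
  finally show ?thesis .
qed

lemma integrable_phi_sq: "integrable lborel (\<lambda>u. (norm (\<phi> u))\<^sup>2)"
  using plancherel by (intro integrableI_nonneg) (auto intro: le_less_trans)

lemma integral_phi_sq: "(LINT u|lborel. (norm (\<phi> u))\<^sup>2) \<le> 2 * pi * K"
  using plancherel integrable_phi_sq K_pos
  by (subst (asm) nn_integral_eq_integral) auto

section \<open>Decay of the characteristic function away from the origin\<close>

lemma phi_integral: "\<phi> u = (CLINT y|D. iexp (u * y))"
  by (simp add: \<phi>_def char_def)

text \<open>Rotating by the phase \<open>\<theta>\<close> of \<open>\<phi> u\<close> turns
  \<open>1 - norm (\<phi> u)\<close> into the mean of \<open>1 - cos (u * y - \<theta>)\<close>. At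
  \<open>k * u\<close> the phase \<open>k * \<theta>\<close> need not be optimal, but it still
  bounds the modulus from below, and \<open>one_minus_cos_mult\<close> applies under the
  integral.\<close>

lemma norm_phi_mult: "1 - norm (\<phi> (real k * u)) \<le> (real k)\<^sup>2 * (1 - norm (\<phi> u))"
proof -
  define \<theta> where "\<theta> = Arg (\<phi> u)"
  have rot: "Re (iexp (- a) * \<phi> v) = (LINT y|D. cos (v * y - a))" for a v
  proof -
    have "iexp (- a) * \<phi> v = (CLINT y|D. iexp (v * y - a))"
      unfolding phi_integral
      by (subst integral_mult_right_zero[symmetric], intro Bochner_Integration.integral_cong refl)
        (simp add: exp_add[symmetric] algebra_simps)
    also have "Re \<dots> = (LINT y|D. Re (iexp (v * y - a)))"
      by (rule integral_Re[symmetric], rule D.integrable_const_bound[where B = 1]) auto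
    finally show ?thesis by (simp add: Re_exp)
  qed
  have i: "integrable D (\<lambda>y. cos (v * y - a))" for v a
    by (rule D.integrable_const_bound[where B = 1]) auto
  have "norm (\<phi> u) = Re (iexp (- \<theta>) * \<phi> u)"
  proof -
    have "\<phi> u = of_real (norm (\<phi> u)) * iexp \<theta>"
      using rcis_cmod_Arg[of "\<phi> u"] by (simp add: rcis_def cis_conv_exp \<theta>_def)
    then have "iexp (- \<theta>) * \<phi> u = of_real (norm (\<phi> u)) * (iexp \<theta> * iexp (- \<theta>))"
      by (metis mult.left_commute mult.commute)
    also have "iexp \<theta> * iexp (- \<theta>) = 1" by (simp add: exp_add[symmetric])
    finally show ?thesis by simp
  qed
  then have 1: "1 - norm (\<phi> u) = (LINT y|D. 1 - cos (u * y - \<theta>))"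
    using i by (simp only: rot) simp
  have "1 - norm (\<phi> (real k * u)) \<le> 1 - Re (iexp (- (real k * \<theta>)) * \<phi> (real k * u))"
    using complex_Re_le_cmod[of "iexp (- (real k * \<theta>)) * \<phi> (real k * u)"] by (simp add: norm_mult)
  also have "\<dots> = (LINT y|D. 1 - cos (real k * (u * y - \<theta>)))"
    using i[of "real k * u" "real k * \<theta>"] by (simp only: rot) (simp add: algebra_simps)
  also have "\<dots> \<le> (LINT y|D. (real k)\<^sup>2 * (1 - cos (u * y - \<theta>)))"
    using i[of "real k * u" "real k * \<theta>"] i[of u \<theta>]
    by (intro integral_mono one_minus_cos_mult) (auto simp: algebra_simps intro!: integrable_mult_right)
  also have "\<dots> = (real k)\<^sup>2 * (1 - norm (\<phi> u))"
    unfolding 1 by simp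
  finally show ?thesis .
qed

lemma phi_lipschitz: "norm (\<phi> u - \<phi> v) \<le> (1 + K) * \<bar>u - v\<bar>"
proof -
  have i: "complex_integrable D (\<lambda>y. iexp (u * y))" for u
    by (rule D.integrable_const_bound[where B = 1]) auto
  have im: "integrable D (\<lambda>y. \<bar>u - v\<bar> * \<bar>y\<bar>)"
    using integrable_moment[of 1] by (auto simp: integrable_D mult_ac intro!: integrable_mult_right)
  have "norm (\<phi> u - \<phi> v) = norm (CLINT y|D. iexp (u * y) - iexp (v * y))"
    unfolding phi_integral using i by simp
  also have "\<dots> \<le> (LINT y|D. norm (iexp (u * y) - iexp (v * y)))"
    by (rule integral_norm_bound)
  also have "\<dots> \<le> (LINT y|D. \<bar>u - v\<bar> * \<bar>y\<bar>)"
  proof (rule integral_mono[OF _ im])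
    show "integrable D (\<lambda>y. norm (iexp (u * y) - iexp (v * y)))" using i by simp
    fix y
    have "norm (iexp (u * y) - iexp (v * y)) = norm (iexp (v * y) * (iexp ((u - v) * y) - 1))"
      by (simp add: algebra_simps exp_add[symmetric])
    also have "\<dots> \<le> \<bar>(u - v) * y\<bar>"
      using iexp_approx1[of "(u - v) * y" 0] by (simp add: norm_mult)
    finally show "norm (iexp (u * y) - iexp (v * y)) \<le> \<bar>u - v\<bar> * \<bar>y\<bar>" by (simp add: abs_mult)
  qed
  also have "\<dots> = \<bar>u - v\<bar> * (LINT y|lborel. \<bar>y\<bar> ^ 1 * f y)"
    by (simp add: integral_D mult_ac)
  also have "\<dots> \<le> \<bar>u - v\<bar> * (1 + K)"
    by (intro mult_left_mono moment_le) auto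
  finally show ?thesis by (simp add: mult.commute)
qed

end

text \<open>Large enough for a contradiction: this many disjoint intervals of length
  \<open>1 / (2 * (1 + K))\<close>, with \<open>(norm (\<phi> v))\<^sup>2 \<ge> 1 / 4\<close> on
  each, would carry more than the total \<open>2 * pi * K\<close> allowed by
  \<open>plancherel\<close>.\<close>

definition decay_count :: "real \<Rightarrow> nat" where
  "decay_count K = nat \<lceil>16 * pi * K * (1 + K)\<rceil> + 1"

text \<open>A quarter of the gap in \<open>norm_phi_gap\<close>; the factor 4 is lost when the gap
  is carried to small arguments.\<close>

definition decay :: "real \<Rightarrow> real" where
  "decay K = 1 / (16 * (real (decay_count K))\<^sup>2)"

lemma decay_pos: "0 < decay K"
  by (simp add: decay_def decay_count_def)

context centered_density begin

text \<open>If \<open>norm (\<phi> u)\<close> were too close to 1, then the same would hold near all the multiples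
  of \<open>u\<close> up to \<open>decay_count K\<close>, which contradicts the bound on the square integral.\<close>

lemma norm_phi_gap:
  assumes u: "1 \<le> \<bar>u\<bar>"
  shows "norm (\<phi> u) \<le> 1 - 1 / (4 * (real (decay_count K))\<^sup>2)"
proof (rule ccontr)
  define N where "N = decay_count K"
  define w where "w = 1 / (4 * (1 + K))"
  define I where "I k = {real k * u - w .. real k * u + w}" for k
  assume "\<not> ?thesis"
  then have gap: "1 - norm (\<phi> u) \<le> 1 / (4 * (real N)\<^sup>2)" by (simp add: N_def)
  have N0: "0 < real N" by (simp add: N_def decay_count_def)
  have N: "16 * pi * K * (1 + K) < real N" unfolding N_def decay_count_def by linarith
  have w: "0 < w" "w < 1 / 4" using K_pos by (auto simp: w_def field_simps)
  have big: "1 / 4 \<le> (norm (\<phi> v))\<^sup>2" if "v \<in> I k" "k \<in> {1..N}" for v k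
  proof -
    have "(real k)\<^sup>2 \<le> (real N)\<^sup>2" using that by simp
    have "1 - norm (\<phi> (real k * u)) \<le> (real k)\<^sup>2 * (1 - norm (\<phi> u))" by (rule norm_phi_mult)
    also have "\<dots> \<le> (real N)\<^sup>2 * (1 / (4 * (real N)\<^sup>2))"
      using gap norm_phi_le_1[of u] \<open>(real k)\<^sup>2 \<le> (real N)\<^sup>2\<close> by (intro mult_mono) auto
    also have "\<dots> = 1 / 4" using N0 by simp
    finally have 1: "3 / 4 \<le> norm (\<phi> (real k * u))" by simp
    have "norm (\<phi> (real k * u) - \<phi> v) \<le> (1 + K) * \<bar>real k * u - v\<bar>" by (rule phi_lipschitz)
    also have "\<dots> \<le> (1 + K) * w" using that(1) K_pos by (intro mult_left_mono) (auto simp: I_def)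
    also have "\<dots> = 1 / 4" using K_pos by (simp add: w_def)
    finally have "1 / 2 \<le> norm (\<phi> v)" using 1 norm_triangle_ineq2[of "\<phi> (real k * u)" "\<phi> v"] by linarith
    then have "(1 / 2)\<^sup>2 \<le> (norm (\<phi> v))\<^sup>2" by (intro power_mono) auto
    then show ?thesis by (simp add: power2_eq_square)
  qed
  have disj: "disjoint_family_on I {1..N}"
  proof (unfold disjoint_family_on_def, intro ballI impI)
    fix j k :: nat assume "j \<noteq> k"
    then have "1 \<le> \<bar>real j - real k\<bar>" by linarith
    then have "1 \<le> \<bar>real j - real k\<bar> * \<bar>u\<bar>" using u by (metis mult_mono mult_1 abs_ge_zero zero_le_one)
    then have "1 \<le> \<bar>real j * u - real k * u\<bar>" by (simp add: abs_mult[symmetric] left_diff_distrib)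
    then show "I j \<inter> I k = {}" using w by (auto simp: I_def)
  qed
  have "ennreal (real N * w / 2) = ennreal (1 / 4) * (\<Sum>k\<in>{1..N}. emeasure lborel (I k))"
    using w by (simp add: I_def sum_ennreal[symmetric] ennreal_mult[symmetric] ennreal_of_nat_eq_real_of_nat)
  also have "\<dots> = ennreal (1 / 4) * emeasure lborel (\<Union>k\<in>{1..N}. I k)"
    using disj by (subst sum_emeasure) (auto simp: I_def)
  also have "\<dots> = (\<integral>\<^sup>+ v. ennreal (1 / 4) * indicator (\<Union>k\<in>{1..N}. I k) v \<partial>lborel)"
    by (subst nn_integral_cmult_indicator) (auto simp: I_def)
  also have "\<dots> \<le> (\<integral>\<^sup>+ v. ennreal ((norm (\<phi> v))\<^sup>2) \<partial>lborel)"
    by (intro nn_integral_mono) (auto simp: indicator_def intro!: ennreal_leI dest: big)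
  also have "\<dots> \<le> ennreal (2 * pi * K)" by (rule plancherel)
  finally have "real N * w / 2 \<le> 2 * pi * K"
    using K_pos by (subst (asm) ennreal_le_iff) auto
  then show False using N K_pos by (simp add: w_def field_simps)
qed

text \<open>Some multiple \<open>k * u\<close> with \<open>k \<le> 2 / \<bar>u\<bar>\<close> lies
  outside the unit interval, where the gap is available; \<open>norm_phi_mult\<close> brings it back
  to \<open>u\<close> at the cost of the factor \<open>k\<^sup>2\<close>. This yields quadratic
  decay without any lower bound on the variance.\<close>

lemma norm_phi_small:
  assumes "\<bar>u\<bar> \<le> 1"
  shows "norm (\<phi> u) \<le> exp (- (decay K * u\<^sup>2))"
proof (cases "u = 0")
  case False
  define \<delta> where "\<delta> = 1 / (4 * (real (decay_count K))\<^sup>2)"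
  have \<delta>: "0 < \<delta>" "decay K = \<delta> / 4" by (auto simp: \<delta>_def decay_def decay_count_def)
  define k where "k = nat \<lceil>1 / \<bar>u\<bar>\<rceil>"
  have k1: "1 / \<bar>u\<bar> \<le> real k" unfolding k_def by linarith
  have "real k \<le> 1 / \<bar>u\<bar> + 1" unfolding k_def using False by simp
  also have "\<dots> \<le> 2 / \<bar>u\<bar>" using assms False proof -
    have "1 \<le> 1 / \<bar>u\<bar>" using assms False by simp
    moreover have "2 / \<bar>u\<bar> = 1 / \<bar>u\<bar> + 1 / \<bar>u\<bar>" by simp
    ultimately show ?thesis by linarith
  qed
  finally have k2: "real k \<le> 2 / \<bar>u\<bar>" .
  have "1 \<le> \<bar>real k * u\<bar>" using k1 False by (simp add: abs_mult field_simps)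
  from norm_phi_gap[OF this] have "\<delta> \<le> 1 - norm (\<phi> (real k * u))" by (simp add: \<delta>_def)
  also have "\<dots> \<le> (real k)\<^sup>2 * (1 - norm (\<phi> u))" by (rule norm_phi_mult)
  also have "\<dots> \<le> (2 / \<bar>u\<bar>)\<^sup>2 * (1 - norm (\<phi> u))"
    using k2 norm_phi_le_1[of u] by (intro mult_right_mono power_mono) auto
  finally have "decay K * u\<^sup>2 \<le> 1 - norm (\<phi> u)"
    using False by (simp add: \<delta> power_divide field_simps)
  then show ?thesis
    using exp_ge_add_one_self[of "- (decay K * u\<^sup>2)"] by linarith
qed (simp add: norm_phi_le_1)

lemma norm_phi_large:
  assumes "1 \<le> \<bar>u\<bar>"
  shows "norm (\<phi> u) \<le> exp (- decay K)"
proof -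
  have "decay K \<le> 1 / (4 * (real (decay_count K))\<^sup>2)"
    by (simp add: decay_def decay_count_def field_simps)
  then show ?thesis
    using norm_phi_gap[OF assms] exp_ge_add_one_self[of "- decay K"] by linarith
qed

text \<open>The inversion integral for \<open>k + 1\<close> summands, numbered so as to match
  \<open>conv_pow\<close>. From \<open>k = 1\<close> on, the integrand is dominated by the
  integrable \<open>(norm (\<phi> u))\<^sup>2\<close>; for \<open>k = 0\<close> the function
  \<open>\<phi>\<close> itself may fail to be integrable.\<close>

definition G :: "nat \<Rightarrow> real \<Rightarrow> complex" where
  "G k x = (CLBINT u. \<phi> u ^ Suc k * iexp (- (u * x))) / of_real (2 * pi)"

lemma integrable_phi_power:
  assumes "1 \<le> k"
  shows "integrable lborel (\<lambda>u. norm (\<phi> u) ^ Suc k)"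
proof (rule Bochner_Integration.integrable_bound[OF integrable_phi_sq])
  show "AE u in lborel. norm (norm (\<phi> u) ^ Suc k) \<le> norm ((norm (\<phi> u))\<^sup>2)"
    using assms by (auto intro!: AE_I2 power_decreasing norm_phi_le_1 simp del: power_Suc)
qed simp

lemma integrable_G:
  assumes "1 \<le> k"
  shows "complex_integrable lborel (\<lambda>u. \<phi> u ^ Suc k * iexp (- (u * x)))"
  by (rule Bochner_Integration.integrable_bound[OF integrable_phi_power[OF assms]])
    (auto simp: norm_mult norm_power simp del: power_Suc)

section \<open>The sum of two copies: Gaussian smoothing and its removal\<close>

definition D2 :: "real measure" where "D2 = (D \<star> D)"

lemma sets_D2 [simp, measurable_cong]: "sets D2 = sets borel"
  and space_D2 [simp]: "space D2 = UNIV"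
  by (simp_all add: D2_def)

lemma real_distribution_D2: "real_distribution D2"
  unfolding D2_def convolution_def
proof (rule real_distribution.intro[OF prob_space.prob_space_distr])
  interpret P: pair_prob_space D D ..
  show "prob_space (D \<Otimes>\<^sub>M D)" by (rule P.prob_space_axioms)
qed (auto intro: real_distribution_axioms.intro)

sublocale D2: real_distribution D2
  by (rule real_distribution_D2)

lemma char_D2: "char D2 u = (\<phi> u)\<^sup>2"
proof -
  interpret P: pair_prob_space D D ..
  have i: "integrable (D \<Otimes>\<^sub>M D) (\<lambda>z. iexp (u * (fst z + snd z)))"
    by (rule P.integrable_const_bound[where B = 1]) auto
  have "char D2 u = (CLINT z|D \<Otimes>\<^sub>M D. iexp (u * (fst z + snd z)))"
    unfolding char_def D2_def convolution_def by (subst integral_distr) (auto simp: case_prod_beta)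
  also have "\<dots> = (CLINT x|D. CLINT y|D. iexp (u * (x + y)))"
    using P.integral_fst'[OF i] by simp
  also have "\<dots> = (CLINT x|D. CLINT y|D. iexp (u * x) * iexp (u * y))"
    by (simp add: exp_add[symmetric] algebra_simps)
  also have "\<dots> = \<phi> u * \<phi> u"
    by (simp add: phi_integral)
  finally show ?thesis by (simp add: power2_eq_square)
qed

text \<open>The density of \<open>Y + Z / s\<close> for \<open>Y\<close> with law \<open>D2\<close>
  and an independent standard normal \<open>Z\<close>.\<close>

definition smooth :: "real \<Rightarrow> real \<Rightarrow> real" where
  "smooth s x = s / sqrt (2 * pi) * (LINT y|D2. exp (- (s * (y - x))\<^sup>2 / 2))"

lemma smooth_fourier:
  assumes s: "0 < s"
  shows "of_real (smooth s x)
    = (CLBINT u. exp (- (u / s)\<^sup>2 / 2) *\<^sub>R (\<phi> u ^ Suc 1 * iexp (- (u * x)))) / of_real (2 * pi)"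
proof -
  have "complex_of_real (LINT y|D2. exp (- (s * (y - x))\<^sup>2 / 2))
      = (CLINT z|std_normal_distribution. (\<lambda>v. \<phi> v ^ Suc 1 * iexp (- (v * x))) (s * z))"
    by (subst D2.gauss_smoothing_char[symmetric]) (simp add: char_D2 power2_eq_square)
  also have "\<dots> = (CLBINT u. (exp (- (u / s)\<^sup>2 / 2) / (s * sqrt (2 * pi))) *\<^sub>R (\<phi> u ^ Suc 1 * iexp (- (u * x))))"
    by (rule integral_std_normal_scale[OF _ s]) simp
  also have "\<dots> = (CLBINT u. (1 / (s * sqrt (2 * pi))) *\<^sub>R (exp (- (u / s)\<^sup>2 / 2) *\<^sub>R (\<phi> u ^ Suc 1 * iexp (- (u * x)))))"
    by (simp add: field_simps)
  also have "\<dots> = (1 / (s * sqrt (2 * pi))) *\<^sub>R (CLBINT u. exp (- (u / s)\<^sup>2 / 2) *\<^sub>R (\<phi> u ^ Suc 1 * iexp (- (u * x))))"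
    by (rule integral_scaleR_right)
  finally have e: "complex_of_real (LINT y|D2. exp (- (s * (y - x))\<^sup>2 / 2))
    = (1 / (s * sqrt (2 * pi))) *\<^sub>R (CLBINT u. exp (- (u / s)\<^sup>2 / 2) *\<^sub>R (\<phi> u ^ Suc 1 * iexp (- (u * x))))" .
  have c: "s / sqrt (2 * pi) * (1 / (s * sqrt (2 * pi))) = 1 / (2 * pi)"
    using s by (simp add: field_simps)
  have "complex_of_real (smooth s x)
     = (s / sqrt (2 * pi)) *\<^sub>R complex_of_real (LINT y|D2. exp (- (s * (y - x))\<^sup>2 / 2))"
    by (simp only: smooth_def scaleR_conv_of_real of_real_mult)
  also have "\<dots> = (1 / (2 * pi)) *\<^sub>R (CLBINT u. exp (- (u / s)\<^sup>2 / 2) *\<^sub>R (\<phi> u ^ Suc 1 * iexp (- (u * x))))"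
    unfolding e scaleR_scaleR c ..
  finally show ?thesis
    by (simp only: scaleR_conv_of_real of_real_divide of_real_1 times_divide_eq_left mult_1)
qed

lemma smooth_nonneg: "0 < s \<Longrightarrow> 0 \<le> smooth s x"
  unfolding smooth_def by (intro mult_nonneg_nonneg Bochner_Integration.integral_nonneg) auto

text \<open>The definition alone gives a bound growing with \<open>s\<close>. The Fourier form
  together with the bound on the square integral gives one that is free of \<open>s\<close>, as
  dominated convergence requires later.\<close>

lemma smooth_le:
  assumes s: "0 < s"
  shows "smooth s x \<le> K"
proof -
  have "smooth s x = norm (complex_of_real (smooth s x))" using smooth_nonneg[OF s, of x] by simp
  also have "\<dots> = norm (CLBINT u. exp (- (u / s)\<^sup>2 / 2) *\<^sub>R (\<phi> u ^ Suc 1 * iexp (- (u * x)))) / (2 * pi)"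
    unfolding smooth_fourier[OF s] by (simp add: norm_divide norm_mult)
  also have "\<dots> \<le> (LINT u|lborel. (norm (\<phi> u))\<^sup>2) / (2 * pi)"
  proof (intro divide_right_mono)
    show "norm (CLBINT u. exp (- (u / s)\<^sup>2 / 2) *\<^sub>R (\<phi> u ^ Suc 1 * iexp (- (u * x)))) \<le> (LINT u|lborel. (norm (\<phi> u))\<^sup>2)"
      by (rule Bochner_Integration.integral_norm_bound_integral[OF Bochner_Integration.integrable_bound[OF integrable_phi_sq] integrable_phi_sq])
        (auto simp: norm_mult power2_eq_square intro!: mult_left_le_one_le)
  qed auto
  also have "\<dots> \<le> 2 * pi * K / (2 * pi)"
    by (intro divide_right_mono integral_phi_sq) auto
  finally show ?thesis by simp
qed

lemma smooth_lim: "(\<lambda>i. complex_of_real (smooth (real (Suc i)) x)) \<longlonglongrightarrow> G 1 x"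
proof -
  have "(\<lambda>i. CLBINT u. exp (- (u / real (Suc i))\<^sup>2 / 2) *\<^sub>R (\<phi> u ^ Suc 1 * iexp (- (u * x))))
      \<longlonglongrightarrow> (CLBINT u. \<phi> u ^ Suc 1 * iexp (- (u * x)))"
  proof (rule integral_dominated_convergence[where w = "\<lambda>u. (norm (\<phi> u))\<^sup>2"])
    show "AE u in lborel. (\<lambda>i. exp (- (u / real (Suc i))\<^sup>2 / 2) *\<^sub>R (\<phi> u ^ Suc 1 * iexp (- (u * x))))
        \<longlonglongrightarrow> \<phi> u ^ Suc 1 * iexp (- (u * x))"
    proof (intro AE_I2)
      fix u :: real
      have "(\<lambda>i. u / real (Suc i)) \<longlonglongrightarrow> 0"
        by (intro tendsto_divide_0[OF tendsto_const] filterlim_at_top_imp_at_infinity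
            filterlim_compose[OF filterlim_real_sequentially filterlim_Suc])
      then have "(\<lambda>i. exp (- (u / real (Suc i))\<^sup>2 / 2) *\<^sub>R (\<phi> u ^ Suc 1 * iexp (- (u * x))))
        \<longlonglongrightarrow> exp (- 0\<^sup>2 / 2) *\<^sub>R (\<phi> u ^ Suc 1 * iexp (- (u * x)))"
        by (intro tendsto_intros) auto
      then show "(\<lambda>i. exp (- (u / real (Suc i))\<^sup>2 / 2) *\<^sub>R (\<phi> u ^ Suc 1 * iexp (- (u * x))))
        \<longlonglongrightarrow> \<phi> u ^ Suc 1 * iexp (- (u * x))" by simp
    qed
    show "AE u in lborel. norm (exp (- (u / real (Suc i))\<^sup>2 / 2) *\<^sub>R (\<phi> u ^ Suc 1 * iexp (- (u * x)))) \<le> (norm (\<phi> u))\<^sup>2" for i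
      by (auto simp: norm_mult power2_eq_square intro!: mult_left_le_one_le)
  qed (auto simp: integrable_phi_sq)
  then show ?thesis
    unfolding G_def by (subst smooth_fourier, simp) (intro tendsto_intros, auto)
qed

lemma G1:
  shows G1_real: "G 1 x = of_real (Re (G 1 x))"
    and G1_nonneg: "0 \<le> Re (G 1 x)"
    and smooth_lim_Re: "(\<lambda>i. smooth (real (Suc i)) x) \<longlonglongrightarrow> Re (G 1 x)"
    and G1_le: "Re (G 1 x) \<le> K"
proof -
  show r: "(\<lambda>i. smooth (real (Suc i)) x) \<longlonglongrightarrow> Re (G 1 x)"
    using tendsto_Re[OF smooth_lim[of x]] by simp
  have "(\<lambda>i. 0) \<longlonglongrightarrow> Im (G 1 x)"
    using tendsto_Im[OF smooth_lim[of x]] by simp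
  then have "Im (G 1 x) = 0" by (simp add: LIMSEQ_const_iff)
  then show "G 1 x = of_real (Re (G 1 x))" by (simp add: complex_eq_iff)
  show "0 \<le> Re (G 1 x)"
    by (rule LIMSEQ_le_const[OF r]) (intro exI allI impI smooth_nonneg, simp)
  show "Re (G 1 x) \<le> K"
    by (rule LIMSEQ_le_const2[OF r]) (intro exI allI impI smooth_le, simp)
qed

end

section \<open>Fourier inversion for convolution powers\<close>

text \<open>The index counts convolutions, not factors: \<open>conv_pow f k\<close> belongs to
  \<open>k + 1\<close> summands. Hence \<open>n - 1\<close> and \<open>n - 2\<close> below stand for
  \<open>n\<close> and \<open>n - 1\<close> summands.\<close>

primrec conv_pow :: "(real \<Rightarrow> real) \<Rightarrow> nat \<Rightarrow> real \<Rightarrow> ennreal" where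
  "conv_pow f 0 s = ennreal (f s)"
| "conv_pow f (Suc k) s = (\<integral>\<^sup>+ x. ennreal (f x) * conv_pow f k (s - x) \<partial>lborel)"

lemma conv_pow_measurable [measurable]:
  assumes [measurable]: "f \<in> borel_measurable borel"
  shows "conv_pow f k \<in> borel_measurable borel"
proof (induction k)
  case (Suc k)
  note [measurable] = Suc
  have "(\<lambda>s. \<integral>\<^sup>+ x. ennreal (f x) * conv_pow f k (s - x) \<partial>lborel) \<in> borel_measurable borel"
    by measurable
  then show ?case by (simp cong: measurable_cong)
qed simp

context centered_density begin

lemma D2_density: "D2 = density lborel (conv_pow f 1)"
proof -
  have "density lborel (\<lambda>x. ennreal (f x)) \<star> density lborel (\<lambda>x. ennreal (f x))
     = density lborel (\<lambda>x. \<integral>\<^sup>+y. ennreal (f (x - y)) * ennreal (f y) \<partial>lborel)"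
    by (rule convolution_density) (auto simp: D_def[symmetric] intro: D.finite_measure_axioms)
  moreover have "conv_pow f 1 = (\<lambda>x. \<integral>\<^sup>+y. ennreal (f (x - y)) * ennreal (f y) \<partial>lborel)"
    by (rule ext) (simp add: mult.commute)
  ultimately show ?thesis
    by (simp only: D2_def D_def)
qed

lemma G_measurable [measurable]: "(\<lambda>x. Re (G k x)) \<in> borel_measurable borel"
  unfolding G_def by measurable

lemma nn_integral_smooth_interval:
  assumes s: "0 < s"
  shows "(\<integral>\<^sup>+ x. indicator {a..b} x * ennreal (smooth s x) \<partial>lborel)
    = (\<integral>\<^sup>+ y. \<integral>\<^sup>+ z. indicator {a..b} (y + z / s) \<partial>std_normal_distribution \<partial>D2)"
proof -
  interpret P: pair_sigma_finite lborel D2 ..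
  define k where "k x y = s / sqrt (2 * pi) * exp (- (s * (y - x))\<^sup>2 / 2)" for x y :: real
  have [measurable]: "(\<lambda>z. k (fst z) (snd z)) \<in> borel_measurable (borel \<Otimes>\<^sub>M borel)"
    unfolding k_def by measurable
  have [measurable]: "k x \<in> borel_measurable borel" for x unfolding k_def by measurable
  have k0: "0 \<le> k x y" for x y using s by (simp add: k_def)
  have sm: "ennreal (smooth s x) = (\<integral>\<^sup>+ y. ennreal (k x y) \<partial>D2)" for x
  proof -
    have "integrable D2 (\<lambda>y. exp (- (s * (y - x))\<^sup>2 / 2))"
      by (rule D2.integrable_const_bound[where B = 1]) auto
    then have "integrable D2 (k x)" unfolding k_def by (rule integrable_mult_right)
    then have "(\<integral>\<^sup>+ y. ennreal (k x y) \<partial>D2) = ennreal (LINT y|D2. k x y)"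
      by (rule nn_integral_eq_integral) (simp add: k0)
    also have "(LINT y|D2. k x y) = smooth s x" by (simp add: k_def smooth_def)
    finally show ?thesis by simp
  qed
  have "(\<integral>\<^sup>+ x. indicator {a..b} x * ennreal (smooth s x) \<partial>lborel)
      = (\<integral>\<^sup>+ x. \<integral>\<^sup>+ y. indicator {a..b} x * ennreal (k x y) \<partial>D2 \<partial>lborel)"
    by (simp add: sm nn_integral_cmult)
  also have "\<dots> = (\<integral>\<^sup>+ y. \<integral>\<^sup>+ x. indicator {a..b} x * ennreal (k x y) \<partial>lborel \<partial>D2)"
  proof (rule P.Fubini'[symmetric])
    have "(\<lambda>z. indicator {a..b} (fst z) * ennreal (k (fst z) (snd z))) \<in> borel_measurable (borel \<Otimes>\<^sub>M borel)"
      by measurable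
    then show "(\<lambda>(x, y). indicator {a..b} x * ennreal (k x y)) \<in> borel_measurable (lborel \<Otimes>\<^sub>M D2)"
      by (simp add: case_prod_beta' cong: measurable_cong_sets sets_pair_measure_cong)
  qed
  also have "\<dots> = (\<integral>\<^sup>+ y. \<integral>\<^sup>+ z. indicator {a..b} (y + z / s) \<partial>std_normal_distribution \<partial>D2)"
  proof (rule nn_integral_cong)
    fix y
    have [measurable]: "(\<lambda>x. k x y) \<in> borel_measurable borel" unfolding k_def by measurable
    have e: "ennreal (1 / s) * (indicator {a..b} (y + 1 / s * z) * ennreal (k (y + 1 / s * z) y))
        = ennreal (std_normal_density z) * indicator {a..b} (y + z / s)" for z
    proof -
      have "(1 / s) * k (y + 1 / s * z) y = std_normal_density z"
        using s by (simp add: k_def std_normal_density_def)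
      then have "ennreal (1 / s) * ennreal (k (y + 1 / s * z) y) = ennreal (std_normal_density z)"
        using s k0 by (subst ennreal_mult[symmetric]) auto
      then have "(ennreal (1 / s) * ennreal (k (y + 1 / s * z) y)) * indicator {a..b} (y + 1 / s * z)
        = ennreal (std_normal_density z) * indicator {a..b} (y + z / s)" by simp
      then show ?thesis by (simp only: mult_ac)
    qed
    have "(\<integral>\<^sup>+ x. indicator {a..b} x * ennreal (k x y) \<partial>lborel)
      = ennreal \<bar>1 / s\<bar> * (\<integral>\<^sup>+ z. indicator {a..b} (y + 1 / s * z) * ennreal (k (y + 1 / s * z) y) \<partial>lborel)"
      using s by (intro nn_integral_real_affine) auto
    also have "\<dots> = (\<integral>\<^sup>+ z. ennreal (1 / s) * (indicator {a..b} (y + 1 / s * z) * ennreal (k (y + 1 / s * z) y)) \<partial>lborel)"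
      using s by (subst nn_integral_cmult) auto
    also have "\<dots> = (\<integral>\<^sup>+ z. ennreal (std_normal_density z) * indicator {a..b} (y + z / s) \<partial>lborel)"
      by (simp only: e)
    also have "\<dots> = (\<integral>\<^sup>+ z. indicator {a..b} (y + z / s) \<partial>std_normal_distribution)"
      by (subst nn_integral_density) auto
    finally show "(\<integral>\<^sup>+ x. indicator {a..b} x * ennreal (k x y) \<partial>lborel)
      = (\<integral>\<^sup>+ z. indicator {a..b} (y + z / s) \<partial>std_normal_distribution)" .
  qed
  finally show ?thesis .
qed

text \<open>The mass that the law with density \<open>smooth s\<close> gives to the interval is
  computed in two ways as \<open>s\<close> grows: the densities converge to \<open>G 1\<close> under
  the common bound \<open>K\<close>, and the random variable \<open>Y + Z / s\<close> converges to
  \<open>Y\<close>.\<close>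

lemma emeasure_G1_interval: "emeasure (density lborel (\<lambda>x. ennreal (Re (G 1 x)))) {a..b} = emeasure D2 {a..b}"
proof -
  interpret N: real_distribution std_normal_distribution by (rule real_dist_normal_dist)
  define s where "s i = real (Suc i)" for i
  have s: "0 < s i" for i by (simp add: s_def)
  have s0: "(\<lambda>i. z / s i) \<longlonglongrightarrow> 0" for z
    unfolding s_def by (intro tendsto_divide_0[OF tendsto_const] filterlim_at_top_imp_at_infinity
            filterlim_compose[OF filterlim_real_sequentially filterlim_Suc])
  have inner: "(\<lambda>i. LINT z|std_normal_distribution. (indicator {a..b} (y + z / s i) :: real))
      \<longlonglongrightarrow> indicator {a..b} y" if y: "y \<noteq> a" "y \<noteq> b" for y
  proof -
    have "(\<lambda>i. LINT z|std_normal_distribution. (indicator {a..b} (y + z / s i) :: real))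
      \<longlonglongrightarrow> (LINT z|std_normal_distribution. indicator {a..b} y)"
    proof (rule integral_dominated_convergence[where w = "\<lambda>_. 1"])
      show "AE z in std_normal_distribution. (\<lambda>i. indicator {a..b} (y + z / s i) :: real) \<longlonglongrightarrow> indicator {a..b} y"
      proof (intro AE_I2)
        fix z
        have lim: "(\<lambda>i. y + z / s i) \<longlonglongrightarrow> y" using tendsto_add[OF tendsto_const s0, of y z] by simp
        have "\<forall>\<^sub>F i in sequentially. (indicator {a..b} (y + z / s i) :: real) = indicator {a..b} y"
        proof (cases "y \<in> {a<..<b}")
          case True
          then show ?thesis
            by (intro eventually_mono[OF topological_tendstoD[OF lim, of "{a<..<b}"]]) (auto simp: indicator_def)
        next
          case False
          then have "y \<in> - {a..b}" using y by auto
          then show ?thesis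
            by (intro eventually_mono[OF topological_tendstoD[OF lim, of "- {a..b}"]])
              (auto simp: indicator_def intro: open_Compl)
        qed
        then show "(\<lambda>i. indicator {a..b} (y + z / s i) :: real) \<longlonglongrightarrow> indicator {a..b} y"
          by (rule tendsto_eventually)
      qed
    qed (auto simp: indicator_def)
    then show ?thesis using N.prob_space by simp
  qed
  have int_in: "integrable std_normal_distribution (\<lambda>z. indicator {a..b} (y + z / s i) :: real)" for y i
    by (rule N.integrable_const_bound[where B = 1]) (auto simp: indicator_def)
  have le1: "(LINT z|std_normal_distribution. (indicator {a..b} (y + z / s i) :: real)) \<le> 1" for y i
    by (rule N.integral_le_const[OF int_in]) (auto simp: indicator_def)
  have [measurable]: "(\<lambda>y. LINT z|std_normal_distribution. (indicator {a..b} (y + z / s i) :: real)) \<in> borel_measurable borel" for i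
    by measurable
  have int_out: "integrable D2 (\<lambda>y. LINT z|std_normal_distribution. (indicator {a..b} (y + z / s i) :: real))" for i
    by (rule D2.integrable_const_bound[where B = 1]) (auto simp: le1)
  have "(\<lambda>i. LINT y|D2. LINT z|std_normal_distribution. (indicator {a..b} (y + z / s i) :: real))
      \<longlonglongrightarrow> (LINT y|D2. indicator {a..b} y)"
  proof (rule integral_dominated_convergence[where w = "\<lambda>_. 1"])
    \<comment> \<open>The inner limit may fail at the two endpoints, where the indicator jumps; they
      are null sets because \<open>D2\<close> has a density.\<close>
    have "AE y in lborel. y \<noteq> a \<and> y \<noteq> b" using AE_lborel_singleton[of a] AE_lborel_singleton[of b] by eventually_elim auto
    then have "AE y in D2. y \<noteq> a \<and> y \<noteq> b" unfolding D2_density by (subst AE_density) auto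
    then show "AE y in D2. (\<lambda>i. LINT z|std_normal_distribution. (indicator {a..b} (y + z / s i) :: real)) \<longlonglongrightarrow> indicator {a..b} y"
      by eventually_elim (auto intro: inner)
  qed (auto simp: le1)
  then have lim1: "(\<lambda>i. LINT y|D2. LINT z|std_normal_distribution. (indicator {a..b} (y + z / s i) :: real)) \<longlonglongrightarrow> measure D2 {a..b}"
    by simp
  have intK: "integrable lborel (\<lambda>x. K * indicator {a..b} x)"
    by (intro integrable_mult_right integrable_real_indicator) (auto simp: emeasure_lborel_Icc_eq)
  have sm_meas [measurable]: "smooth r \<in> borel_measurable borel" for r unfolding smooth_def by measurable
  have "(\<lambda>i. LINT x|lborel. indicator {a..b} x * smooth (s i) x) \<longlonglongrightarrow> (LINT x|lborel. indicator {a..b} x * Re (G 1 x))"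
  proof (rule integral_dominated_convergence[where w = "\<lambda>x. K * indicator {a..b} x"])
    show "AE x in lborel. (\<lambda>i. indicator {a..b} x * smooth (s i) x) \<longlonglongrightarrow> indicator {a..b} x * Re (G 1 x)"
      unfolding s_def by (intro AE_I2 tendsto_intros smooth_lim_Re)
    show "AE x in lborel. norm (indicator {a..b} x * smooth (s i) x) \<le> K * indicator {a..b} x" for i
      by (auto simp: indicator_def smooth_le smooth_nonneg s abs_of_nonneg)
  qed (use intK in simp_all)
  moreover have "(LINT x|lborel. indicator {a..b} x * smooth (s i) x)
      = (LINT y|D2. LINT z|std_normal_distribution. (indicator {a..b} (y + z / s i) :: real))" for i
  proof -
    have "ennreal (LINT x|lborel. indicator {a..b} x * smooth (s i) x)
      = (\<integral>\<^sup>+ x. ennreal (indicator {a..b} x * smooth (s i) x) \<partial>lborel)"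
      by (rule nn_integral_eq_integral[symmetric], rule Bochner_Integration.integrable_bound[OF intK])
        (auto simp: indicator_def smooth_le smooth_nonneg s abs_of_nonneg K_pos intro!: order_trans[OF smooth_le[OF s] abs_ge_self])
    also have "\<dots> = (\<integral>\<^sup>+ x. indicator {a..b} x * ennreal (smooth (s i) x) \<partial>lborel)"
      by (intro nn_integral_cong) (auto simp: indicator_def)
    also have "\<dots> = (\<integral>\<^sup>+ y. \<integral>\<^sup>+ z. indicator {a..b} (y + z / s i) \<partial>std_normal_distribution \<partial>D2)"
      by (rule nn_integral_smooth_interval[OF s])
    also have "\<dots> = (\<integral>\<^sup>+ y. \<integral>\<^sup>+ z. ennreal (indicator {a..b} (y + z / s i)) \<partial>std_normal_distribution \<partial>D2)"
      by (intro nn_integral_cong) (auto simp: indicator_def)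
    also have "\<dots> = (\<integral>\<^sup>+ y. ennreal (LINT z|std_normal_distribution. indicator {a..b} (y + z / s i)) \<partial>D2)"
      by (intro nn_integral_cong nn_integral_eq_integral int_in) auto
    also have "\<dots> = ennreal (LINT y|D2. LINT z|std_normal_distribution. indicator {a..b} (y + z / s i))"
      by (intro nn_integral_eq_integral int_out) auto
    finally show ?thesis
      by (subst (asm) ennreal_inj) (auto intro!: Bochner_Integration.integral_nonneg mult_nonneg_nonneg smooth_nonneg s)
  qed
  ultimately have eq: "(LINT x|lborel. indicator {a..b} x * Re (G 1 x)) = measure D2 {a..b}"
    using lim1 LIMSEQ_unique by auto
  have "emeasure (density lborel (\<lambda>x. ennreal (Re (G 1 x)))) {a..b}
     = (\<integral>\<^sup>+ x. ennreal (indicator {a..b} x * Re (G 1 x)) \<partial>lborel)"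
    by (subst emeasure_density) (auto simp: indicator_def intro!: nn_integral_cong)
  also have "\<dots> = ennreal (LINT x|lborel. indicator {a..b} x * Re (G 1 x))"
    by (rule nn_integral_eq_integral, rule Bochner_Integration.integrable_bound[OF intK])
      (auto simp: indicator_def G1_nonneg abs_of_nonneg intro!: AE_I2 order_trans[OF G1_le abs_ge_self] simp del: One_nat_def)
  finally show ?thesis by (simp only: eq D2.emeasure_eq_measure)
qed

text \<open>Closed intervals form an intersection-stable generator, so the two measures agree.
  Uniqueness of densities then identifies the functions only up to a null set.\<close>

lemma AE_conv_pow_1: "AE x in lborel. conv_pow f 1 x = ennreal (Re (G 1 x))"
proof -
  have "density lborel (\<lambda>x. ennreal (Re (G 1 x))) = D2"
  proof (rule measure_eqI_generator_eq[where E = "range (\<lambda>(a, b). {a..b})" and \<Omega> = UNIV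
        and A = "\<lambda>i. {- real i..real i}"])
    show "Int_stable (range (\<lambda>(a, b). {a..b :: real}))"
      by (auto simp: Int_stable_def)
    have "sets borel = sigma_sets UNIV (range (\<lambda>(a, b). {a..b :: real}))"
      by (subst borel_eq_atLeastAtMost) simp
    then show "sets (density lborel (\<lambda>x. ennreal (Re (G 1 x)))) = sigma_sets UNIV (range (\<lambda>(a, b). {a..b}))"
      "sets D2 = sigma_sets UNIV (range (\<lambda>(a, b). {a..b}))" by simp_all
    show "(\<Union>i. {- real i..real i}) = UNIV"
    proof (intro equalityI subsetI UNIV_I)
      fix x :: real
      obtain n where "\<bar>x\<bar> \<le> real n" using real_arch_simple by blast
      then show "x \<in> (\<Union>i. {- real i..real i})" by (auto intro!: exI[of _ n])
    qed
  qed (auto simp: emeasure_G1_interval D2.emeasure_eq_measure simp del: One_nat_def)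
  then have "density lborel (conv_pow f 1) = density lborel (\<lambda>x. ennreal (Re (G 1 x)))"
    by (simp add: D2_density)
  then show ?thesis by (rule sigma_finite_measure.density_unique[OF sigma_finite_lborel, rotated 2]) (simp_all del: One_nat_def conv_pow.simps)
qed

lemma norm_G_le:
  assumes "1 \<le> k"
  shows "norm (G k x) \<le> K"
proof -
  have "norm (CLBINT u. \<phi> u ^ Suc k * iexp (- (u * x))) \<le> (LINT u|lborel. (norm (\<phi> u))\<^sup>2)"
    by (rule Bochner_Integration.integral_norm_bound_integral[OF integrable_G[OF assms] integrable_phi_sq])
      (use assms in \<open>auto simp: norm_mult norm_power simp del: power_Suc intro!: power_decreasing norm_phi_le_1\<close>)
  also note integral_phi_sq
  finally show ?thesis
    unfolding G_def by (simp add: norm_divide norm_mult field_simps)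
qed

text \<open>Convolving with \<open>D\<close> multiplies the integrand by one more
  \<open>\<phi> u\<close>. Exchanging the integrals is legitimate because the modulus of the
  integrand does not depend on \<open>y\<close>.\<close>

lemma G_Suc:
  assumes k: "1 \<le> k"
  shows "(CLINT y|D. G k (x - y)) = G (Suc k) x"
proof -
  interpret P: pair_sigma_finite D lborel ..
  define F where "F y u = \<phi> u ^ Suc k * iexp (- (u * (x - y)))" for y u
  have Fm [measurable]: "(\<lambda>z. F (fst z) (snd z)) \<in> borel_measurable (borel \<Otimes>\<^sub>M borel)"
    unfolding F_def by measurable
  have nF: "norm (F y u) = norm (\<phi> u) ^ Suc k" for y u
    by (simp add: F_def norm_mult norm_power del: power_Suc)
  have iF: "complex_integrable (D \<Otimes>\<^sub>M lborel) (\<lambda>(y, u). F y u)"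
  proof (rule P.Fubini_integrable)
    show "(\<lambda>(y, u). F y u) \<in> borel_measurable (D \<Otimes>\<^sub>M lborel)"
      using Fm by (simp add: case_prod_beta' cong: measurable_cong_sets sets_pair_measure_cong)
    show "integrable D (\<lambda>y. LINT u|lborel. norm (case (y, u) of (y, u) \<Rightarrow> F y u))"
      by (simp add: nF del: power_Suc)
    show "AE y in D. complex_integrable lborel (\<lambda>u. case (y, u) of (y, u) \<Rightarrow> F y u)"
      using integrable_G[OF k, of "x - y" for y] unfolding F_def by (simp only: split_conv) simp
  qed
  have "(CLINT y|D. CLINT u|lborel. F y u) = (CLINT u|lborel. CLINT y|D. F y u)"
    by (rule P.Fubini_integral[symmetric, OF iF])
  also have "\<dots> = (CLBINT u. \<phi> u ^ Suc (Suc k) * iexp (- (u * x)))"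
  proof (rule Bochner_Integration.integral_cong[OF refl])
    fix u
    have "(CLINT y|D. F y u) = (CLINT y|D. (\<phi> u ^ Suc k * iexp (- (u * x))) * iexp (u * y))"
      unfolding F_def by (intro Bochner_Integration.integral_cong refl)
        (simp add: exp_add[symmetric] algebra_simps)
    also have "\<dots> = (\<phi> u ^ Suc k * iexp (- (u * x))) * \<phi> u"
      by (simp add: phi_integral del: power_Suc)
    finally show "(CLINT y|D. F y u) = \<phi> u ^ Suc (Suc k) * iexp (- (u * x))"
      by (simp add: mult_ac)
  qed
  finally show ?thesis
    unfolding G_def F_def[symmetric] by (simp del: power_Suc)
qed

text \<open>Equality with \<open>conv_pow\<close> is claimed at every point from
  \<open>k = 2\<close> on: a convolution integral does not see the null set left open at
  \<open>k = 1\<close>. From then on the induction is pointwise.\<close>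

lemma conv_pow_fourier:
  assumes "1 \<le> k"
  shows "G k x = of_real (Re (G k x)) \<and> 0 \<le> Re (G k x) \<and>
    (2 \<le> k \<longrightarrow> conv_pow f k x = ennreal (Re (G k x)))"
  using assms
proof (induction k arbitrary: x rule: dec_induct)
  case base
  show ?case using G1_real G1_nonneg by simp
next
  case (step k)
  have k: "1 \<le> k" by fact
  have real: "G k y = of_real (Re (G k y))" and nn: "0 \<le> Re (G k y)"
    and conv: "2 \<le> k \<Longrightarrow> conv_pow f k y = ennreal (Re (G k y))" for y
    using step.IH[of y] by blast+
  have le: "Re (G k y) \<le> K" for y using complex_Re_le_cmod[of "G k y"] norm_G_le[OF k, of y] by linarith
  have iD: "integrable D (\<lambda>y. Re (G k (x - y)))"
    by (rule D.integrable_const_bound[where B = K]) (auto simp: nn le)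
  have e: "G (Suc k) x = of_real (LINT y|D. Re (G k (x - y)))"
  proof -
    have "G (Suc k) x = (CLINT y|D. of_real (Re (G k (x - y))))"
      unfolding G_Suc[OF k, symmetric] by (rule Bochner_Integration.integral_cong[OF refl real])
    then show ?thesis by (simp only: integral_complex_of_real)
  qed
  then have r: "Re (G (Suc k) x) = (LINT y|D. Re (G k (x - y)))" by simp
  have "conv_pow f (Suc k) x = (\<integral>\<^sup>+ y. ennreal (f y) * ennreal (Re (G k (x - y))) \<partial>lborel)"
  \<comment> \<open>The exceptional set is described in the variable \<open>x - y\<close>, so the
    integral is first reflected by the substitution \<open>y = x - z\<close>.\<close>
  proof (cases "k = 1")
    case True
    have ae: "AE z in lborel. ennreal (f (x + (-1) * z)) * conv_pow f 1 (x - (x + (-1) * z))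
        = ennreal (f (x + (-1) * z)) * ennreal (Re (G 1 (x - (x + (-1) * z))))"
      using AE_conv_pow_1 by eventually_elim simp
    have "(\<integral>\<^sup>+ y. ennreal (f y) * conv_pow f 1 (x - y) \<partial>lborel)
        = ennreal \<bar>-1\<bar> * (\<integral>\<^sup>+ z. ennreal (f (x + (-1) * z)) * conv_pow f 1 (x - (x + (-1) * z)) \<partial>lborel)"
      by (rule nn_integral_real_affine) auto
    also have "\<dots> = ennreal \<bar>-1\<bar> * (\<integral>\<^sup>+ z. ennreal (f (x + (-1) * z)) * ennreal (Re (G 1 (x - (x + (-1) * z)))) \<partial>lborel)"
      by (simp only: nn_integral_cong_AE[OF ae])
    also have "\<dots> = (\<integral>\<^sup>+ y. ennreal (f y) * ennreal (Re (G 1 (x - y))) \<partial>lborel)"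
      by (rule nn_integral_real_affine[symmetric]) auto
    finally show ?thesis using True by simp
  next
    case False
    then have "2 \<le> k" using k by simp
    then show ?thesis by (simp add: conv)
  qed
  also have "\<dots> = (\<integral>\<^sup>+ y. ennreal (Re (G k (x - y))) \<partial>D)"
    unfolding D_def by (subst nn_integral_density) auto
  also have "\<dots> = ennreal (LINT y|D. Re (G k (x - y)))"
    by (rule nn_integral_eq_integral[OF iD]) (simp add: nn)
  finally have c: "conv_pow f (Suc k) x = ennreal (LINT y|D. Re (G k (x - y)))" .
  show ?case
    unfolding r c by (simp add: e nn Bochner_Integration.integral_nonneg)
qed

end

section \<open>A local limit estimate\<close>

lemma integral_inverse_1_plus_square:
  "has_bochner_integral lborel (\<lambda>x::real. 1 / (1 + x\<^sup>2)) pi"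
  using integrable_inverse_1_plus_square LBINT_inverse_1_plus_square
  by (simp add: has_bochner_integral_iff set_integrable_def interval_lebesgue_integral_def
      set_lebesgue_integral_def einterval_def divide_inverse)

lemma integral_inverse_1_plus_scaled_square:
  assumes n: "0 < n"
  shows "has_bochner_integral lborel (\<lambda>u::real. 1 / (1 + n * u\<^sup>2)) (pi / sqrt n)"
proof -
  have "has_bochner_integral lborel (\<lambda>u. 1 / (1 + (0 + sqrt n * u)\<^sup>2)) (pi /\<^sub>R \<bar>sqrt n\<bar>)"
    using integral_inverse_1_plus_square n
    by (subst (asm) lborel_has_bochner_integral_real_affine_iff[of "sqrt n" _ _ 0]) auto
  then show ?thesis
    using n by (simp add: power_mult_distrib divide_inverse mult.commute)
qed

lemma norm_power_diff_le:
  fixes z w :: complex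
  assumes "norm z \<le> r" "norm w \<le> r"
  shows "norm (z ^ n - w ^ n) \<le> real n * norm (z - w) * r ^ (n - 1)"
proof (induction n)
  case (Suc n)
  have r: "0 \<le> r" using assms norm_ge_zero order_trans by blast
  have "z ^ Suc n - w ^ Suc n = (z - w) * z ^ n + w * (z ^ n - w ^ n)"
    by (simp add: algebra_simps)
  then have "norm (z ^ Suc n - w ^ Suc n) \<le> norm (z - w) * norm z ^ n + norm w * norm (z ^ n - w ^ n)"
    by (metis norm_triangle_ineq norm_mult norm_power)
  also have "\<dots> \<le> norm (z - w) * r ^ n + r * (real n * norm (z - w) * r ^ (n - 1))"
    using assms r Suc by (intro add_mono mult_mono power_mono) auto
  also have "\<dots> = real (Suc n) * norm (z - w) * r ^ n"
    by (cases n) (auto simp: algebra_simps)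
  finally show ?case by simp
qed simp

lemma norm_power_diff_Re_le:
  "norm (z ^ n - of_real (Re z ^ n)) \<le> real n * \<bar>Im z\<bar> * norm z ^ (n - 1)"
proof -
  have "norm (z - of_real (Re z)) = \<bar>Im z\<bar>"
    by (simp add: cmod_def)
  then show ?thesis
    using norm_power_diff_le[of z "norm z" "of_real (Re z)" n] by (simp add: abs_Re_le_cmod)
qed

lemma iexp_bound: "cmod (iexp v - 1 - \<i> * v) \<le> v\<^sup>2 / 2"
  using iexp_approx1[of v 1] by (simp add: numeral_2_eq_2 diff_diff_eq)

text \<open>Bounds \<open>(1 + v) ^ 3 * exp (- (decay K * v / 2))\<close> for
  \<open>v \<ge> 0\<close>: with \<open>c = decay K / 6 \<le> 1\<close> one has
  \<open>c * (1 + v) \<le> 1 + c * v \<le> exp (c * v)\<close>, and the cube of this is what is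
  needed.\<close>

definition peak :: "real \<Rightarrow> real" where
  "peak K = (6 / decay K) ^ 3"

lemma decay_le_1: "decay K \<le> 1"
proof -
  have "1 \<le> (real (decay_count K))\<^sup>2" by (simp add: decay_count_def)
  then have "1 \<le> 16 * (real (decay_count K))\<^sup>2" by simp
  then show ?thesis unfolding decay_def by (subst divide_le_eq_1) auto
qed

lemma cubic_exp_le_peak:
  assumes "0 \<le> v"
  shows "(1 + v) ^ 3 * exp (- (decay K * v / 2)) \<le> peak K"
proof -
  define c where "c = decay K / 6"
  have c: "0 < c" "c \<le> 1" using decay_pos[of K] decay_le_1[of K] by (auto simp: c_def)
  have "c * (1 + v) \<le> 1 + c * v" using c by (simp add: algebra_simps)
  also have "\<dots> \<le> exp (c * v)" by (rule exp_ge_add_one_self)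
  finally have "1 + v \<le> exp (c * v) / c" using c by (simp add: field_simps)
  then have "(1 + v) ^ 3 \<le> (exp (c * v) / c) ^ 3" using assms by (intro power_mono) auto
  also have "\<dots> = exp (3 * (c * v)) / c ^ 3"
    by (simp add: power_divide exp_of_nat_mult[of 3, simplified])
  also have "3 * (c * v) = decay K * v / 2" by (simp add: c_def)
  finally have "(1 + v) ^ 3 * exp (- (decay K * v / 2)) \<le> exp (decay K * v / 2) / c ^ 3 * exp (- (decay K * v / 2))"
    by (intro mult_right_mono) auto
  also have "\<dots> = 1 / c ^ 3" by (simp add: exp_minus)
  also have "\<dots> = peak K" by (simp add: c_def peak_def power_divide)
  finally show ?thesis .
qed

lemma peak_pos: "0 < peak K"
  using decay_pos[of K] by (simp add: peak_def)

context centered_density begin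

text \<open>Of the three powers of \<open>1 + n * u\<^sup>2\<close> that the exponential decay can
  pay for, two absorb the polynomial factors of the Taylor estimates and the third remains as a
  majorant with integral of order \<open>1 / sqrt n\<close>. Half of the exponent suffices, so
  \<open>n\<close>, \<open>n - 1\<close> and \<open>n - 2\<close> are treated alike.\<close>

lemma norm_phi_power_small:
  assumes u: "\<bar>u\<bar> \<le> 1" and m: "n \<le> 2 * m"
  shows "norm (\<phi> u) ^ m * (1 + real n * u\<^sup>2)\<^sup>2 \<le> peak K / (1 + real n * u\<^sup>2)"
proof -
  define v where "v = real n * u\<^sup>2"
  have v: "0 \<le> v" by (simp add: v_def)
  have "norm (\<phi> u) ^ m \<le> exp (- (decay K * u\<^sup>2)) ^ m"
    by (intro power_mono norm_phi_small u) auto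
  also have "\<dots> = exp (- (decay K * (real m * u\<^sup>2)))"
    by (simp add: exp_of_nat_mult[symmetric] algebra_simps)
  also have "\<dots> \<le> exp (- (decay K * v / 2))"
  proof -
    have "real n / 2 * u\<^sup>2 \<le> real m * u\<^sup>2" using m by (intro mult_right_mono) auto
    then have "decay K * (real n / 2 * u\<^sup>2) \<le> decay K * (real m * u\<^sup>2)"
      using decay_pos[of K] by (intro mult_left_mono) auto
    then show ?thesis by (simp add: v_def)
  qed
  finally have "norm (\<phi> u) ^ m * (1 + v) ^ 3 \<le> exp (- (decay K * v / 2)) * (1 + v) ^ 3"
    using v by (intro mult_right_mono) auto
  also have "\<dots> \<le> peak K" using cubic_exp_le_peak[OF v, of K] by (simp add: mult.commute)
  finally show ?thesis using v unfolding v_def[symmetric] by (simp add: field_simps power3_eq_cube power2_eq_square)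
qed

text \<open>Two factors of \<open>norm (\<phi> u)\<close> are kept for integrability at infinity;
  the other \<open>m - 2 \<ge> n / 2\<close> factors give exponential decay in \<open>n\<close>, of
  which only the order \<open>1 / n\<^sup>2\<close> is retained.\<close>

lemma norm_phi_power_large:
  assumes u: "1 \<le> \<bar>u\<bar>" and m: "n + 4 \<le> 2 * m" and n: "1 \<le> n"
  shows "norm (\<phi> u) ^ m \<le> peak K / (real n)\<^sup>2 * (norm (\<phi> u))\<^sup>2"
proof -
  have "norm (\<phi> u) ^ (m - 2) \<le> exp (- decay K) ^ (m - 2)"
    by (intro power_mono norm_phi_large u) auto
  also have "\<dots> = exp (- (decay K * real (m - 2)))"
    by (simp add: exp_of_nat_mult[symmetric] algebra_simps)
  also have "\<dots> \<le> exp (- (decay K * real n / 2))"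
  proof -
    have "decay K * (real n / 2) \<le> decay K * real (m - 2)"
      using decay_pos[of K] m by (intro mult_left_mono) auto
    then show ?thesis by simp
  qed
  also have "\<dots> \<le> peak K / (1 + real n) ^ 3"
    using cubic_exp_le_peak[of "real n" K] by (simp add: field_simps)
  also have "\<dots> \<le> peak K / (real n)\<^sup>2"
  proof (rule divide_left_mono)
    have "(real n)\<^sup>2 \<le> (1 + real n)\<^sup>2" by (intro power_mono) auto
    also have "\<dots> \<le> (1 + real n) ^ 3" by (intro power_increasing) auto
    finally show "(real n)\<^sup>2 \<le> (1 + real n) ^ 3" .
    show "0 < (1 + real n) ^ 3 * (real n)\<^sup>2" using n by simp
  qed (use peak_pos[of K] in simp)
  finally have "norm (\<phi> u) ^ (m - 2) * (norm (\<phi> u))\<^sup>2 \<le> peak K / (real n)\<^sup>2 * (norm (\<phi> u))\<^sup>2"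
    by (intro mult_right_mono) auto
  moreover have "norm (\<phi> u) ^ m = norm (\<phi> u) ^ (m - 2) * (norm (\<phi> u))\<^sup>2"
    using m n by (subst power_add[symmetric]) (intro arg_cong2[where f = power] refl, simp)
  ultimately show ?thesis by simp
qed

section \<open>Taylor estimates at the origin\<close>

lemma integrable_pow_D: "j \<le> 3 \<Longrightarrow> integrable D (\<lambda>y. \<bar>y\<bar> ^ j)"
  using integrable_moment[of j] by (simp add: integrable_D mult.commute)

lemma integral_pow_D: "j \<le> 3 \<Longrightarrow> (LINT y|D. \<bar>y\<bar> ^ j) \<le> 1 + K"
  using moment_le[of j] by (simp add: integral_D mult.commute)

lemma integrable_id_D: "integrable D (\<lambda>y. y)"
  by (rule Bochner_Integration.integrable_bound[OF integrable_pow_D[of 1]]) auto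

lemma mean_D: "(LINT y|D. y) = 0"
  using mean_0 by (simp add: integral_D mult.commute)

text \<open>Since the mean is 0, \<open>sin (u * y)\<close> may be replaced by
  \<open>sin (u * y) - u * y\<close> under the integral, which is of third order.\<close>

lemma Im_phi: "\<bar>Im (\<phi> u)\<bar> \<le> (1 + K) * \<bar>u\<bar> ^ 3"
proof -
  have isin: "integrable D (\<lambda>y. sin (u * y))"
    by (rule D.integrable_const_bound[where B = 1]) auto
  have ii: "complex_integrable D (\<lambda>y. iexp (u * y))"
    by (rule D.integrable_const_bound[where B = 1]) auto
  have i3: "integrable D (\<lambda>y. \<bar>u\<bar> ^ 3 * \<bar>y\<bar> ^ 3)"
    using integrable_pow_D[of 3] by simp
  have b: "\<bar>sin v - v\<bar> \<le> \<bar>v\<bar> ^ 3" for v :: real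
  proof -
    have "sin v - v = Im (iexp v - (\<Sum>k\<le>2. (\<i> * v) ^ k / fact k))"
      by (simp add: numeral_2_eq_2 Im_exp)
    then have "\<bar>sin v - v\<bar> \<le> cmod (iexp v - (\<Sum>k\<le>2. (\<i> * v) ^ k / fact k))"
      by (metis abs_Im_le_cmod)
    also have "\<dots> \<le> \<bar>v\<bar> ^ Suc 2 / fact (Suc 2)" by (rule iexp_approx1)
    also have "\<dots> \<le> \<bar>v\<bar> ^ 3" by (simp add: fact_numeral)
    finally show ?thesis .
  qed
  have "Im (\<phi> u) = (LINT y|D. sin (u * y))"
    unfolding phi_integral by (subst integral_Im[OF ii, symmetric]) (simp add: Im_exp)
  also have "\<dots> = (LINT y|D. sin (u * y) - u * y)"
    using isin integrable_id_D mean_D by simp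
  finally have "\<bar>Im (\<phi> u)\<bar> = \<bar>LINT y|D. sin (u * y) - u * y\<bar>" by simp
  also have "\<dots> \<le> (LINT y|D. \<bar>u\<bar> ^ 3 * \<bar>y\<bar> ^ 3)"
    using Bochner_Integration.integral_norm_bound_integral[of D "\<lambda>y. sin (u * y) - u * y" "\<lambda>y. \<bar>u\<bar> ^ 3 * \<bar>y\<bar> ^ 3"] isin integrable_id_D i3 b
    by (simp add: abs_mult[symmetric] power_mult_distrib[symmetric])
  also have "\<dots> = \<bar>u\<bar> ^ 3 * (LINT y|D. \<bar>y\<bar> ^ 3)" by simp
  also have "\<dots> \<le> \<bar>u\<bar> ^ 3 * (1 + K)"
    by (intro mult_left_mono integral_pow_D) auto
  finally show ?thesis by (simp add: mult.commute)
qed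

lemma phi_minus_1: "norm (\<phi> u - 1) \<le> (1 + K) * u\<^sup>2"
proof -
  have ii: "complex_integrable D (\<lambda>y. iexp (u * y))"
    by (rule D.integrable_const_bound[where B = 1]) auto
  have i1: "complex_integrable D (\<lambda>y. \<i> * of_real (u * y))"
    using integrable_id_D by (intro integrable_mult_right integrable_of_real) auto
  have i2: "integrable D (\<lambda>y. u\<^sup>2 * \<bar>y\<bar> ^ 2)"
    using integrable_pow_D[of 2] by simp
  have "(CLINT y|D. \<i> * of_real (u * y)) = 0"
    using mean_D by (simp only: integral_mult_right_zero integral_complex_of_real) simp
  then have "\<phi> u - 1 = (CLINT y|D. iexp (u * y) - 1 - \<i> * of_real (u * y))"
    unfolding phi_integral using ii i1
    by (simp only: Bochner_Integration.integral_diff Bochner_Integration.integrable_diff D.integrable_const) simp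
  then have "norm (\<phi> u - 1) = norm (CLINT y|D. iexp (u * y) - 1 - \<i> * of_real (u * y))" by simp
  also have "\<dots> \<le> (LINT y|D. u\<^sup>2 * \<bar>y\<bar> ^ 2)"
  proof (intro Bochner_Integration.integral_norm_bound_integral i2 Bochner_Integration.integrable_diff ii i1 D.integrable_const)
    fix y
    have "norm (iexp (u * y) - 1 - \<i> * of_real (u * y)) \<le> (u * y)\<^sup>2 / 2" by (rule iexp_bound)
    also have "\<dots> \<le> u\<^sup>2 * \<bar>y\<bar> ^ 2" by (simp add: power_mult_distrib)
    finally show "norm (iexp (u * y) - 1 - \<i> * of_real (u * y)) \<le> u\<^sup>2 * \<bar>y\<bar> ^ 2" .
  qed
  also have "\<dots> = u\<^sup>2 * (LINT y|D. \<bar>y\<bar> ^ 2)" by simp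
  also have "\<dots> \<le> u\<^sup>2 * (1 + K)"
    by (intro mult_left_mono integral_pow_D) auto
  finally show ?thesis by (simp add: mult.commute)
qed

lemma norm_phi_power_le:
  assumes n: "1 \<le> n" and m: "n + 4 \<le> 2 * m"
  shows "norm (\<phi> u) ^ m \<le> peak K / (1 + real n * u\<^sup>2) + peak K / (real n)\<^sup>2 * (norm (\<phi> u))\<^sup>2"
proof (cases "\<bar>u\<bar> \<le> 1")
  case True
  have "norm (\<phi> u) ^ m * 1 \<le> norm (\<phi> u) ^ m * (1 + real n * u\<^sup>2)\<^sup>2"
    by (intro mult_left_mono one_le_power) auto
  also have "\<dots> \<le> peak K / (1 + real n * u\<^sup>2)"
    using m by (intro norm_phi_power_small True) simp
  finally show ?thesis
    using peak_pos[of K] by (simp add: add_increasing2)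
next
  case False
  then have "norm (\<phi> u) ^ m \<le> peak K / (real n)\<^sup>2 * (norm (\<phi> u))\<^sup>2"
    using n m by (intro norm_phi_power_large) auto
  then show ?thesis
    using peak_pos[of K] by (simp add: add_increasing)
qed

lemma dominating_integral:
  assumes n: "1 \<le> (n::nat)"
  shows "has_bochner_integral lborel
      (\<lambda>u. A / (1 + real n * u\<^sup>2) + B * (norm (\<phi> u))\<^sup>2)
      (A * (pi / sqrt n) + B * (LINT u|lborel. (norm (\<phi> u))\<^sup>2))"
proof -
  have "has_bochner_integral lborel (\<lambda>u. A * (1 / (1 + real n * u\<^sup>2))) (A * (pi / sqrt n))"
    using n by (intro has_bochner_integral_mult_right integral_inverse_1_plus_scaled_square) auto
  moreover have "has_bochner_integral lborel (\<lambda>u. B * (norm (\<phi> u))\<^sup>2) (B * (LINT u|lborel. (norm (\<phi> u))\<^sup>2))"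
    by (intro has_bochner_integral_mult_right has_bochner_integral_integrable integrable_phi_sq)
  ultimately show ?thesis
    using has_bochner_integral_add by fastforce
qed

section \<open>Size of the inversion integral and of its change when one summand is fixed\<close>

lemma Re_G: "1 \<le> k \<Longrightarrow> 2 * pi * Re (G k x) = (LINT u|lborel. Re (\<phi> u ^ Suc k * iexp (- (u * x))))"
  unfolding G_def by (subst integral_Re[OF integrable_G]) (simp_all del: power_Suc)

lemma Re_G_le:
  assumes n: "8 \<le> n" and k: "n \<le> Suc k + 1" "k < n"
  shows "Re (G k x) \<le> peak K * (1 + K) / sqrt n"
proof -
  have k1: "1 \<le> k" using n k by simp
  have "2 * pi * Re (G k x) \<le> peak K * (pi / sqrt n) + peak K / (real n)\<^sup>2 * (LINT u|lborel. (norm (\<phi> u))\<^sup>2)"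
  proof -
    have d: "has_bochner_integral lborel
      (\<lambda>u. peak K / (1 + real n * u\<^sup>2) + peak K / (real n)\<^sup>2 * (norm (\<phi> u))\<^sup>2)
      (peak K * (pi / sqrt n) + peak K / (real n)\<^sup>2 * (LINT u|lborel. (norm (\<phi> u))\<^sup>2))"
      using n by (intro dominating_integral) auto
    have "(LINT u|lborel. Re (\<phi> u ^ Suc k * iexp (- (u * x))))
      \<le> (LINT u|lborel. peak K / (1 + real n * u\<^sup>2) + peak K / (real n)\<^sup>2 * (norm (\<phi> u))\<^sup>2)"
    proof (rule integral_mono)
      fix u :: real
      have "Re (\<phi> u ^ Suc k * iexp (- (u * x))) \<le> norm (\<phi> u) ^ Suc k"
        using complex_Re_le_cmod[of "\<phi> u ^ Suc k * iexp (- (u * x))"]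
        by (simp add: norm_mult norm_power del: power_Suc)
      also have "\<dots> \<le> peak K / (1 + real n * u\<^sup>2) + peak K / (real n)\<^sup>2 * (norm (\<phi> u))\<^sup>2"
        using n k by (intro norm_phi_power_le) auto
      finally show "Re (\<phi> u ^ Suc k * iexp (- (u * x)))
          \<le> peak K / (1 + real n * u\<^sup>2) + peak K / (real n)\<^sup>2 * (norm (\<phi> u))\<^sup>2" .
      show "integrable lborel (\<lambda>u. Re (\<phi> u ^ Suc k * iexp (- (u * x))))"
        by (rule integrable_Re[OF integrable_G[OF k1]])
    qed (use d in \<open>simp add: has_bochner_integral_iff\<close>)
    then show ?thesis
      using d by (simp add: Re_G[OF k1] has_bochner_integral_iff)
  qed
  also have "\<dots> \<le> peak K * (pi / sqrt n) + peak K / sqrt n * (2 * pi * K)"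
  proof (intro add_mono mult_mono integral_phi_sq order_refl divide_left_mono)
    have "sqrt n \<le> n" using n by (simp add: real_le_lsqrt sqrt_le_D power2_eq_square)
    also have "\<dots> \<le> (real n)\<^sup>2" using n by (simp add: power2_eq_square)
    finally show "sqrt n \<le> (real n)\<^sup>2" .
  qed (use peak_pos[of K] n in \<open>auto intro!: Bochner_Integration.integral_nonneg\<close>)
  also have "\<dots> \<le> 2 * pi * (peak K * (1 + K) / sqrt n)"
    using peak_pos[of K] n by (simp add: field_simps)
  finally show ?thesis by (subst (asm) mult_le_cancel_left_pos) auto
qed

text \<open>\<open>Re (\<phi> u ^ n)\<close> may be negative, so near the origin it is compared with
  \<open>Re (\<phi> u) ^ n\<close>, which is nonnegative there and, by Bernoulli's inequality, at
  least 1/2 on the set in the indicator. The error of this exchange is proportional to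
  \<open>Im (\<phi> u)\<close>, hence cubic in \<open>u\<close>, which yields the extra factor
  \<open>1 / sqrt n\<close>.\<close>

lemma Re_phi_power_ge:
  assumes n: "8 \<le> n"
  shows "1 / 2 * indicator {u. 2 * real n * (1 + K) * u\<^sup>2 \<le> 1} u
    \<le> Re (\<phi> u ^ n) + (4 * (1 + K)\<^sup>2 * peak K / sqrt n / (1 + real n * u\<^sup>2) + peak K / (real n)\<^sup>2 * (norm (\<phi> u))\<^sup>2)"
proof -
  define L where "L = 1 + K"
  have L: "1 \<le> L" using K_pos by (simp add: L_def)
  have n0: "0 < real n" using n by simp
  have abs_ge: "- (norm (\<phi> u) ^ n) \<le> Re (\<phi> u ^ n)"
    using abs_Re_le_cmod[of "\<phi> u ^ n"] by (simp add: norm_power)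
  have B0: "0 \<le> peak K / (real n)\<^sup>2 * (norm (\<phi> u))\<^sup>2" using peak_pos[of K] by simp
  have A0: "0 \<le> 4 * L\<^sup>2 * peak K / sqrt n / (1 + real n * u\<^sup>2)" using peak_pos[of K] by simp
  have ind0: "indicator {u. 2 * real n * L * u\<^sup>2 \<le> 1} u = (0::real)" if "1 / 2 < L * u\<^sup>2"
  proof -
    have "1 / 2 * 2 < (L * u\<^sup>2) * (2 * real n)" using that n by (intro mult_strict_mono) auto
    then show ?thesis by (simp add: mult_ac)
  qed
  \<comment> \<open>For \<open>s = sqrt n\<close>, \<open>s * n * |u|^3 = (s * |u|)^3\<close> is at
    most \<open>(1 + n * u^2)^2\<close>; the two spare powers in \<open>norm_phi_power_small\<close>
    absorb it and leave the gain \<open>1 / s\<close>.\<close>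
  have small: "real n * \<bar>u\<bar> ^ 3 * norm (\<phi> u) ^ (n - 1) \<le> peak K / sqrt n / (1 + real n * u\<^sup>2)" if u: "\<bar>u\<bar> \<le> 1"
  proof -
    define s where "s = sqrt n"
    have s: "0 < s" "real n = s\<^sup>2" using n by (auto simp: s_def)
    have "(s * (real n * \<bar>u\<bar> ^ 3)) \<le> (1 + real n * u\<^sup>2)\<^sup>2"
    proof -
      have "s * (real n * \<bar>u\<bar> ^ 3) = (s * \<bar>u\<bar>) ^ 3"
        by (simp add: s(2) power_mult_distrib power2_eq_square power3_eq_cube)
      also have "\<dots> \<le> (1 + (s * \<bar>u\<bar>)\<^sup>2)\<^sup>2"
      proof -
        have "0 \<le> (s * \<bar>u\<bar>) * 1 + (s * \<bar>u\<bar>) ^ 4" using s by simp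
        moreover have "(s * \<bar>u\<bar>) ^ 3 \<le> 1 + (s * \<bar>u\<bar>) ^ 4"
        proof (cases "s * \<bar>u\<bar> \<le> 1")
          case True
          then have "(s * \<bar>u\<bar>) ^ 3 \<le> 1" using s by (intro power_le_one) auto
          then show ?thesis using s by (simp add: add_increasing2)
        next
          case False
          then have "(s * \<bar>u\<bar>) ^ 3 \<le> (s * \<bar>u\<bar>) ^ 4" by (intro power_increasing) auto
          then show ?thesis by linarith
        qed
        moreover have "(1 + (s * \<bar>u\<bar>)\<^sup>2)\<^sup>2 = 1 + 2 * (s * \<bar>u\<bar>)\<^sup>2 + (s * \<bar>u\<bar>) ^ 4"
          by (simp add: power2_eq_square power4_eq_xxxx algebra_simps)
        ultimately show ?thesis by (smt (verit) zero_le_power2)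
      qed
      also have "\<dots> = (1 + real n * u\<^sup>2)\<^sup>2" by (simp add: s(2) power_mult_distrib)
      finally show ?thesis .
    qed
    then have "(s * (real n * \<bar>u\<bar> ^ 3)) * norm (\<phi> u) ^ (n - 1) \<le> (1 + real n * u\<^sup>2)\<^sup>2 * norm (\<phi> u) ^ (n - 1)"
      by (intro mult_right_mono) auto
    also have "\<dots> \<le> peak K / (1 + real n * u\<^sup>2)"
      using norm_phi_power_small[OF u, of n "n - 1"] n by (simp add: mult.commute)
    finally have "(real n * \<bar>u\<bar> ^ 3 * norm (\<phi> u) ^ (n - 1)) * s \<le> peak K / (1 + real n * u\<^sup>2)"
      by (simp only: mult_ac)
    then have "real n * \<bar>u\<bar> ^ 3 * norm (\<phi> u) ^ (n - 1) \<le> peak K / (1 + real n * u\<^sup>2) / s"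
      using s(1) by (simp only: pos_le_divide_eq)
    then show ?thesis unfolding s_def by (simp only: divide_divide_eq_left mult.commute)
  qed
  \<comment> \<open>Outside the first region the indicator vanishes and a bound on the modulus
    suffices. In the second, \<open>4 * L\<^sup>2 * n * \<bar>u\<bar> ^ 3 \<ge> 1\<close>, so the
    cubic bound already controls the modulus; in the third, the exponential decay does.\<close>
  consider (a) "L * u\<^sup>2 \<le> 1 / 2" | (b) "1 / 2 < L * u\<^sup>2" "\<bar>u\<bar> \<le> 1" | (c) "1 < \<bar>u\<bar>" by linarith
  then have "1 / 2 * indicator {u. 2 * real n * L * u\<^sup>2 \<le> 1} u
    \<le> Re (\<phi> u ^ n) + (4 * L\<^sup>2 * peak K / sqrt n / (1 + real n * u\<^sup>2) + peak K / (real n)\<^sup>2 * (norm (\<phi> u))\<^sup>2)"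
  proof cases
    case a
    have "u\<^sup>2 \<le> 1"
    proof -
      have "1 * u\<^sup>2 \<le> L * u\<^sup>2" using L by (intro mult_right_mono) auto
      then show ?thesis using a by simp
    qed
    then have u: "\<bar>u\<bar> \<le> 1" by (simp add: abs_square_le_1)
    have "1 - Re (\<phi> u) \<le> norm (\<phi> u - 1)" using abs_Re_le_cmod[of "\<phi> u - 1"] by simp
    also have "\<dots> \<le> L * u\<^sup>2" unfolding L_def by (rule phi_minus_1)
    finally have re: "1 - L * u\<^sup>2 \<le> Re (\<phi> u)" by simp
    have "1 + real n * (- (L * u\<^sup>2)) \<le> (1 + (- (L * u\<^sup>2))) ^ n"
      using a by (intro Bernoulli_inequality) simp
    also have "\<dots> \<le> Re (\<phi> u) ^ n" using re a by (intro power_mono) auto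
    finally have bern: "1 - real n * (L * u\<^sup>2) \<le> Re (\<phi> u) ^ n" by simp
    have pos: "0 \<le> Re (\<phi> u) ^ n" using re a by (intro zero_le_power) linarith
    have 1: "1 / 2 * indicator {u. 2 * real n * L * u\<^sup>2 \<le> 1} u \<le> Re (\<phi> u) ^ n"
      using bern pos by (auto simp: indicator_def mult_ac)
    have "Re (\<phi> u) ^ n - Re (\<phi> u ^ n) \<le> norm (\<phi> u ^ n - of_real (Re (\<phi> u) ^ n))"
      using abs_Re_le_cmod[of "\<phi> u ^ n - of_real (Re (\<phi> u) ^ n)"] by (simp del: of_real_power)
    also have "\<dots> \<le> real n * \<bar>Im (\<phi> u)\<bar> * norm (\<phi> u) ^ (n - 1)" by (rule norm_power_diff_Re_le)
    also have "\<dots> \<le> real n * (L * \<bar>u\<bar> ^ 3) * norm (\<phi> u) ^ (n - 1)"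
      using Im_phi[of u] by (intro mult_right_mono mult_left_mono) (auto simp: L_def)
    also have "\<dots> = L * (real n * \<bar>u\<bar> ^ 3 * norm (\<phi> u) ^ (n - 1))" by simp
    also have "\<dots> \<le> (4 * L\<^sup>2) * (peak K / sqrt n / (1 + real n * u\<^sup>2))"
      using L peak_pos[of K] by (intro mult_mono small u) (auto simp: power2_eq_square intro: order_trans[of _ "4 * L"])
    also have "\<dots> = 4 * L\<^sup>2 * peak K / sqrt n / (1 + real n * u\<^sup>2)" by simp
    finally show ?thesis using 1 B0 by linarith
  next
    case b
    have "(1 / 2)\<^sup>2 \<le> (L * u\<^sup>2)\<^sup>2" using b by (intro power_mono) auto
    moreover have "(L * u\<^sup>2)\<^sup>2 = L\<^sup>2 * \<bar>u\<bar> ^ 4" by (simp add: power_mult_distrib flip: power_mult)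
    ultimately have "(1 / 2)\<^sup>2 \<le> L\<^sup>2 * \<bar>u\<bar> ^ 4" by (simp only:)
    then have "1 \<le> 4 * L\<^sup>2 * \<bar>u\<bar> ^ 4" by (simp add: power_divide)
    also have "\<dots> \<le> 4 * L\<^sup>2 * \<bar>u\<bar> ^ 3" using b by (intro mult_left_mono power_decreasing) auto
    also have "\<dots> \<le> 4 * L\<^sup>2 * (real n * \<bar>u\<bar> ^ 3)" using n by (intro mult_left_mono) (auto simp: mult_le_cancel_right1)
    finally have "1 * norm (\<phi> u) ^ (n - 1) \<le> 4 * L\<^sup>2 * (real n * \<bar>u\<bar> ^ 3) * norm (\<phi> u) ^ (n - 1)"
      by (intro mult_right_mono) auto
    also have "\<dots> = 4 * L\<^sup>2 * (real n * \<bar>u\<bar> ^ 3 * norm (\<phi> u) ^ (n - 1))" by simp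
    also have "\<dots> \<le> 4 * L\<^sup>2 * (peak K / sqrt n / (1 + real n * u\<^sup>2))"
      by (intro mult_left_mono small b) auto
    finally have 1: "norm (\<phi> u) ^ (n - 1) \<le> 4 * L\<^sup>2 * peak K / sqrt n / (1 + real n * u\<^sup>2)" by simp
    have "norm (\<phi> u) ^ n \<le> norm (\<phi> u) ^ (n - 1)" by (intro power_decreasing norm_phi_le_1) auto
    then show ?thesis using 1 abs_ge B0 ind0[OF b(1)] by simp
  next
    case c
    have "1 < u\<^sup>2" using c by (metis one_less_power power2_abs pos2)
    then have "1 * 1 < L * u\<^sup>2" using L by (intro mult_le_less_imp_less) auto
    then have "1 / 2 < L * u\<^sup>2" by simp
    moreover have "norm (\<phi> u) ^ n \<le> peak K / (real n)\<^sup>2 * (norm (\<phi> u))\<^sup>2"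
      using c n by (intro norm_phi_power_large) auto
    ultimately show ?thesis using abs_ge A0 ind0 by simp
  qed
  then show ?thesis by (simp add: L_def)
qed

text \<open>The first term is the integral of the indicator in \<open>Re_phi_power_ge\<close>, of
  order \<open>1 / sqrt n\<close>; the corrections integrate to order \<open>1 / n\<close> and lose
  for large \<open>n\<close>.\<close>

lemma Re_G_ge:
  assumes n: "8 \<le> n"
  shows "1 / sqrt (2 * real n * (1 + K)) - (4 * (1 + K)\<^sup>2 * peak K * pi + 2 * pi * K * peak K) / real n
    \<le> 2 * pi * Re (G (n - 1) 0)"
proof -
  define w where "w = 1 / sqrt (2 * real n * (1 + K))"
  have n0: "0 < real n" using n by simp
  have nL: "0 < 2 * real n * (1 + K)" using n0 K_pos by simp
  have w0: "0 < w" using nL by (simp add: w_def)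
  have set_eq: "{u. 2 * real n * (1 + K) * u\<^sup>2 \<le> 1} = {-w..w}"
  proof -
    have "2 * real n * (1 + K) * u\<^sup>2 \<le> 1 \<longleftrightarrow> u \<in> {-w..w}" for u
    proof -
      have "2 * real n * (1 + K) * u\<^sup>2 \<le> 1 \<longleftrightarrow> u\<^sup>2 \<le> 1 / (2 * real n * (1 + K))"
        using nL by (subst pos_le_divide_eq) (auto simp: mult.commute)
      also have "1 / (2 * real n * (1 + K)) = w\<^sup>2"
        using nL by (simp add: w_def power_divide)
      also have "u\<^sup>2 \<le> w\<^sup>2 \<longleftrightarrow> \<bar>u\<bar> \<le> w"
        using w0 by (simp add: abs_le_square_iff[symmetric])
      also have "\<dots> \<longleftrightarrow> u \<in> {-w..w}" by auto
      finally show ?thesis .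
    qed
    then show ?thesis by (intro set_eqI) (simp only: mem_Collect_eq)
  qed
  define A where "A = 4 * (1 + K)\<^sup>2 * peak K / sqrt n"
  define B where "B = peak K / (real n)\<^sup>2"
  have d: "has_bochner_integral lborel (\<lambda>u. A / (1 + real n * u\<^sup>2) + B * (norm (\<phi> u))\<^sup>2)
      (A * (pi / sqrt n) + B * (LINT u|lborel. (norm (\<phi> u))\<^sup>2))"
    using n by (intro dominating_integral) auto
  have k1: "1 \<le> n - 1" and Sn: "Suc (n - 1) = n" using n by auto
  have iG: "integrable lborel (\<lambda>u. Re (\<phi> u ^ n))"
    using integrable_Re[OF integrable_G[OF k1, of 0]] unfolding Sn by simp
  have iI: "integrable lborel (\<lambda>u. 1 / 2 * indicator {-w..w} u :: real)"
    by (intro integrable_mult_right integrable_real_indicator) (auto simp: emeasure_lborel_Icc_eq)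
  have "w = (LINT u|lborel. 1 / 2 * indicator {-w..w} u :: real)"
    using w0 by simp
  also have "\<dots> \<le> (LINT u|lborel. Re (\<phi> u ^ n) + (A / (1 + real n * u\<^sup>2) + B * (norm (\<phi> u))\<^sup>2))"
  proof (rule integral_mono[OF iI Bochner_Integration.integrable_add[OF iG]])
    show "integrable lborel (\<lambda>u. A / (1 + real n * u\<^sup>2) + B * (norm (\<phi> u))\<^sup>2)"
      using d by (simp add: has_bochner_integral_iff)
    fix u
    show "1 / 2 * indicator {-w..w} u \<le> Re (\<phi> u ^ n) + (A / (1 + real n * u\<^sup>2) + B * (norm (\<phi> u))\<^sup>2)"
      using Re_phi_power_ge[OF n, of u] unfolding set_eq A_def B_def .
  qed
  also have "\<dots> = 2 * pi * Re (G (n - 1) 0) + (A * (pi / sqrt n) + B * (LINT u|lborel. (norm (\<phi> u))\<^sup>2))"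
  proof -
    have "2 * pi * Re (G (n - 1) 0) = (LINT u|lborel. Re (\<phi> u ^ n))"
      unfolding Re_G[OF k1] Sn by simp
    then show ?thesis using d iG by (simp add: has_bochner_integral_iff)
  qed
  finally have 1: "w \<le> 2 * pi * Re (G (n - 1) 0) + (A * (pi / sqrt n) + B * (LINT u|lborel. (norm (\<phi> u))\<^sup>2))" .
  have eqA: "A * (pi / sqrt n) = 4 * (1 + K)\<^sup>2 * peak K * pi / real n"
  proof -
    have "A * (pi / sqrt n) = 4 * (1 + K)\<^sup>2 * peak K * pi / (sqrt n * sqrt n)" by (simp add: A_def)
    then show ?thesis by simp
  qed
  have "A * (pi / sqrt n) + B * (LINT u|lborel. (norm (\<phi> u))\<^sup>2) \<le> A * (pi / sqrt n) + peak K / real n * (2 * pi * K)"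
  proof (intro add_mono mult_mono integral_phi_sq order_refl)
    show "B \<le> peak K / real n"
      using n peak_pos[of K] unfolding B_def by (intro divide_left_mono) (auto simp: power2_eq_square)
  qed (use peak_pos[of K] n in \<open>auto simp: A_def intro!: Bochner_Integration.integral_nonneg\<close>)
  also have "\<dots> = (4 * (1 + K)\<^sup>2 * peak K * pi + 2 * pi * K * peak K) / real n"
    by (simp only: eqA) (simp add: add_divide_distrib mult.commute)
  finally show ?thesis using 1 unfolding w_def by linarith
qed

text \<open>Both integrals carry the factor \<open>\<phi> u ^ (n - 1)\<close>, so only the
  difference between \<open>\<phi> u\<close> and \<open>iexp (u * y)\<close> matters. Near 0 it
  costs order \<open>u\<^sup>2\<close>, or \<open>n * u ^ 4\<close> for the linear term, and both
  scale like \<open>1 / n\<close> where the majorant lives.\<close>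

lemma Re_G_diff_le:
  assumes n: "8 \<le> n"
  shows "\<bar>Re (G (n - 1) 0) - Re (G (n - 2) (- y))\<bar> \<le> (1 + y\<^sup>2) * ((1 + K) * peak K * (1 + 2 * K)) / (real n * sqrt n)"
proof -
  define L where "L = 1 + K"
  have L: "1 \<le> L" using K_pos by (simp add: L_def)
  have y1: "\<bar>y\<bar> \<le> 1 + y\<^sup>2" using sum_squares_bound[of "\<bar>y\<bar>" 1] by (simp add: power2_eq_square[symmetric])
  have k1: "1 \<le> n - 1" "1 \<le> n - 2" and Sn: "Suc (n - 1) = n" "Suc (n - 2) = n - 1" using n by auto
  define A where "A = (1 + y\<^sup>2) * (L * peak K / real n)"
  define B where "B = 2 * (peak K / (real n)\<^sup>2)"
  have d: "has_bochner_integral lborel (\<lambda>u. A / (1 + real n * u\<^sup>2) + B * (norm (\<phi> u))\<^sup>2)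
      (A * (pi / sqrt n) + B * (LINT u|lborel. (norm (\<phi> u))\<^sup>2))"
    using n by (intro dominating_integral) auto
  have A0: "0 \<le> A" and B0: "0 \<le> B" using peak_pos[of K] L by (auto simp: A_def B_def)
  have pw: "\<bar>Re (\<phi> u ^ n) - Re (\<phi> u ^ (n - 1) * iexp (u * y))\<bar> \<le> A / (1 + real n * u\<^sup>2) + B * (norm (\<phi> u))\<^sup>2" for u
  proof (cases "\<bar>u\<bar> \<le> 1")
    case True
    define P where "P = \<phi> u ^ (n - 1)"
    have nP: "norm P \<le> norm (\<phi> u) ^ (n - 2)"
      unfolding P_def norm_power by (intro power_decreasing norm_phi_le_1) auto
    have ImP: "\<bar>Im P\<bar> \<le> real n * (L * \<bar>u\<bar> ^ 3) * norm (\<phi> u) ^ (n - 2)"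
    proof -
      have "\<bar>Im P\<bar> \<le> norm (P - of_real (Re (\<phi> u) ^ (n - 1)))"
        using abs_Im_le_cmod[of "P - of_real (Re (\<phi> u) ^ (n - 1))"] by (simp del: of_real_power)
      also have "\<dots> \<le> real (n - 1) * \<bar>Im (\<phi> u)\<bar> * norm (\<phi> u) ^ (n - 1 - 1)"
        unfolding P_def by (rule norm_power_diff_Re_le)
      also have "n - 1 - 1 = n - 2" by simp
      also have "real (n - 1) * \<bar>Im (\<phi> u)\<bar> * norm (\<phi> u) ^ (n - 2) \<le> real n * (L * \<bar>u\<bar> ^ 3) * norm (\<phi> u) ^ (n - 2)"
        using Im_phi[of u] n L by (intro mult_right_mono mult_mono) (auto simp: L_def)
      finally show ?thesis .
    qed
    \<comment> \<open>The exponential is split as \<open>1 + \<i> * (u * y)\<close> plus a quadratic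
      remainder, while \<open>\<phi> u - 1\<close> is itself quadratic. The linear term contributes
      \<open>- Im P * (u * y)\<close> to the real part, and \<open>ImP\<close> supplies three
      further powers of \<open>u\<close>.\<close>
    have "\<phi> u ^ n = P * \<phi> u" using Sn(1) unfolding P_def by (metis power_Suc2)
    then have "\<phi> u ^ n - P * iexp (u * y) = P * (\<phi> u - 1) - P * (iexp (u * y) - 1 - \<i> * (u * y)) - P * (\<i> * (u * y))"
      by (simp add: algebra_simps)
    then have "Re (\<phi> u ^ n) - Re (P * iexp (u * y))
       = Re (P * (\<phi> u - 1)) - Re (P * (iexp (u * y) - 1 - \<i> * (u * y))) - Re (P * (\<i> * (u * y)))"
      by (metis minus_complex.sel(1))
    moreover have "\<bar>Re (P * (\<phi> u - 1))\<bar> \<le> norm (\<phi> u) ^ (n - 2) * (L * u\<^sup>2)"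
    proof -
      have "\<bar>Re (P * (\<phi> u - 1))\<bar> \<le> norm P * norm (\<phi> u - 1)" by (metis abs_Re_le_cmod norm_mult)
      also have "\<dots> \<le> norm (\<phi> u) ^ (n - 2) * (L * u\<^sup>2)"
        using phi_minus_1[of u] by (intro mult_mono nP) (auto simp: L_def)
      finally show ?thesis .
    qed
    moreover have "\<bar>Re (P * (iexp (u * y) - 1 - \<i> * (u * y)))\<bar> \<le> norm (\<phi> u) ^ (n - 2) * ((u * y)\<^sup>2 / 2)"
    proof -
      have "\<bar>Re (P * (iexp (u * y) - 1 - \<i> * (u * y)))\<bar> \<le> norm P * norm (iexp (u * y) - 1 - \<i> * (u * y))"
        by (metis abs_Re_le_cmod norm_mult)
      also have "\<dots> \<le> norm (\<phi> u) ^ (n - 2) * ((u * y)\<^sup>2 / 2)"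
        by (intro mult_mono nP iexp_bound) auto
      finally show ?thesis .
    qed
    moreover have "\<bar>Re (P * (\<i> * (u * y)))\<bar> \<le> norm (\<phi> u) ^ (n - 2) * (real n * L * u ^ 4 * (1 + y\<^sup>2))"
    proof -
      have "\<bar>Re (P * (\<i> * (u * y)))\<bar> = \<bar>Im P\<bar> * (\<bar>u\<bar> * \<bar>y\<bar>)" by (simp add: abs_mult)
      also have "\<dots> \<le> (real n * (L * \<bar>u\<bar> ^ 3) * norm (\<phi> u) ^ (n - 2)) * (\<bar>u\<bar> * (1 + y\<^sup>2))"
        using ImP y1 L by (intro mult_mono) auto
      also have "\<dots> = norm (\<phi> u) ^ (n - 2) * (real n * L * \<bar>u\<bar> ^ 4 * (1 + y\<^sup>2))"
        by (simp add: power4_eq_xxxx power3_eq_cube)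
      finally show ?thesis by simp
    qed
    ultimately have "\<bar>Re (\<phi> u ^ n) - Re (P * iexp (u * y))\<bar>
      \<le> norm (\<phi> u) ^ (n - 2) * (L * u\<^sup>2) + norm (\<phi> u) ^ (n - 2) * ((u * y)\<^sup>2 / 2)
        + norm (\<phi> u) ^ (n - 2) * (real n * L * u ^ 4 * (1 + y\<^sup>2))" by linarith
    also have "\<dots> = norm (\<phi> u) ^ (n - 2) * (L * u\<^sup>2 + (u * y)\<^sup>2 / 2 + real n * L * u ^ 4 * (1 + y\<^sup>2))"
      by (simp add: algebra_simps)
    also have "\<dots> \<le> norm (\<phi> u) ^ (n - 2) * ((1 + y\<^sup>2) * (L / real n) * (1 + real n * u\<^sup>2)\<^sup>2)"
    proof (intro mult_left_mono)
      have "(u * y)\<^sup>2 / 2 \<le> (u * y)\<^sup>2" by simp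
      also have "\<dots> \<le> L * (u * y)\<^sup>2" using L by (simp add: mult_le_cancel_right1)
      finally have "L * u\<^sup>2 + (u * y)\<^sup>2 / 2 \<le> (1 + y\<^sup>2) * L * u\<^sup>2" by (simp add: algebra_simps power_mult_distrib)
      then have "L * u\<^sup>2 + (u * y)\<^sup>2 / 2 + real n * L * u ^ 4 * (1 + y\<^sup>2)
        \<le> (1 + y\<^sup>2) * L * (u\<^sup>2 + real n * u ^ 4)" by (simp add: algebra_simps)
      also have "\<dots> = (1 + y\<^sup>2) * (L / real n) * (real n * u\<^sup>2 + (real n * u\<^sup>2)\<^sup>2)"
        using n by (simp add: power2_eq_square power4_eq_xxxx field_simps)
      also have "\<dots> \<le> (1 + y\<^sup>2) * (L / real n) * (1 + real n * u\<^sup>2)\<^sup>2"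
      proof (rule mult_left_mono)
        have "(1 + real n * u\<^sup>2)\<^sup>2 = 1 + 2 * (real n * u\<^sup>2) + (real n * u\<^sup>2)\<^sup>2" by (simp add: power2_eq_square algebra_simps)
        moreover have "0 \<le> real n * u\<^sup>2" by simp
        ultimately show "real n * u\<^sup>2 + (real n * u\<^sup>2)\<^sup>2 \<le> (1 + real n * u\<^sup>2)\<^sup>2" by linarith
      qed (use L in simp)
      finally show "L * u\<^sup>2 + (u * y)\<^sup>2 / 2 + real n * L * u ^ 4 * (1 + y\<^sup>2) \<le> (1 + y\<^sup>2) * (L / real n) * (1 + real n * u\<^sup>2)\<^sup>2" .
    qed simp
    also have "\<dots> = ((1 + y\<^sup>2) * (L / real n)) * (norm (\<phi> u) ^ (n - 2) * (1 + real n * u\<^sup>2)\<^sup>2)" by simp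
    also have "\<dots> \<le> ((1 + y\<^sup>2) * (L / real n)) * (peak K / (1 + real n * u\<^sup>2))"
      using n L by (intro mult_left_mono norm_phi_power_small True) auto
    also have "\<dots> = A / (1 + real n * u\<^sup>2)" by (simp add: A_def)
    finally show ?thesis using B0 by (simp add: P_def add_increasing2)
  next
    case False
    have "\<bar>Re (\<phi> u ^ n) - Re (\<phi> u ^ (n - 1) * iexp (u * y))\<bar> \<le> norm (\<phi> u) ^ n + norm (\<phi> u) ^ (n - 1)"
    proof -
      have "\<bar>Re (\<phi> u ^ n)\<bar> \<le> norm (\<phi> u) ^ n"
        using abs_Re_le_cmod[of "\<phi> u ^ n"] by (simp only: norm_power)
      moreover have "\<bar>Re (\<phi> u ^ (n - 1) * iexp (u * y))\<bar> \<le> norm (\<phi> u) ^ (n - 1)"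
        using abs_Re_le_cmod[of "\<phi> u ^ (n - 1) * iexp (u * y)"]
        by (simp only: norm_mult norm_power norm_exp_i_times mult_1_right)
      ultimately show ?thesis by linarith
    qed
    also have "\<dots> \<le> norm (\<phi> u) ^ (n - 1) + norm (\<phi> u) ^ (n - 1)"
      by (intro add_mono power_decreasing norm_phi_le_1) auto
    also have "\<dots> \<le> B * (norm (\<phi> u))\<^sup>2"
    proof -
      have "n + 4 \<le> 2 * (n - 1)" using n by linarith
      then show ?thesis using norm_phi_power_large[of u n "n - 1"] False n by (simp add: B_def)
    qed
    finally show ?thesis using A0 by (simp add: add_increasing)
  qed
  have i1: "integrable lborel (\<lambda>u. Re (\<phi> u ^ n))"
    using integrable_Re[OF integrable_G[OF k1(1), of 0]] unfolding Sn by simp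
  have i2: "integrable lborel (\<lambda>u. Re (\<phi> u ^ (n - 1) * iexp (u * y)))"
    using integrable_Re[OF integrable_G[OF k1(2), of "- y"]] unfolding Sn by simp
  have "2 * pi * (Re (G (n - 1) 0) - Re (G (n - 2) (- y)))
    = (LINT u|lborel. Re (\<phi> u ^ n) - Re (\<phi> u ^ (n - 1) * iexp (u * y)))"
    unfolding right_diff_distrib Re_G[OF k1(1)] Re_G[OF k1(2)] Sn Bochner_Integration.integral_diff[OF i1 i2]
    by simp
  then have "\<bar>2 * pi * (Re (G (n - 1) 0) - Re (G (n - 2) (- y)))\<bar>
    = \<bar>LINT u|lborel. Re (\<phi> u ^ n) - Re (\<phi> u ^ (n - 1) * iexp (u * y))\<bar>"
    by (rule arg_cong)
  moreover have "\<bar>2 * pi * z\<bar> = 2 * pi * \<bar>z\<bar>" for z :: real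
    by (simp add: abs_mult)
  ultimately have "2 * pi * \<bar>Re (G (n - 1) 0) - Re (G (n - 2) (- y))\<bar>
    = \<bar>LINT u|lborel. Re (\<phi> u ^ n) - Re (\<phi> u ^ (n - 1) * iexp (u * y))\<bar>"
    by (simp only:)
  also have "\<dots> \<le> (LINT u|lborel. A / (1 + real n * u\<^sup>2) + B * (norm (\<phi> u))\<^sup>2)"
    using Bochner_Integration.integral_norm_bound_integral[OF Bochner_Integration.integrable_diff[OF i1 i2],
      of "\<lambda>u. A / (1 + real n * u\<^sup>2) + B * (norm (\<phi> u))\<^sup>2"] d pw
    by (simp add: has_bochner_integral_iff)
  also have "\<dots> = A * (pi / sqrt n) + B * (LINT u|lborel. (norm (\<phi> u))\<^sup>2)"
    using d by (simp add: has_bochner_integral_iff)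
  also have "\<dots> \<le> A * (pi / sqrt n) + 2 * ((1 + y\<^sup>2) * (L * peak K / (real n * sqrt n))) * (2 * pi * K)"
  proof (intro add_mono mult_mono integral_phi_sq order_refl)
    have "sqrt n \<le> n" using n by (simp add: real_le_lsqrt power2_eq_square)
    then have "peak K / (real n)\<^sup>2 \<le> peak K / (real n * sqrt n)"
      using n peak_pos[of K] by (intro divide_left_mono) (auto simp: power2_eq_square)
    also have "\<dots> = 1 * (1 * (peak K / (real n * sqrt n)))" by simp
    also have "\<dots> \<le> (1 + y\<^sup>2) * (L * (peak K / (real n * sqrt n)))"
      using L peak_pos[of K] by (intro mult_mono) auto
    finally show "B \<le> 2 * ((1 + y\<^sup>2) * (L * peak K / (real n * sqrt n)))" by (simp add: B_def)
  qed (use A0 L peak_pos[of K] n in \<open>auto intro!: Bochner_Integration.integral_nonneg\<close>)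
  also have "\<dots> = pi * ((1 + y\<^sup>2) * (L * peak K / (real n * sqrt n))) * (1 + 4 * K)"
    by (simp add: A_def algebra_simps add_divide_distrib)
  also have "\<dots> \<le> pi * ((1 + y\<^sup>2) * (L * peak K / (real n * sqrt n))) * (2 * (1 + 2 * K))"
    using L K_pos peak_pos[of K] by (intro mult_left_mono) auto
  also have "\<dots> = 2 * pi * ((1 + y\<^sup>2) * (L * peak K * (1 + 2 * K)) / (real n * sqrt n))"
    by simp
  finally show ?thesis
    unfolding L_def by (subst (asm) mult_le_cancel_left_pos) auto
qed

end

text \<open>\<open>N\<close> and \<open>B\<close> are fixed before \<open>f\<close>, which is what
  permits a density varying with \<open>n\<close>. The crude bound \<open>b \<le> B * c\<close>
  accompanies the sharp one because probabilities will be taken under the conditional density, which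
  it compares with the tilted one.\<close>

theorem conv_pow_ratio:
  fixes K :: real
  shows "\<exists>N B. 0 < B \<and> (\<forall>f n. centered_density K f \<longrightarrow> N \<le> n \<longrightarrow> (\<exists>c>0. conv_pow f (n - 1) 0 = ennreal c \<and>
    (\<forall>y. \<exists>b\<ge>0. conv_pow f (n - 2) (- y) = ennreal b \<and> b \<le> B * c \<and> \<bar>b / c - 1\<bar> \<le> B * (1 + y\<^sup>2) / real n)))"
proof (cases "0 < K")
  case False
  then have "\<not> centered_density K f" for f using centered_density.K_pos[of K f] by auto
  then show ?thesis by (intro exI[of _ 0] exI[of _ 1]) auto
next
  case K: True
  define E where "E = 4 * (1 + K)\<^sup>2 * peak K * pi + 2 * pi * K * peak K"
  define r where "r = sqrt (2 * (1 + K))"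
  \<comment> \<open>\<open>Re_G_ge\<close> reads
    \<open>1 / (r * sqrt n) - E / n \<le> 2 * pi * c\<close>. From \<open>N\<close> on, the error is
    at most half of the main term, which leaves \<open>c \<ge> a / sqrt n\<close>. \<open>W\<close>
    and \<open>U\<close> are the constants of the difference and of the upper bound, both divided by
    this lower bound in \<open>B\<close>.\<close>
  define a where "a = 1 / (4 * pi * r)"
  define W where "W = (1 + K) * peak K * (1 + 2 * K)"
  define U where "U = peak K * (1 + K)"
  define B where "B = (W + U) / a"
  define N where "N = 8 + nat \<lceil>(2 * r * E)\<^sup>2\<rceil>"
  have r: "0 < r" using K by (simp add: r_def)
  have a: "0 < a" using r by (simp add: a_def)
  have E: "0 \<le> E" and W: "0 < W" and U: "0 < U" using K peak_pos[of K] by (auto simp: E_def W_def U_def)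
  have B: "0 < B" using a W U by (simp add: B_def)
  have main: "\<exists>c>0. conv_pow f (n - 1) 0 = ennreal c \<and>
    (\<forall>y. \<exists>b\<ge>0. conv_pow f (n - 2) (- y) = ennreal b \<and> b \<le> B * c \<and> \<bar>b / c - 1\<bar> \<le> B * (1 + y\<^sup>2) / real n)"
    if f: "centered_density K f" and n: "N \<le> n" for f n
  proof -
    interpret centered_density K f by (rule f)
    have n8: "8 \<le> n" using n by (simp add: N_def)
    define s where "s = sqrt (real n)"
    have s: "0 < s" "real n = s * s" using n8 by (auto simp: s_def)
    define c where "c = Re (G (n - 1) 0)"
    have rE: "2 * r * E \<le> s"
    proof -
      have "(2 * r * E)\<^sup>2 \<le> real n" using n unfolding N_def by linarith
      then show ?thesis unfolding s_def by (rule real_le_rsqrt)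
    qed
    have "a / s \<le> c"
    proof -
      have "E / real n \<le> 1 / (2 * r * s)"
      proof -
        have "E / real n = (2 * r * E) / (2 * r * (s * s))" using r s by simp
        also have "\<dots> \<le> s / (2 * r * (s * s))" using rE r s by (intro divide_right_mono) auto
        also have "\<dots> = 1 / (2 * r * s)" using s by simp
        finally show ?thesis .
      qed
      moreover have "sqrt (2 * real n * (1 + K)) = r * s"
        unfolding r_def s_def real_sqrt_mult[symmetric] by (simp add: mult_ac)
      ultimately have "1 / (r * s) - 1 / (2 * r * s) \<le> 2 * pi * c"
        using Re_G_ge[OF n8] unfolding E_def c_def by simp
      moreover have "1 / (r * s) - 1 / (2 * r * s) = 2 * pi * (a / s)"
        using r s by (simp add: a_def field_simps)
      ultimately show ?thesis by (simp del: times_divide_eq_right)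
    qed
    then have c: "0 < c" using divide_pos_pos[OF a s(1)] by linarith
    have cs: "1 / (c * s) \<le> 1 / a"
      using \<open>a / s \<le> c\<close> a c s(1) by (intro divide_left_mono) (auto simp: field_simps)
    have k: "1 \<le> n - 1" "1 \<le> n - 2" "2 \<le> n - 1" "2 \<le> n - 2" using n8 by auto
    have "\<exists>b\<ge>0. conv_pow f (n - 2) (- y) = ennreal b \<and> b \<le> B * c \<and> \<bar>b / c - 1\<bar> \<le> B * (1 + y\<^sup>2) / real n" for y
    proof (intro exI[of _ "Re (G (n - 2) (- y))"] conjI)
      let ?b = "Re (G (n - 2) (- y))"
      show "0 \<le> ?b" "conv_pow f (n - 2) (- y) = ennreal ?b"
        using conv_pow_fourier[OF k(2), of "- y"] k by auto
      have "?b \<le> U / s" unfolding U_def s_def using n8 by (intro Re_G_le) auto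
      also have "\<dots> = U * (a / s) / a" using a by simp
      also have "\<dots> \<le> U * c / a" using \<open>a / s \<le> c\<close> U a by (intro divide_right_mono mult_left_mono) auto
      also have "\<dots> \<le> B * c" using W U a c by (simp add: B_def field_simps)
      finally show "?b \<le> B * c" .
      have "\<bar>?b / c - 1\<bar> = \<bar>c - ?b\<bar> / c" using c by (simp add: field_simps abs_minus_commute)
      also have "\<dots> \<le> ((1 + y\<^sup>2) * W / (real n * s)) / c"
        using Re_G_diff_le[OF n8, of y] c unfolding W_def c_def s_def by (intro divide_right_mono) auto
      also have "\<dots> = (1 + y\<^sup>2) * W / real n * (1 / (c * s))" by simp
      also have "\<dots> \<le> (1 + y\<^sup>2) * W / real n * (1 / a)"
        using W cs by (intro mult_left_mono) auto
      also have "\<dots> \<le> (1 + y\<^sup>2) * (W + U) / real n * (1 / a)"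
        using W U a by (intro mult_right_mono divide_right_mono mult_left_mono) auto
      also have "\<dots> = B * (1 + y\<^sup>2) / real n" by (simp add: B_def mult.commute)
      finally show "\<bar>?b / c - 1\<bar> \<le> B * (1 + y\<^sup>2) / real n" .
    qed
    moreover have "conv_pow f (n - 1) 0 = ennreal c"
      using conv_pow_fourier[OF k(1), of 0] k by (simp add: c_def)
    ultimately show ?thesis using c by blast
  qed
  show ?thesis
    by (intro exI[of _ N] exI[of _ B]) (use B main in blast)
qed

section \<open>The conditional law of the first coordinate\<close>

text \<open>The index set is arbitrary because both \<open>{1..<n}\<close> and, once the first
  coordinate is fixed, \<open>{2..<n}\<close> occur. The coordinates in \<open>I\<close> together
  with the determined last one make \<open>card I + 1\<close> factors.\<close>

lemma nn_integral_PiM_conv_pow: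
  assumes [measurable]: "p \<in> borel_measurable borel" and "finite I"
  shows "(\<integral>\<^sup>+ y. (\<Prod>i\<in>I. ennreal (p (y i))) * ennreal (p (s - (\<Sum>i\<in>I. y i))) \<partial>(\<Pi>\<^sub>M i\<in>I. lborel))
    = conv_pow p (card I) s"
  using \<open>finite I\<close>
proof (induction I arbitrary: s rule: finite_induct)
  case empty
  interpret L: product_sigma_finite "\<lambda>_::'a. lborel :: real measure" ..
  show ?case by (simp add: PiM_empty nn_integral_count_space_finite)
next
  case (insert j I)
  interpret L: product_sigma_finite "\<lambda>_::'a. lborel :: real measure" ..
  note [simp] = \<open>finite I\<close> \<open>j \<notin> I\<close>
  have m: "(\<lambda>y. (\<Prod>i\<in>insert j I. ennreal (p (y i))) * ennreal (p (s - (\<Sum>i\<in>insert j I. y i))))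
      \<in> borel_measurable (\<Pi>\<^sub>M i\<in>insert j I. lborel)"
    by measurable
  have e: "(\<Prod>i\<in>insert j I. ennreal (p ((y(j := x)) i))) * ennreal (p (s - (\<Sum>i\<in>insert j I. (y(j := x)) i)))
      = ennreal (p x) * ((\<Prod>i\<in>I. ennreal (p (y i))) * ennreal (p (s - x - (\<Sum>i\<in>I. y i))))" for x :: real and y :: "'a \<Rightarrow> real"
  proof -
    have "(\<Prod>i\<in>I. ennreal (p ((y(j := x)) i))) = (\<Prod>i\<in>I. ennreal (p (y i)))"
      "(\<Sum>i\<in>I. (y(j := x)) i) = (\<Sum>i\<in>I. y i)"
      by (auto intro!: prod.cong sum.cong)
    then show ?thesis by (simp add: mult.assoc diff_diff_eq)
  qed
  have "(\<integral>\<^sup>+ y. (\<Prod>i\<in>insert j I. ennreal (p (y i))) * ennreal (p (s - (\<Sum>i\<in>insert j I. y i))) \<partial>(\<Pi>\<^sub>M i\<in>insert j I. lborel))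
    = (\<integral>\<^sup>+ x. (\<integral>\<^sup>+ y. ennreal (p x) * ((\<Prod>i\<in>I. ennreal (p (y i))) * ennreal (p (s - x - (\<Sum>i\<in>I. y i)))) \<partial>(\<Pi>\<^sub>M i\<in>I. lborel)) \<partial>lborel)"
    by (subst L.product_nn_integral_insert_rev[OF _ _ m]) (simp_all only: e \<open>finite I\<close> \<open>j \<notin> I\<close> not_False_eq_True)
  also have "\<dots> = (\<integral>\<^sup>+ x. ennreal (p x) * conv_pow p (card I) (s - x) \<partial>lborel)"
    by (intro nn_integral_cong, subst nn_integral_cmult) (simp_all add: insert.IH)
  finally show ?case by simp
qed

lemma joint_density_eq:
  assumes "\<And>x. 0 \<le> p x"
  shows "joint_density p n s y = (\<Prod>i\<in>{1..<n}. ennreal (p (y i))) * ennreal (p (s - (\<Sum>i\<in>{1..<n}. y i)))"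
  using assms by (simp add: joint_density_def ennreal_mult prod_nonneg prod_ennreal)

lemma sum_density_eq_conv_pow:
  assumes "p \<in> borel_measurable borel" "\<And>x. 0 \<le> p x"
  shows "sum_density p n s = conv_pow p (n - 1) s"
  unfolding sum_density_def joint_density_eq[OF assms(2)]
  using nn_integral_PiM_conv_pow[OF assms(1), of "{1..<n}"] by simp

lemma cond_law_marginal:
  assumes [measurable]: "p \<in> borel_measurable borel" and p0: "\<And>x. 0 \<le> p x"
    and n: "2 \<le> n" and [measurable]: "B \<in> sets borel"
  shows "emeasure (cond_law p n s) {y \<in> space (cond_law p n s). y 1 \<in> B}
    = (\<integral>\<^sup>+ x. ennreal (p x) * conv_pow p (n - 2) (s - x) * indicator B x \<partial>lborel) / conv_pow p (n - 1) s"
proof -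
  interpret L: product_sigma_finite "\<lambda>_::nat. lborel :: real measure" ..
  let ?I = "{2..<n}"
  have I: "{1..<n} = insert 1 ?I" using n by auto
  have A: "{y \<in> space (\<Pi>\<^sub>M i\<in>{1..n}. borel). y 1 \<in> B} \<in> sets (\<Pi>\<^sub>M i\<in>{1..n}. (borel :: real measure))"
  proof -
    have "(\<lambda>y. y 1) \<in> (\<Pi>\<^sub>M i\<in>{1..n}. (borel :: real measure)) \<rightarrow>\<^sub>M borel"
      using n by (intro measurable_component_singleton) auto
    then show ?thesis by measurable
  qed
  have sp: "space (cond_law p n s) = space (\<Pi>\<^sub>M i\<in>{1..n}. borel)" by (simp add: cond_law_def)
  have m: "(\<lambda>y. (\<Prod>i\<in>insert 1 ?I. ennreal (p (y i))) * ennreal (p (s - (\<Sum>i\<in>insert 1 ?I. y i))) * indicator B (y 1))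
      \<in> borel_measurable (\<Pi>\<^sub>M i\<in>insert 1 ?I. lborel)"
    by measurable
  have e: "(\<Prod>i\<in>insert 1 ?I. ennreal (p ((y(1 := x)) i))) * ennreal (p (s - (\<Sum>i\<in>insert 1 ?I. (y(1 := x)) i))) * indicator B ((y(1 := x)) 1)
      = (ennreal (p x) * indicator B x) * ((\<Prod>i\<in>?I. ennreal (p (y i))) * ennreal (p (s - x - (\<Sum>i\<in>?I. y i))))" for x :: real and y :: "nat \<Rightarrow> real"
  proof -
    have "(\<Prod>i\<in>?I. ennreal (p ((y(1 := x)) i))) = (\<Prod>i\<in>?I. ennreal (p (y i)))"
      "(\<Sum>i\<in>?I. (y(1 := x)) i) = (\<Sum>i\<in>?I. y i)"
      by (auto intro!: prod.cong sum.cong)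
    then show ?thesis by (simp add: mult_ac diff_diff_eq)
  qed
  have "(\<integral>\<^sup>+ y. joint_density p n s y * indicator {y \<in> space (\<Pi>\<^sub>M i\<in>{1..n}. borel). y 1 \<in> B}
        (y(n := s - (\<Sum>i\<in>{1..<n}. y i))) \<partial>(\<Pi>\<^sub>M i\<in>{1..<n}. lborel))
     = (\<integral>\<^sup>+ y. (\<Prod>i\<in>{1..<n}. ennreal (p (y i))) * ennreal (p (s - (\<Sum>i\<in>{1..<n}. y i))) * indicator B (y 1) \<partial>(\<Pi>\<^sub>M i\<in>{1..<n}. lborel))"
    using n by (intro nn_integral_cong) (auto simp: joint_density_eq[OF p0] indicator_def space_PiM PiE_iff extensional_def)
  also have "\<dots> = (\<integral>\<^sup>+ x. (\<integral>\<^sup>+ y. (ennreal (p x) * indicator B x) * ((\<Prod>i\<in>?I. ennreal (p (y i))) * ennreal (p (s - x - (\<Sum>i\<in>?I. y i)))) \<partial>(\<Pi>\<^sub>M i\<in>?I. lborel)) \<partial>lborel)"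
    unfolding I by (subst L.product_nn_integral_insert_rev[OF _ _ m]) (simp, simp, simp only: e)
  also have "\<dots> = (\<integral>\<^sup>+ x. ennreal (p x) * indicator B x * conv_pow p (card ?I) (s - x) \<partial>lborel)"
    by (intro nn_integral_cong, subst nn_integral_cmult) (simp_all only: nn_integral_PiM_conv_pow[OF assms(1)] finite_atLeastLessThan, measurable)
  also have "\<dots> = (\<integral>\<^sup>+ x. ennreal (p x) * conv_pow p (n - 2) (s - x) * indicator B x \<partial>lborel)"
    by (simp add: mult_ac)
  finally show ?thesis
    unfolding sp cond_law_emeasure[OF assms(1) order_trans[OF one_le_numeral n] A] sum_density_eq_conv_pow[OF assms(1) p0]
    by simp
qed

text \<open>Allows the error term to be defined by dividing by the tilted density.\<close>

lemma AE_cond_law_nonzero: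
  assumes [measurable]: "p \<in> borel_measurable borel" and p0: "\<And>x. 0 \<le> p x" and n: "2 \<le> n"
  shows "AE y in cond_law p n s. p (y 1) \<noteq> 0"
proof -
  have m [measurable]: "(\<lambda>y. y 1) \<in> borel_measurable (cond_law p n s)"
    using n unfolding cond_law_def by (simp add: measurable_component_singleton)
  have "emeasure (cond_law p n s) {y \<in> space (cond_law p n s). y 1 \<in> {x. p x = 0}} = 0"
  proof (subst cond_law_marginal[OF assms(1) p0 n])
    have "(\<integral>\<^sup>+ x. ennreal (p x) * conv_pow p (n - 2) (s - x) * indicator {x. p x = 0} x \<partial>lborel) = (\<integral>\<^sup>+ x. 0 \<partial>(lborel :: real measure))"
      by (intro nn_integral_cong) (auto simp: indicator_def)
    then show "(\<integral>\<^sup>+ x. ennreal (p x) * conv_pow p (n - 2) (s - x) * indicator {x. p x = 0} x \<partial>lborel) / conv_pow p (n - 1) s = 0"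
      by simp
  qed auto
  then show ?thesis
    by (intro AE_I[where N = "{y \<in> space (cond_law p n s). y 1 \<in> {x. p x = 0}}"]) (auto simp del: One_nat_def)
qed

text \<open>The exponential factors multiply to one that depends on the sum alone. Tilting therefore
  leaves the law conditioned on the sum unchanged, which permits choosing \<open>t\<close> so that
  the mean is \<open>a\<close>.\<close>

lemma conv_pow_tilt:
  assumes [measurable]: "p \<in> borel_measurable borel" and p0: "\<And>x. 0 \<le> p x" and Z: "0 < Z"
  shows "conv_pow (\<lambda>x. exp (t * x) * p x / Z) k s = ennreal (exp (t * s) / Z ^ Suc k) * conv_pow p k s"
proof (induction k arbitrary: s)
  case 0
  show ?case using Z p0 by (simp add: ennreal_mult[symmetric])
next
  case (Suc k)
  have "ennreal (exp (t * x) * p x / Z) * (ennreal (exp (t * (s - x)) / Z ^ Suc k) * conv_pow p k (s - x))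
      = ennreal (exp (t * s) / Z ^ Suc (Suc k)) * (ennreal (p x) * conv_pow p k (s - x))" for x
  proof -
    have "(exp (t * x) * p x / Z) * (exp (t * (s - x)) / Z ^ Suc k) = exp (t * s) / Z ^ Suc (Suc k) * p x"
      using Z by (simp add: exp_diff right_diff_distrib)
    then have "ennreal (exp (t * x) * p x / Z) * ennreal (exp (t * (s - x)) / Z ^ Suc k) = ennreal (exp (t * s) / Z ^ Suc (Suc k)) * ennreal (p x)"
      using Z p0 by (simp add: ennreal_mult[symmetric] del: power_Suc)
    then show ?thesis by (simp only: mult.assoc[symmetric])
  qed
  then show ?case
    by (simp add: Suc nn_integral_cmult del: power_Suc)
qed

text \<open>The \<open>k + 1\<close> densities contribute \<open>k + 1\<close> factors
  \<open>l\<close>, and the \<open>k\<close> integrations absorb all but one of them.\<close>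

lemma conv_pow_scale:
  assumes [measurable]: "q \<in> borel_measurable borel" and q0: "\<And>x. 0 \<le> q x" and l: "0 < l"
  shows "conv_pow (\<lambda>y. l * q (a + l * y)) k s = ennreal l * conv_pow q k (real (Suc k) * a + l * s)"
proof (induction k arbitrary: s)
  case 0
  show ?case using l q0 by (simp add: ennreal_mult)
next
  case (Suc k)
  have "conv_pow (\<lambda>y. l * q (a + l * y)) (Suc k) s
    = (\<integral>\<^sup>+ x. ennreal l * (ennreal l * (ennreal (q (a + l * x)) * conv_pow q k (real (Suc (Suc k)) * a + l * s - (a + l * x)))) \<partial>lborel)"
  proof (simp only: conv_pow.simps(2) Suc, intro nn_integral_cong)
    fix x
    have "real (Suc k) * a + l * (s - x) = real (Suc (Suc k)) * a + l * s - (a + l * x)"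
      by (simp add: algebra_simps)
    then show "ennreal (l * q (a + l * x)) * (ennreal l * conv_pow q k (real (Suc k) * a + l * (s - x)))
        = ennreal l * (ennreal l * (ennreal (q (a + l * x)) * conv_pow q k (real (Suc (Suc k)) * a + l * s - (a + l * x))))"
      using l q0 by (simp only: ennreal_mult less_imp_le) (simp only: mult_ac)
  qed
  also have "\<dots> = ennreal l * (ennreal \<bar>l\<bar> * (\<integral>\<^sup>+ x. ennreal (q (a + l * x)) * conv_pow q k (real (Suc (Suc k)) * a + l * s - (a + l * x)) \<partial>lborel))"
    using l by (simp add: nn_integral_cmult)
  also have "ennreal \<bar>l\<bar> * (\<integral>\<^sup>+ x. ennreal (q (a + l * x)) * conv_pow q k (real (Suc (Suc k)) * a + l * s - (a + l * x)) \<partial>lborel)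
    = (\<integral>\<^sup>+ z. ennreal (q z) * conv_pow q k (real (Suc (Suc k)) * a + l * s - z) \<partial>lborel)"
    using l by (intro nn_integral_real_affine[symmetric]) auto
  finally show ?case by simp
qed

text \<open>Under the conditional law the first coordinate has density \<open>p x * conv_pow p (n - 2) (n * a - x) / conv_pow p (n - 1) (n * a)\<close>;
  after tilting by \<open>t\<close> and rescaling by \<open>l\<close> around \<open>a\<close> the quotient is the one bounded in \<open>conv_pow_ratio\<close>.\<close>

lemma conditional_density_ratio:
  assumes pm [measurable]: "p \<in> borel_measurable borel" and p0: "\<And>x. 0 \<le> p x"
    and Z: "0 < Z" and l: "0 < l" and n: "2 \<le> n"
    and f: "f = (\<lambda>y. l * (exp (t * (a + l * y)) * p (a + l * y) / Z))"
    and c: "0 < c" "conv_pow f (n - 1) 0 = ennreal c"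
    and b: "\<And>y. 0 \<le> b y" "\<And>y. conv_pow f (n - 2) (- y) = ennreal (b y)"
    and pa0: "\<And>x. 0 \<le> pa x"
    and distr: "distributed (cond_law p n (real n * a)) lborel (\<lambda>y. y 1) (\<lambda>x. ennreal (pa x))"
  shows "AE x in lborel. pa x = exp (t * x) * p x / Z * (b ((x - a) / l) / c)"
proof -
  define q where "q x = exp (t * x) * p x / Z" for x
  have [measurable]: "q \<in> borel_measurable borel" unfolding q_def by measurable
  have q0: "0 \<le> q x" for x using p0 Z by (simp add: q_def)
  have fq: "f = (\<lambda>y. l * q (a + l * y))" by (simp add: f q_def)
  have fm [measurable]: "f \<in> borel_measurable borel" unfolding fq by measurable
  have pam [measurable]: "pa \<in> borel_measurable borel"
    using distributed_borel_measurable[OF distr] pa0 by (simp add: measurable_lborel1)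
  have bm [measurable]: "b \<in> borel_measurable borel"
  proof -
    have "(\<lambda>y. enn2real (conv_pow f (n - 2) (- y))) \<in> borel_measurable borel" by measurable
    then show ?thesis by (simp add: b)
  qed
  have conv_q: "conv_pow q k s = ennreal (exp (t * s) / Z ^ Suc k) * conv_pow p k s" for k s
    unfolding q_def by (rule conv_pow_tilt[OF pm p0 Z])
  have conv_f: "conv_pow f k s = ennreal l * conv_pow q k (real (Suc k) * a + l * s)" for k s
    unfolding fq by (rule conv_pow_scale[OF _ q0 l]) simp
  have inv: "X = ennreal (r / v)" if "ennreal v * X = ennreal r" "0 < v" "0 \<le> r" for X v r
  proof -
    have "X = ennreal v * X / ennreal v"
      using that(2) by (simp add: mult.commute[of _ X] mult_divide_eq_ennreal)
    then show ?thesis using that by (simp add: divide_ennreal)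
  qed
  have C: "conv_pow p (n - 1) (real n * a) = ennreal (c / (l * (exp (t * (real n * a)) / Z ^ n)))"
  proof (rule inv)
    have "ennreal (l * (exp (t * (real n * a)) / Z ^ n)) = ennreal l * ennreal (exp (t * (real n * a)) / Z ^ n)"
      using l Z by (intro ennreal_mult) auto
    moreover have "ennreal c = ennreal l * (ennreal (exp (t * (real n * a)) / Z ^ n) * conv_pow p (n - 1) (real n * a))"
      using n c(2) unfolding conv_f conv_q by (simp add: Suc_diff_Suc del: power_Suc)
    ultimately show "ennreal (l * (exp (t * (real n * a)) / Z ^ n)) * conv_pow p (n - 1) (real n * a) = ennreal c"
      by (simp add: mult.assoc)
  qed (use c l Z in auto)
  have Bx: "conv_pow p (n - 2) (real n * a - x) = ennreal (b ((x - a) / l) / (l * (exp (t * (real n * a - x)) / Z ^ (n - 1))))" for x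
  proof (rule inv)
    have 1: "Suc (n - 2) = n - 1" using n by simp
    \<comment> \<open>The other \<open>n - 1\<close> summands must add up to
      \<open>n * a - x\<close>, a deviation of \<open>a - x\<close> from their mean; this is the
      origin of the argument \<open>- y\<close> in the ratio bound.\<close>
    have 2: "real (n - 1) * a + l * (- ((x - a) / l)) = real n * a - x"
    proof -
      have "l * (- ((x - a) / l)) = a - x" using l by simp
      then show ?thesis using n by (simp only:) (simp add: of_nat_diff algebra_simps)
    qed
    have "ennreal (l * (exp (t * (real n * a - x)) / Z ^ (n - 1))) = ennreal l * ennreal (exp (t * (real n * a - x)) / Z ^ (n - 1))"
      using l Z by (intro ennreal_mult) auto
    moreover have "ennreal (b ((x - a) / l)) = ennreal l * (ennreal (exp (t * (real n * a - x)) / Z ^ (n - 1)) * conv_pow p (n - 2) (real n * a - x))"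
      using b(2)[of "(x - a) / l"] unfolding conv_f conv_q 1 2 by simp
    ultimately show "ennreal (l * (exp (t * (real n * a - x)) / Z ^ (n - 1))) * conv_pow p (n - 2) (real n * a - x) = ennreal (b ((x - a) / l))"
      by (simp add: mult.assoc)
  qed (use b l Z in auto)
  have val: "ennreal (p x) * conv_pow p (n - 2) (real n * a - x) / conv_pow p (n - 1) (real n * a) = ennreal (q x * (b ((x - a) / l) / c))" for x
  proof -
    have Zn: "Z ^ n = Z * Z ^ (n - 1)" using n by (simp add: power_eq_if)
    have "p x * (b ((x - a) / l) / (l * (exp (t * (real n * a - x)) / Z ^ (n - 1)))) / (c / (l * (exp (t * (real n * a)) / Z ^ n)))
       = q x * (b ((x - a) / l) / c)"
      using l Z c(1) unfolding Zn by (simp add: q_def right_diff_distrib exp_diff field_simps)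
    then show ?thesis
      unfolding C Bx using l Z c(1) p0 b(1) by (simp add: ennreal_mult[symmetric] divide_ennreal)
  qed
  have "density lborel (\<lambda>x. ennreal (pa x)) = density lborel (\<lambda>x. ennreal (q x * (b ((x - a) / l) / c)))"
  proof (rule measure_eqI)
    fix S assume "S \<in> sets (density lborel (\<lambda>x. ennreal (pa x)))"
    then have S [measurable]: "S \<in> sets borel" by simp
    have m: "(\<lambda>y. y 1) \<in> measurable (cond_law p n (real n * a)) lborel"
      by (rule distributed_measurable[OF distr])
    have "emeasure (density lborel (\<lambda>x. ennreal (pa x))) S = emeasure (distr (cond_law p n (real n * a)) lborel (\<lambda>y. y 1)) S"
      by (simp only: distributed_distr_eq_density[OF distr])
    also have "\<dots> = emeasure (cond_law p n (real n * a)) ((\<lambda>y. y 1) -` S \<inter> space (cond_law p n (real n * a)))"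
      using S by (intro emeasure_distr m) simp
    also have "(\<lambda>y. y 1) -` S \<inter> space (cond_law p n (real n * a)) = {y \<in> space (cond_law p n (real n * a)). y 1 \<in> S}"
      by auto
    also have "emeasure (cond_law p n (real n * a)) \<dots>
        = (\<integral>\<^sup>+ x. ennreal (p x) * conv_pow p (n - 2) (real n * a - x) * indicator S x \<partial>lborel) / conv_pow p (n - 1) (real n * a)"
      by (rule cond_law_marginal[OF pm p0 n S])
    also have "\<dots> = (\<integral>\<^sup>+ x. ennreal (p x) * conv_pow p (n - 2) (real n * a - x) * indicator S x / conv_pow p (n - 1) (real n * a) \<partial>lborel)"
      by (rule nn_integral_divide[symmetric]) measurable
    also have "\<dots> = (\<integral>\<^sup>+ x. ennreal (q x * (b ((x - a) / l) / c)) * indicator S x \<partial>lborel)"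
      unfolding val[symmetric] by (simp add: divide_ennreal_def mult_ac)
    also have "\<dots> = emeasure (density lborel (\<lambda>x. ennreal (q x * (b ((x - a) / l) / c)))) S"
      by (subst emeasure_density) auto
    finally show "emeasure (density lborel (\<lambda>x. ennreal (pa x))) S = emeasure (density lborel (\<lambda>x. ennreal (q x * (b ((x - a) / l) / c)))) S" .
  qed simp
  then have "AE x in lborel. ennreal (pa x) = ennreal (q x * (b ((x - a) / l) / c))"
    by (intro sigma_finite_measure.density_unique[OF sigma_finite_lborel]) auto
  then show ?thesis
  proof eventually_elim
    case (elim x)
    have "0 \<le> q x * (b ((x - a) / l) / c)" using q0 b(1) c(1) by (intro mult_nonneg_nonneg divide_nonneg_pos) auto
    then show ?case using elim pa0[of x] by (simp add: q_def)
  qed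
qed

text \<open>Markov's inequality with the weight \<open>1 + y\<^sup>2\<close>: on the exceptional set
  \<open>1 \<le> B / (\<delta> * sqrt n) * (1 + y\<^sup>2)\<close>, and \<open>pa\<close> is at most
  \<open>B\<close> times the tilted density, whence \<open>B\<^sup>2\<close>. The factor
  \<open>2 + K\<close> is the total mass 1 plus the bound \<open>1 + K\<close> on the second
  moment.\<close>

lemma conditional_density_estimate:
  assumes pm [measurable]: "p \<in> borel_measurable borel" and p0: "\<And>x. 0 \<le> p x"
    and Z: "0 < Z" and l: "0 < l" and n: "2 \<le> n" and B: "0 < B" and \<delta>: "0 < \<delta>"
    and f: "f = (\<lambda>y. l * (exp (t * (a + l * y)) * p (a + l * y) / Z))"
    and dens: "centered_density K f"
    and c: "0 < c" "conv_pow f (n - 1) 0 = ennreal c"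
    and b: "\<And>y. \<exists>b\<ge>0. conv_pow f (n - 2) (- y) = ennreal b \<and> b \<le> B * c \<and> \<bar>b / c - 1\<bar> \<le> B * (1 + y\<^sup>2) / real n"
    and pa0: "\<And>x. 0 \<le> pa x"
    and distr: "distributed (cond_law p n (real n * a)) lborel (\<lambda>y. y 1) (\<lambda>x. ennreal (pa x))"
  shows "measure (cond_law p n (real n * a))
     {y \<in> space (cond_law p n (real n * a)). \<bar>pa (y 1) / (exp (t * y 1) * p (y 1) / Z) - 1\<bar> > \<delta> / sqrt n}
     \<le> B\<^sup>2 * (2 + K) / (\<delta> * sqrt n)"
proof -
  interpret centered_density K f by (rule dens)
  from b obtain \<beta> where \<beta>: "\<And>y. 0 \<le> \<beta> y" "\<And>y. conv_pow f (n - 2) (- y) = ennreal (\<beta> y)"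
    "\<And>y. \<beta> y \<le> B * c" "\<And>y. \<bar>\<beta> y / c - 1\<bar> \<le> B * (1 + y\<^sup>2) / real n" by metis
  define \<pi> where "\<pi> x = exp (t * x) * p x / Z" for x
  have [measurable]: "\<pi> \<in> borel_measurable borel" unfolding \<pi>_def by measurable
  have \<pi>0: "0 \<le> \<pi> x" for x using p0 Z by (simp add: \<pi>_def)
  have pam [measurable]: "pa \<in> borel_measurable borel"
    using distributed_borel_measurable[OF distr] pa0 by (simp add: measurable_lborel1)
  define S where "S = {x. \<bar>pa x / \<pi> x - 1\<bar> > \<delta> / sqrt n}"
  have [measurable]: "S \<in> sets borel" unfolding S_def by measurable
  define w where "w y = B\<^sup>2 / (\<delta> * sqrt n) * (1 + y\<^sup>2)" for y :: real
  have sn: "0 < sqrt n" "real n = sqrt n * sqrt n" using n by auto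
  have ae: "AE x in lborel. ennreal (pa x) * indicator S x \<le> ennreal (\<pi> x * w ((x - a) / l))"
    using conditional_density_ratio[OF pm p0 Z l n f c \<beta>(1,2) pa0 distr]
  proof eventually_elim
    case (elim x)
    define y where "y = (x - a) / l"
    have e: "pa x = \<pi> x * (\<beta> y / c)" using elim by (simp add: \<pi>_def y_def)
    show ?case
    proof (cases "x \<in> S \<and> \<pi> x \<noteq> 0")
      case True
      then have "\<delta> / sqrt n < \<bar>\<beta> y / c - 1\<bar>" by (auto simp: S_def e)
      also have "\<dots> \<le> B * (1 + y\<^sup>2) / (sqrt n * sqrt n)" using \<beta>(4)[of y] sn(2) by simp
      finally have "\<delta> / sqrt n * sqrt n < B * (1 + y\<^sup>2) / (sqrt n * sqrt n) * sqrt n"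
        using sn by (intro mult_strict_right_mono) auto
      moreover have "X / (r * r) * r = X / r" "\<delta> / r * r = \<delta>" if "0 < r" for X r :: real
        using that by simp_all
      ultimately have "\<delta> < B * (1 + y\<^sup>2) / sqrt n" using sn(1) by (simp only:)
      then have 1: "1 \<le> B / (\<delta> * sqrt n) * (1 + y\<^sup>2)" using \<delta> sn(1) by (simp add: field_simps)
      have "\<beta> y / c \<le> B" using \<beta>(3)[of y] c(1) by (simp add: field_simps)
      then have "\<beta> y / c \<le> B * (B / (\<delta> * sqrt n) * (1 + y\<^sup>2))"
        using 1 B mult_left_mono[OF 1, of B] by simp
      also have "\<dots> = w y" by (simp add: w_def power2_eq_square)
      finally have "pa x \<le> \<pi> x * w y" unfolding e using \<pi>0 by (intro mult_left_mono) auto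
      then show ?thesis using True by (auto simp: y_def intro: ennreal_leI)
    next
      \<comment> \<open>Either the indicator vanishes, or the tilted density is 0 at
        \<open>x\<close> and then so is \<open>pa x\<close> by \<open>e\<close>.\<close>
      case False
      then show ?thesis using e by (auto simp: indicator_def)
    qed
  qed
  have m: "(\<lambda>y. y 1) \<in> measurable (cond_law p n (real n * a)) lborel"
    by (rule distributed_measurable[OF distr])
  have "emeasure (cond_law p n (real n * a)) {y \<in> space (cond_law p n (real n * a)). y 1 \<in> S}
      = emeasure (distr (cond_law p n (real n * a)) lborel (\<lambda>y. y 1)) S"
    by (subst emeasure_distr[OF m]) (auto intro!: arg_cong2[where f = emeasure])
  also have "\<dots> = emeasure (density lborel (\<lambda>x. ennreal (pa x))) S"
    by (simp only: distributed_distr_eq_density[OF distr])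
  also have "\<dots> = (\<integral>\<^sup>+ x. ennreal (pa x) * indicator S x \<partial>lborel)"
    by (subst emeasure_density) auto
  also have "\<dots> \<le> (\<integral>\<^sup>+ x. ennreal (\<pi> x * w ((x - a) / l)) \<partial>lborel)"
    by (rule nn_integral_mono_AE[OF ae])
  also have "\<dots> = ennreal \<bar>l\<bar> * (\<integral>\<^sup>+ y. ennreal (\<pi> (a + l * y) * w ((a + l * y - a) / l)) \<partial>lborel)"
    using l by (intro nn_integral_real_affine) (auto simp: w_def)
  also have "\<dots> = (\<integral>\<^sup>+ y. ennreal (f y * w y) \<partial>lborel)"
  proof -
    have [measurable]: "w \<in> borel_measurable borel" unfolding w_def by measurable
    have fe: "f y = l * \<pi> (a + l * y)" and wy: "(a + l * y - a) / l = y" for y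
      using l by (simp_all add: f \<pi>_def)
    have "ennreal \<bar>l\<bar> * (\<integral>\<^sup>+ y. ennreal (\<pi> (a + l * y) * w y) \<partial>lborel)
        = (\<integral>\<^sup>+ y. ennreal \<bar>l\<bar> * ennreal (\<pi> (a + l * y) * w y) \<partial>lborel)"
      by (rule nn_integral_cmult[symmetric]) measurable
    also have "\<dots> = (\<integral>\<^sup>+ y. ennreal (f y * w y) \<partial>lborel)"
      using l by (intro nn_integral_cong) (simp add: fe ennreal_mult'[symmetric] mult.assoc)
    finally show ?thesis by (simp only: wy)
  qed
  also have "\<dots> = ennreal (LINT y|lborel. f y * w y)"
  proof (rule nn_integral_eq_integral)
    have "integrable lborel (\<lambda>y. B\<^sup>2 / (\<delta> * sqrt n) * (f y + \<bar>y\<bar> ^ 2 * f y))"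
      using integrable integrable_moment[of 2] by (intro integrable_mult_right Bochner_Integration.integrable_add) auto
    then show "integrable lborel (\<lambda>y. f y * w y)" by (simp add: w_def algebra_simps)
  qed (use B \<delta> in \<open>auto simp: w_def\<close>)
  also have "(LINT y|lborel. f y * w y) = (LINT y|lborel. B\<^sup>2 / (\<delta> * sqrt n) * (f y + \<bar>y\<bar> ^ 2 * f y))"
    by (intro Bochner_Integration.integral_cong refl) (simp add: w_def algebra_simps)
  also have "\<dots> = B\<^sup>2 / (\<delta> * sqrt n) * (1 + (LINT y|lborel. \<bar>y\<bar> ^ 2 * f y))"
    using integrable integrable_moment[of 2] integral_1 by (subst integral_mult_right_zero) (simp add: Bochner_Integration.integral_add)
  also have "\<dots> \<le> B\<^sup>2 / (\<delta> * sqrt n) * (1 + (1 + K))"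
    using moment_le[of 2] \<delta> by (intro mult_left_mono) auto
  finally have "emeasure (cond_law p n (real n * a)) {y \<in> space (cond_law p n (real n * a)). y 1 \<in> S}
      \<le> ennreal (B\<^sup>2 * (2 + K) / (\<delta> * sqrt n))" by (simp add: ennreal_leI)
  then have "measure (cond_law p n (real n * a)) {y \<in> space (cond_law p n (real n * a)). y 1 \<in> S}
      \<le> B\<^sup>2 * (2 + K) / (\<delta> * sqrt n)"
    using \<delta> K_pos by (simp add: measure_def enn2real_leI)
  then show ?thesis by (simp add: S_def \<pi>_def)
qed

section \<open>Exponential tilting of densities with convex tail exponent\<close>

lemma exp_abs_moment:
  shows integrable_exp_abs_moment: "integrable lborel (\<lambda>x::real. \<bar>x\<bar> ^ k * exp (- \<bar>x\<bar>))"
    and exp_abs_moment_le: "(LINT x|lborel. \<bar>x\<bar> ^ k * exp (- \<bar>x\<bar>)) \<le> (2 * fact k :: real)"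
proof -
  define F where "F x = ennreal (x ^ k * exp (- x)) * indicator {0..} x" for x :: real
  have [measurable]: "F \<in> borel_measurable borel" unfolding F_def by measurable
  have "(\<integral>\<^sup>+ x. ennreal (\<bar>x\<bar> ^ k * exp (- \<bar>x\<bar>)) \<partial>lborel) \<le> (\<integral>\<^sup>+ x. F x + F (- x) \<partial>lborel)"
    by (intro nn_integral_mono) (auto simp: F_def indicator_def)
  also have "\<dots> = (\<integral>\<^sup>+ x. F x \<partial>lborel) + (\<integral>\<^sup>+ x. F (- x) \<partial>lborel)"
    by (rule nn_integral_add) auto
  also have "(\<integral>\<^sup>+ x. F (- x) \<partial>lborel) = (\<integral>\<^sup>+ x. F x \<partial>lborel)"
    using nn_integral_real_affine[of F "-1" 0] by simp
  also have "(\<integral>\<^sup>+ x. F x \<partial>lborel) = ennreal (fact k)"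
    unfolding F_def using nn_intergal_power_times_exp_Ici[of k] by simp
  also have "ennreal (fact k) + ennreal (fact k) = ennreal (2 * fact k)"
    by (simp add: ennreal_plus[symmetric] del: ennreal_plus)
  finally have le: "(\<integral>\<^sup>+ x. ennreal (\<bar>x\<bar> ^ k * exp (- \<bar>x\<bar>)) \<partial>lborel) \<le> ennreal (2 * fact k)" .
  show i: "integrable lborel (\<lambda>x::real. \<bar>x\<bar> ^ k * exp (- \<bar>x\<bar>))"
    using le by (intro integrableI_nonneg) (auto intro: le_less_trans)
  show "(LINT x|lborel. \<bar>x\<bar> ^ k * exp (- \<bar>x\<bar>)) \<le> (2 * fact k :: real)"
    using le i by (subst (asm) nn_integral_eq_integral) auto
qed

lemma integral_pos:
  fixes F :: "real \<Rightarrow> real"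
  assumes i: "integrable lborel F" and nn: "\<And>x. 0 \<le> F x" and pos: "\<And>x. A \<le> x \<Longrightarrow> 0 < F x"
  shows "0 < integral\<^sup>L lborel F"
proof -
  have "integral\<^sup>L lborel F \<noteq> 0"
  proof
    assume "integral\<^sup>L lborel F = 0"
    then have "AE x in lborel. F x = 0"
      using integral_nonneg_eq_0_iff_AE[OF i] nn by auto
    then have "AE x in lborel. x \<notin> {A..A + 1}"
      by eventually_elim (use pos in force)
    then have "emeasure lborel {x \<in> space lborel. \<not> x \<notin> {A..A + 1}} = 0"
      by (subst (asm) AE_iff_measurable[OF _ refl]) auto
    moreover have "{x \<in> space lborel. \<not> x \<notin> {A..A + 1}} = {A..A + 1}" by auto
    ultimately have "emeasure lborel {A..A + 1} = 0" by (simp only:)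
    then show False by simp
  qed
  then show ?thesis
    using Bochner_Integration.integral_nonneg[of lborel F] nn by (simp add: less_le)
qed

text \<open>The chord from \<open>x0\<close> to \<open>x\<close> lies above the graph, and at the
  fraction \<open>r\<close> of the way the graph has already risen by 1.\<close>

lemma convex_growth:
  fixes U :: "real \<Rightarrow> real"
  assumes "convex_on S U" "x0 \<in> S" "x \<in> S" "0 < r" "r \<le> 1" "U (x0 + r * (x - x0)) = U x0 + 1"
  shows "1 / r \<le> U x - U x0"
proof -
  have "U ((1 - r) *\<^sub>R x0 + r *\<^sub>R x) \<le> (1 - r) * U x0 + r * U x"
    using assms by (intro convex_onD) auto
  moreover have "(1 - r) *\<^sub>R x0 + r *\<^sub>R x = x0 + r * (x - x0)" by (simp add: algebra_simps)
  ultimately have "1 \<le> r * (U x - U x0)" using assms(6) by (simp add: algebra_simps)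
  then show ?thesis using assms(4) by (simp add: field_simps)
qed

text \<open>All regularity is demanded beyond \<open>A\<close> only, because the assumptions on
  \<open>q\<close> and the class of \<open>h\<close> speak of large arguments; below
  \<open>A\<close> just the bound \<open>P\<close> is kept.\<close>

locale convex_tail =
  fixes p g q h :: "real \<Rightarrow> real" and c A P :: real
  assumes p_meas [measurable]: "p \<in> borel_measurable borel"
    and p_nonneg: "0 \<le> p x" and p_le: "p x \<le> P" and p_neg: "x < 0 \<Longrightarrow> p x = 0"
    and c: "0 < c" and A: "0 < A"
    and p_tail: "A \<le> x \<Longrightarrow> p x = c * exp (- (g x - q x))"
    and q_tail: "A \<le> x \<Longrightarrow> \<bar>q x\<bar> \<le> 1"
    and g_deriv: "A \<le> x \<Longrightarrow> (g has_real_derivative h x) (at x)"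
    and h_mono: "A \<le> x \<Longrightarrow> x \<le> y \<Longrightarrow> h x \<le> h y"
    and h_nonneg: "A \<le> x \<Longrightarrow> 0 \<le> h x"
    and g_super: "filterlim (\<lambda>x. g x / x) at_top at_top"
begin

section \<open>Exponential moments and the tilted mean\<close>

lemma P_nonneg: "0 \<le> P" using p_nonneg[of 0] p_le[of 0] by linarith

lemma g_linear: "\<exists>x0\<ge>A. \<forall>x\<ge>x0. r * x \<le> g x"
proof -
  have "\<forall>\<^sub>F x in at_top. r \<le> g x / x" using g_super by (auto simp: filterlim_at_top)
  then have "\<forall>\<^sub>F x in at_top. r \<le> g x / x \<and> 0 < x" using eventually_gt_at_top[of 0] by (rule eventually_conj)
  then obtain x0 where "\<And>x. x \<ge> x0 \<Longrightarrow> r \<le> g x / x \<and> 0 < x"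
    unfolding eventually_at_top_linorder by blast
  then have "r * x \<le> g x" if "x0 \<le> x" for x
    using that by (metis pos_le_divide_eq)
  then show ?thesis by (intro exI[of _ "max x0 A"]) auto
qed

definition wt :: "real \<Rightarrow> real \<Rightarrow> real" where "wt t x = exp (t * x) * p x"

lemma wt_meas [measurable]: "wt t \<in> borel_measurable borel"
  unfolding wt_def by measurable

lemma wt_nonneg [simp]: "0 \<le> wt t x" by (simp add: wt_def p_nonneg)

lemma wt_pos: "A \<le> x \<Longrightarrow> 0 < wt t x" using c by (simp add: wt_def p_tail)

text \<open>Superlinear growth of \<open>g\<close> beats any linear exponent, so moments of every
  order exist for every real \<open>t\<close>.\<close>

lemma wt_bound: "\<exists>D\<ge>0. \<forall>x. wt t x \<le> D * exp (- \<bar>x\<bar>)"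
proof -
  obtain x0 where x0: "A \<le> x0" "\<And>x. x0 \<le> x \<Longrightarrow> (t + 1) * x \<le> g x" using g_linear[of "t + 1"] by auto
  define D where "D = c * exp 1 + P * exp (\<bar>t\<bar> * x0 + x0)"
  have parts: "0 \<le> c * exp 1" "0 \<le> P * exp (\<bar>t\<bar> * x0 + x0)" using c P_nonneg by auto
  have "wt t x \<le> D * exp (- \<bar>x\<bar>)" for x
  proof -
    consider "x < 0" | "0 \<le> x" "x < x0" | "x0 \<le> x" by linarith
    then show ?thesis
    proof cases
      case 1
      then show ?thesis using parts by (simp add: wt_def p_neg D_def)
    next
      case 2
      have "t * x \<le> \<bar>t\<bar> * x0"
        using 2 by (intro order_trans[OF mult_right_mono[OF abs_ge_self] mult_left_mono]) auto
      then have "exp (t * x) \<le> exp (\<bar>t\<bar> * x0 + x0) * exp (- \<bar>x\<bar>)"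
        using 2 by (simp add: exp_add[symmetric])
      then have "wt t x \<le> (exp (\<bar>t\<bar> * x0 + x0) * exp (- \<bar>x\<bar>)) * P"
        unfolding wt_def by (intro mult_mono p_le p_nonneg) auto
      also have "\<dots> = P * exp (\<bar>t\<bar> * x0 + x0) * exp (- \<bar>x\<bar>)" by simp
      also have "\<dots> \<le> D * exp (- \<bar>x\<bar>)" using parts by (intro mult_right_mono) (auto simp: D_def)
      finally show ?thesis .
    next
      case 3
      have "A \<le> x" using 3 x0 by simp
      have "wt t x = c * exp (t * x - g x + q x)"
        using p_tail[OF \<open>A \<le> x\<close>] by (simp add: wt_def mult_exp_exp algebra_simps)
      also have "\<dots> \<le> c * exp (1 - \<bar>x\<bar>)"
        using c x0(2)[OF 3] q_tail[OF \<open>A \<le> x\<close>] A \<open>A \<le> x\<close>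
        by (intro mult_left_mono) (auto simp: algebra_simps)
      also have "\<dots> = c * exp 1 * exp (- \<bar>x\<bar>)" by (simp add: mult_exp_exp)
      also have "\<dots> \<le> D * exp (- \<bar>x\<bar>)" using parts by (intro mult_right_mono) (auto simp: D_def)
      finally show ?thesis .
    qed
  qed
  moreover have "0 \<le> D" using parts by (simp add: D_def)
  ultimately show ?thesis by blast
qed

lemma integrable_wt: "integrable lborel (\<lambda>x. x ^ k * wt t x)"
proof -
  obtain D where D: "0 \<le> D" "\<And>x. wt t x \<le> D * exp (- \<bar>x\<bar>)" using wt_bound by blast
  have "integrable lborel (\<lambda>x::real. D * (\<bar>x\<bar> ^ k * exp (- \<bar>x\<bar>)))"
    by (intro integrable_mult_right integrable_exp_abs_moment)
  then show ?thesis
  proof (rule Bochner_Integration.integrable_bound)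
    show "AE x in lborel. norm (x ^ k * wt t x) \<le> norm (D * (\<bar>x\<bar> ^ k * exp (- \<bar>x\<bar>)))"
    proof (intro AE_I2)
      fix x
      have "\<bar>x\<bar> ^ k * wt t x \<le> \<bar>x\<bar> ^ k * (D * exp (- \<bar>x\<bar>))" by (intro mult_left_mono D) auto
      then show "norm (x ^ k * wt t x) \<le> norm (D * (\<bar>x\<bar> ^ k * exp (- \<bar>x\<bar>)))"
        using D(1) by (simp add: abs_mult power_abs mult_ac)
    qed
  qed simp
qed

lemmas integrable_wt0 = integrable_wt[of 0, simplified]
lemmas integrable_wt1 = integrable_wt[of 1, simplified]

lemma Phi_eq: "Phi p t = (LINT x|lborel. wt t x)"
  unfolding Phi_def set_lebesgue_integral_def
  by (intro Bochner_Integration.integral_cong refl) (auto simp: wt_def indicator_def p_neg)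

lemma Phi_pos: "0 < Phi p t"
  unfolding Phi_eq by (rule integral_pos[OF integrable_wt0 _ wt_pos]) auto

definition M1 :: "real \<Rightarrow> real" where "M1 t = (LINT x|lborel. x * wt t x)"

text \<open>Differentiation under the integral by a second-order Taylor bound. As \<open>p\<close>
  lives on nonnegative arguments, the remainder for \<open>\<bar>\<delta>\<bar> \<le> 1\<close> is
  at most \<open>\<delta>\<^sup>2\<close> times the second moment at \<open>t + 1\<close>.\<close>

lemma Phi_deriv: "(Phi p has_real_derivative M1 t) (at t)"
proof -
  define C where "C = (LINT x|lborel. x ^ 2 * wt (t + 1) x)"
  have bnd: "\<bar>(Phi p (t + \<delta>) - Phi p t) / \<delta> - M1 t\<bar> \<le> \<bar>\<delta>\<bar> * C" if \<delta>: "\<delta> \<noteq> 0" "\<bar>\<delta>\<bar> \<le> 1" for \<delta>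
  proof -
    have pw: "\<bar>wt (t + \<delta>) x - wt t x - \<delta> * (x * wt t x)\<bar> \<le> \<delta>\<^sup>2 * (x ^ 2 * wt (t + 1) x)" for x
    proof (cases "x < 0")
      case True
      then show ?thesis by (simp add: wt_def p_neg)
    next
      case False
      obtain r where r: "\<bar>r\<bar> \<le> \<bar>\<delta> * x\<bar>" "exp (\<delta> * x) = (\<Sum>m<2. (\<delta> * x) ^ m / fact m) + exp r / fact 2 * (\<delta> * x) ^ 2"
        using Maclaurin_exp_le[of "\<delta> * x" 2] by blast
      have "r \<le> x"
      proof -
        have "\<bar>\<delta> * x\<bar> \<le> 1 * x" using \<delta> False by (simp only: abs_mult) (intro mult_mono, auto)
        then show ?thesis using r(1) by linarith
      qed
      have e: "exp (\<delta> * x) - 1 - \<delta> * x = exp r / 2 * (\<delta> * x)\<^sup>2"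
        using r(2) by (simp add: numeral_2_eq_2)
      have "wt (t + \<delta>) x - wt t x - \<delta> * (x * wt t x) = (exp (\<delta> * x) - 1 - \<delta> * x) * wt t x"
        by (simp add: wt_def exp_add algebra_simps)
      also have "\<dots> = \<delta>\<^sup>2 * (x ^ 2 * (exp r / 2 * wt t x))" unfolding e by (simp add: power_mult_distrib)
      finally have "\<bar>wt (t + \<delta>) x - wt t x - \<delta> * (x * wt t x)\<bar> = \<delta>\<^sup>2 * (x ^ 2 * (exp r / 2 * wt t x))"
        by (simp only:) (rule abs_of_nonneg, simp)
      also have "\<dots> \<le> \<delta>\<^sup>2 * (x ^ 2 * (exp x * wt t x))"
      proof (intro mult_left_mono mult_right_mono)
        have "exp r \<le> exp x" using \<open>r \<le> x\<close> by simp
        then show "exp r / 2 \<le> exp x" using exp_gt_zero[of r] by linarith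
      qed auto
      also have "exp x * wt t x = wt (t + 1) x" by (simp add: wt_def exp_add algebra_simps)
      finally show ?thesis .
    qed
    have i0: "integrable lborel (\<lambda>x. wt (t + \<delta>) x - wt t x - \<delta> * (x * wt t x))"
      by (intro Bochner_Integration.integrable_diff integrable_mult_right integrable_wt0 integrable_wt1)
    have e1: "Phi p (t + \<delta>) - Phi p t - \<delta> * M1 t = (LINT x|lborel. wt (t + \<delta>) x - wt t x - \<delta> * (x * wt t x))"
      unfolding Phi_eq M1_def by (simp add: integrable_wt0 integrable_wt1)
    have e2: "\<bar>LINT x|lborel. wt (t + \<delta>) x - wt t x - \<delta> * (x * wt t x)\<bar> \<le> (LINT x|lborel. \<delta>\<^sup>2 * (x ^ 2 * wt (t + 1) x))"
      unfolding real_norm_def[symmetric]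
      by (rule Bochner_Integration.integral_norm_bound_integral[OF i0 integrable_mult_right[OF integrable_wt]])
        (simp only: real_norm_def pw)
    have e3: "(LINT x|lborel. \<delta>\<^sup>2 * (x ^ 2 * wt (t + 1) x)) = \<delta>\<^sup>2 * C"
      unfolding C_def by (rule integral_mult_right_zero)
    have e4: "\<bar>Phi p (t + \<delta>) - Phi p t - \<delta> * M1 t\<bar> / \<bar>\<delta>\<bar> \<le> \<delta>\<^sup>2 * C / \<bar>\<delta>\<bar>"
      using e2 unfolding e1 e3 by (rule divide_right_mono) (rule abs_ge_zero)
    have e5: "\<delta>\<^sup>2 * C / \<bar>\<delta>\<bar> = \<bar>\<delta>\<bar> * C"
    proof -
      have "\<delta>\<^sup>2 = \<bar>\<delta>\<bar> * \<bar>\<delta>\<bar>" by (simp add: power2_eq_square)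
      then have "\<delta>\<^sup>2 * C = \<bar>\<delta>\<bar> * (\<bar>\<delta>\<bar> * C)" by (simp only: mult.assoc)
      then show ?thesis using \<delta>(1) by (simp only: nonzero_mult_div_cancel_left abs_eq_0 not_False_eq_True)
    qed
    have "(Phi p (t + \<delta>) - Phi p t) / \<delta> - M1 t = (Phi p (t + \<delta>) - Phi p t - \<delta> * M1 t) / \<delta>"
      using \<delta>(1) by (simp add: diff_divide_distrib)
    then show ?thesis using e4 unfolding e5 by (simp only: abs_divide)
  qed
  have "((\<lambda>\<delta>. (Phi p (t + \<delta>) - Phi p t) / \<delta> - M1 t) \<longlongrightarrow> 0) (at 0)"
  proof (rule Lim_null_comparison)
    have "\<forall>\<^sub>F \<delta> in at (0::real). \<bar>\<delta>\<bar> < 1"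
      using order_tendstoD(2)[OF tendsto_rabs[OF tendsto_ident_at[of 0]], of 1] by simp
    then show "\<forall>\<^sub>F \<delta> in at 0. norm ((Phi p (t + \<delta>) - Phi p t) / \<delta> - M1 t) \<le> \<bar>\<delta>\<bar> * C"
      using eventually_neq_at_within[of 0] by eventually_elim (use bnd in auto)
    show "((\<lambda>\<delta>. \<bar>\<delta>\<bar> * C) \<longlongrightarrow> 0) (at 0)"
      by (auto intro!: tendsto_eq_intros)
  qed
  then show ?thesis
    unfolding DERIV_def by (subst LIM_zero_iff[symmetric])
qed

lemma tilt_mean_eq: "tilt_mean p t = M1 t / Phi p t"
  unfolding tilt_mean_def
  by (rule DERIV_imp_deriv) (auto intro!: derivative_eq_intros Phi_deriv simp: Phi_pos)

text \<open>Chebyshev's association argument: \<open>x - a\<close> and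
  \<open>exp (\<delta> * x) - exp (\<delta> * a)\<close> always have the same sign, so their product
  has positive integral. As \<open>a\<close> is the mean at \<open>t1\<close>, the term with
  \<open>exp (\<delta> * a)\<close> integrates to 0.\<close>

lemma tilt_mean_less:
  assumes "t1 < t2"
  shows "tilt_mean p t1 < tilt_mean p t2"
proof -
  define a where "a = tilt_mean p t1"
  define \<delta> where "\<delta> = t2 - t1"
  have \<delta>: "0 < \<delta>" using assms by (simp add: \<delta>_def)
  have wt2: "wt t2 x = exp (\<delta> * x) * wt t1 x" for x by (simp add: wt_def \<delta>_def mult_exp_exp algebra_simps)
  have c1: "(LINT x|lborel. x * wt t1 x - a * wt t1 x) = 0"
    using Phi_pos[of t1] by (simp add: integrable_wt0 integrable_wt1 a_def tilt_mean_eq M1_def Phi_eq[symmetric])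
  have eq: "(x - a) * (exp (\<delta> * x) - exp (\<delta> * a)) * wt t1 x
      = (x * wt t2 x - a * wt t2 x) - exp (\<delta> * a) * (x * wt t1 x - a * wt t1 x)" for x
    by (simp add: wt2 algebra_simps)
  have i: "integrable lborel (\<lambda>x. (x - a) * (exp (\<delta> * x) - exp (\<delta> * a)) * wt t1 x)"
    unfolding eq by (intro Bochner_Integration.integrable_diff integrable_mult_right integrable_wt0 integrable_wt1)
  have "0 < (LINT x|lborel. (x - a) * (exp (\<delta> * x) - exp (\<delta> * a)) * wt t1 x)"
  proof (rule integral_pos[OF i, of "max A (a + 1)"])
    show "0 \<le> (x - a) * (exp (\<delta> * x) - exp (\<delta> * a)) * wt t1 x" for x
    proof (rule mult_nonneg_nonneg[OF _ wt_nonneg])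
      show "0 \<le> (x - a) * (exp (\<delta> * x) - exp (\<delta> * a))"
        using \<delta> by (cases "x \<le> a") (auto simp: zero_le_mult_iff)
    qed
    show "0 < (x - a) * (exp (\<delta> * x) - exp (\<delta> * a)) * wt t1 x" if "max A (a + 1) \<le> x" for x
      using \<delta> that by (intro mult_pos_pos wt_pos) auto
  qed
  also have "\<dots> = (LINT x|lborel. x * wt t2 x - a * wt t2 x) - exp (\<delta> * a) * (LINT x|lborel. x * wt t1 x - a * wt t1 x)"
    unfolding eq by (simp add: integrable_wt0 integrable_wt1)
  also have "\<dots> = M1 t2 - a * Phi p t2"
    unfolding c1 M1_def Phi_eq by (simp add: integrable_wt0 integrable_wt1)
  finally have "a < M1 t2 / Phi p t2"
    using Phi_pos[of t2] by (simp add: field_simps)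
  then show ?thesis by (simp add: a_def tilt_mean_eq)
qed

text \<open>Strict monotonicity of the mean makes the parameter in the definite description
  unique.\<close>

lemma tilted_density_eq:
  assumes "tilt_mean p t = a"
  shows "tilted_density p a x = exp (t * x) * p x / Phi p t"
proof -
  have "(THE t. tilt_mean p t = a) = t"
  proof (rule the_equality[where a = t])
    fix t' assume "tilt_mean p t' = a"
    then show "t' = t" using assms tilt_mean_less[of t t'] tilt_mean_less[of t' t] by (cases t t' rule: linorder_cases) auto
  qed (rule assms)
  then show ?thesis by (simp add: tilted_density_def)
qed

text \<open>The scale \<open>l\<close> is the width of the level set of \<open>g x - t * x\<close> at height 1 above its minimum,
  attained at \<open>x0\<close>; beyond that level set convexity forces linear growth with slope \<open>1 / l\<close>.\<close>

lemma tilted_exponential_bound: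
  "\<exists>T C. 0 < C \<and> (\<forall>t\<ge>T. \<exists>l>0. \<exists>x0. \<forall>x. wt t x / Phi p t \<le> C / l * exp (- (\<bar>x - x0\<bar> / l)))"
proof -
  \<comment> \<open>The first summand serves \<open>x \<ge> A\<close>, with one unit in the exponent
    for \<open>q\<close> and one for the loss in \<open>growth\<close>; the second serves
    \<open>x < A\<close>, where only \<open>P\<close> is known.\<close>
  define C1 where "C1 = c * exp 2 + P * exp (g A + 1)"
  define C where "C = C1 * exp 2 / c"
  \<comment> \<open>For such \<open>t\<close> the tilted exponent drops by at least 1 between
    \<open>A\<close> and \<open>A + 1\<close>, so the level set at height 1 has its left end in the
    region where convexity holds. The final 1 makes \<open>t\<close> positive.\<close>
  define T where "T = \<bar>1 + g (A + 1) - g A\<bar> + 1"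
  have parts: "0 < c * exp 2" "0 \<le> P * exp (g A + 1)" using c P_nonneg by auto
  have C1: "0 < C1" using parts by (simp add: C1_def)
  have C: "0 < C" using C1 c by (simp add: C_def)
  have "\<exists>l>0. \<exists>x0. \<forall>x. wt t x / Phi p t \<le> C / l * exp (- (\<bar>x - x0\<bar> / l))" if t: "T \<le> t" for t
  proof -
    define U where "U x = g x - t * x" for x
    have U_deriv: "(U has_real_derivative h x - t) (at x)" if "A \<le> x" for x
      unfolding U_def by (auto intro!: derivative_eq_intros g_deriv that)
    have U_cont: "continuous_on {a..b} U" if "A \<le> a" for a b
      using that by (intro continuous_at_imp_continuous_on) (auto intro!: DERIV_isCont U_deriv)
    have U_convex: "convex_on {A..} U"
      by (rule convex_on_realI[where f' = "\<lambda>x. h x - t"]) (auto intro!: U_deriv h_mono connected_Ici)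
    obtain R0 where R0: "A \<le> R0" "\<And>x. R0 \<le> x \<Longrightarrow> (t + 1) * x \<le> g x"
      using g_linear[of "t + 1"] by auto
    have U_large: "x \<le> U x" if "R0 \<le> x" for x using R0(2)[OF that] by (simp add: U_def algebra_simps)
    \<comment> \<open>Beyond \<open>R\<close> the value \<open>U x \<ge> x\<close> exceeds
      \<open>U (A + 1)\<close>, so the minimum over the compact interval is a minimum over the whole
      half-line.\<close>
    define R where "R = max (max R0 (A + 1)) \<bar>U (A + 1)\<bar>"
    have AR: "A \<le> R" using R0(1) by (simp add: R_def le_max_iff_disj)
    obtain x0 where x0: "x0 \<in> {A..R}" "\<And>x. x \<in> {A..R} \<Longrightarrow> U x0 \<le> U x"
      using continuous_attains_inf[OF compact_Icc _ U_cont, of A R] AR by auto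
    have min: "U x0 \<le> U x" if "A \<le> x" for x
    proof (cases "x \<le> R")
      case False
      have "U x0 \<le> U (A + 1)" by (rule x0(2)) (auto simp: R_def)
      also have "\<dots> \<le> R" by (simp add: R_def)
      also have "\<dots> \<le> x" using False by simp
      also have "\<dots> \<le> U x" using False by (intro U_large) (simp add: R_def)
      finally show ?thesis .
    qed (use x0 that in auto)
    have A0: "A \<le> x0" using x0 by simp
    have t0: "0 < t" using t by (simp add: T_def)
    have UA: "U x0 + 1 \<le> U A"
    proof -
      have "U x0 \<le> U (A + 1)" by (rule min) simp
      moreover have "U (A + 1) + 1 \<le> U A"
        using t abs_ge_self[of "1 + g (A + 1) - g A"] by (simp add: U_def T_def algebra_simps)
      ultimately show ?thesis by simp
    qed
    obtain d where d: "A \<le> d" "d \<le> x0" "U d = U x0 + 1"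
      using IVT2'[of U x0 "U x0 + 1" A] UA A0 U_cont[of A x0] by auto
    define R1 where "R1 = max R (\<bar>U x0\<bar> + 1)"
    have "x0 \<le> R1" using x0 by (simp add: R1_def le_max_iff_disj)
    moreover have "U x0 + 1 \<le> U R1"
    proof -
      have "U x0 + 1 \<le> R1" by (simp add: R1_def)
      also have "\<dots> \<le> U R1" by (intro U_large) (simp add: R1_def R_def)
      finally show ?thesis .
    qed
    ultimately obtain b where b: "x0 \<le> b" "U b = U x0 + 1"
      using IVT'[of U x0 "U x0 + 1" R1] U_cont[OF A0, of R1] by auto
    have dx: "d < x0" and xb: "x0 < b" using d b by (auto simp: less_le)
    define l where "l = b - d"
    have l: "0 < l" using dx xb by (simp add: l_def)
    have growth: "\<bar>x - x0\<bar> / l - 1 \<le> U x - U x0" if x: "A \<le> x" for x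
    proof -
      have quot: "1 / ((e - x0) / (x - x0)) \<le> U x - U x0" if "U e = U x0 + 1" "(e - x0) / (x - x0) \<le> 1" "0 < (e - x0) / (x - x0)" "x \<noteq> x0" for e
        using that x A0 by (intro convex_growth[OF U_convex]) auto
      consider "x \<le> d" | "d < x" "x < b" | "b \<le> x" by linarith
      then show ?thesis
      proof cases
        case 1
        have "\<bar>x - x0\<bar> / l \<le> \<bar>x - x0\<bar> / (x0 - d)"
          using dx xb by (intro divide_left_mono) (auto simp: l_def)
        also have "\<dots> = 1 / ((d - x0) / (x - x0))" using 1 dx by (simp add: field_simps)
        also have "\<dots> \<le> U x - U x0"
          using 1 dx d(3) by (intro quot) (auto simp: divide_le_eq zero_less_divide_iff)
        finally show ?thesis by simp
      next
        case 2
        have "\<bar>x - x0\<bar> / l \<le> 1" using 2 dx xb l by (auto simp: l_def)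
        then show ?thesis using min[OF x] by simp
      next
        case 3
        have "\<bar>x - x0\<bar> / l \<le> \<bar>x - x0\<bar> / (b - x0)"
          using dx xb by (intro divide_left_mono) (auto simp: l_def)
        also have "\<dots> = 1 / ((b - x0) / (x - x0))" using 3 xb by (simp add: field_simps)
        also have "\<dots> \<le> U x - U x0"
          using 3 xb b(2) by (intro quot) (auto simp: divide_le_eq)
        finally show ?thesis by simp
      qed
    qed
    \<comment> \<open>Since \<open>g\<close> is nondecreasing, the drop of 1 from \<open>d\<close>
      to \<open>x0\<close> is due to the linear term alone. This lets \<open>exp (t * x)\<close>
      supply the required decay at rate \<open>1 / l\<close> to the left of
      \<open>A\<close>.\<close>
    have tl: "1 / l \<le> t"
    proof -
      have "g d \<le> g x0"
      proof (rule DERIV_nonneg_imp_nondecreasing[OF d(2)])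
        fix x assume "d \<le> x" "x \<le> x0"
        then show "\<exists>y. (g has_real_derivative y) (at x) \<and> 0 \<le> y"
          using d(1) by (intro exI[of _ "h x"] conjI g_deriv h_nonneg) auto
      qed
      then have "1 \<le> t * (x0 - d)" using d(3) by (simp add: U_def algebra_simps)
      also have "\<dots> \<le> t * l" using t0 xb by (intro mult_left_mono) (auto simp: l_def)
      finally show ?thesis using l by (simp add: field_simps)
    qed
    have upper: "wt t x \<le> C1 * exp (- U x0) * exp (- (\<bar>x - x0\<bar> / l))" for x
    proof (cases "A \<le> x")
      case True
      have "wt t x = c * exp (- U x + q x)"
        by (simp add: wt_def p_tail[OF True] mult_exp_exp U_def algebra_simps)
      also have "\<dots> \<le> c * exp (2 - U x0 - \<bar>x - x0\<bar> / l)"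
        using c growth[OF True] q_tail[OF True] by (intro mult_left_mono) auto
      also have "\<dots> = c * exp 2 * (exp (- U x0) * exp (- (\<bar>x - x0\<bar> / l)))"
        by (simp add: mult_exp_exp)
      also have "\<dots> \<le> C1 * (exp (- U x0) * exp (- (\<bar>x - x0\<bar> / l)))"
        using parts by (intro mult_right_mono) (auto simp: C1_def)
      finally show ?thesis by (simp add: mult.assoc)
    next
      case False
      have "(A - x) / l \<le> t * (A - x)" using mult_right_mono[OF tl, of "A - x"] False by simp
      moreover have "(x0 - A) / l - 1 \<le> U A - U x0" using growth[of A] A0 by simp
      moreover have "\<bar>x - x0\<bar> / l = (x0 - A) / l + (A - x) / l"
        using A0 False by (simp add: add_divide_distrib[symmetric])
      ultimately have "t * x \<le> g A + 1 - U x0 - \<bar>x - x0\<bar> / l"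
        by (simp add: U_def algebra_simps)
      then have "wt t x \<le> exp (g A + 1 - U x0 - \<bar>x - x0\<bar> / l) * P"
        unfolding wt_def by (intro mult_mono p_le p_nonneg) auto
      also have "\<dots> = P * exp (g A + 1) * (exp (- U x0) * exp (- (\<bar>x - x0\<bar> / l)))"
        by (simp add: mult_exp_exp)
      also have "\<dots> \<le> C1 * (exp (- U x0) * exp (- (\<bar>x - x0\<bar> / l)))"
        using parts by (intro mult_right_mono) (auto simp: C1_def)
      finally show ?thesis by (simp add: mult.assoc)
    qed
    \<comment> \<open>On the level set convexity keeps \<open>U\<close> within 1 of its minimum and
      \<open>q\<close> costs another 1. Integrating over its length \<open>l\<close> bounds the
      normalising constant from below, so the height \<open>exp (- U x0)\<close> cancels from the
      quotient.\<close>
    have lower: "c * exp (- U x0 - 2) * indicator {d..b} x \<le> wt t x" for x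
    proof (cases "x \<in> {d..b}")
      case True
      define r where "r = (x - d) / l"
      have r: "0 \<le> r" "r \<le> 1" using True l by (auto simp: r_def l_def)
      have x: "x = (1 - r) *\<^sub>R d + r *\<^sub>R b"
      proof -
        have "(1 - r) *\<^sub>R d + r *\<^sub>R b = d + r * l" by (simp add: l_def algebra_simps)
        then show ?thesis using l by (simp add: r_def)
      qed
      have "U x \<le> (1 - r) * U d + r * U b"
        unfolding x using r d b A0 by (intro convex_onD[OF U_convex]) auto
      then have Ux: "U x \<le> U x0 + 1" by (simp add: d b algebra_simps)
      have "A \<le> x" using True d by simp
      have "c * exp (- U x0 - 2) \<le> c * exp (- U x + q x)"
        using c Ux q_tail[OF \<open>A \<le> x\<close>] by (intro mult_left_mono) auto
      also have "\<dots> = wt t x" by (simp add: wt_def p_tail[OF \<open>A \<le> x\<close>] mult_exp_exp U_def algebra_simps)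
      finally show ?thesis using True by simp
    qed simp
    have Z: "c * exp (- U x0 - 2) * l \<le> Phi p t"
    proof -
      have "c * exp (- U x0 - 2) * l = (LINT x|lborel. c * exp (- U x0 - 2) * indicator {d..b} x)"
        using dx xb by (simp add: l_def)
      also have "\<dots> \<le> (LINT x|lborel. wt t x)"
        by (intro integral_mono lower integrable_wt0 integrable_mult_right integrable_real_indicator)
          (auto simp: emeasure_lborel_Icc_eq)
      finally show ?thesis by (simp add: Phi_eq)
    qed
    have "wt t x / Phi p t \<le> C / l * exp (- (\<bar>x - x0\<bar> / l))" for x
    proof -
      have pos: "0 < c * exp (- U x0 - 2) * l" using c l by simp
      have "wt t x / Phi p t \<le> wt t x / (c * exp (- U x0 - 2) * l)"
        using Z pos Phi_pos[of t] by (intro divide_left_mono) auto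
      also have "\<dots> \<le> C1 * exp (- U x0) * exp (- (\<bar>x - x0\<bar> / l)) / (c * exp (- U x0 - 2) * l)"
        using upper pos by (intro divide_right_mono) auto
      also have "\<dots> = C / l * exp (- (\<bar>x - x0\<bar> / l))"
        using c l by (simp add: C_def exp_diff field_simps)
      finally show ?thesis .
    qed
    then show ?thesis using l by blast
  qed
  then show ?thesis using C by blast
qed

text \<open>The exponential bound is centred at the minimiser \<open>x0\<close>, whereas the local
  limit estimate needs the mean as centre. In units of \<open>l\<close> the two differ by at most
  \<open>2 * C\<close>, the first moment of the majorant, so recentring costs the factor
  \<open>exp (2 * C)\<close>. The 12 is \<open>2 * fact 3\<close>, from the third moment.\<close>

lemma rescaled_tilt_centered_density:
  "\<exists>T K. 0 < K \<and> (\<forall>t\<ge>T. \<exists>l>0. centered_density K (\<lambda>y. l * (exp (t * (tilt_mean p t + l * y)) * p (tilt_mean p t + l * y) / Phi p t)))"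
proof -
  obtain T C where C: "0 < C" and
    bnd: "\<And>t. T \<le> t \<Longrightarrow> \<exists>l>0. \<exists>x0. \<forall>x. wt t x / Phi p t \<le> C / l * exp (- (\<bar>x - x0\<bar> / l))"
    using tilted_exponential_bound by blast
  define C2 where "C2 = C * exp (2 * C)"
  have C2: "0 < C2" using C by (simp add: C2_def)
  have "\<exists>l>0. centered_density (12 * C2) (\<lambda>y. l * (exp (t * (tilt_mean p t + l * y)) * p (tilt_mean p t + l * y) / Phi p t))"
    if t: "T \<le> t" for t
  proof -
    obtain l x0 where l: "0 < l" and b: "\<And>x. wt t x / Phi p t \<le> C / l * exp (- (\<bar>x - x0\<bar> / l))"
      using bnd[OF t] by blast
    define Z where "Z = Phi p t"
    have Z: "0 < Z" by (simp add: Z_def Phi_pos)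
    define a where "a = tilt_mean p t"
    define F where "F r y = l * (wt t (r + l * y) / Z)" for r y
    have [measurable]: "F r \<in> borel_measurable borel" for r unfolding F_def by measurable
    have F0: "0 \<le> F r y" for r y using l Z by (simp add: F_def)
    have F_int: "has_bochner_integral lborel (F r) 1" for r
    proof -
      have "has_bochner_integral lborel (\<lambda>x. wt t x / Z) 1"
        using integrable_wt0[of t] Z by (simp add: has_bochner_integral_iff Z_def Phi_eq)
      then have "has_bochner_integral lborel (\<lambda>y. wt t (r + l * y) / Z) (1 /\<^sub>R \<bar>l\<bar>)"
        using l by (subst (asm) lborel_has_bochner_integral_real_affine_iff[of l _ _ r]) auto
      from has_bochner_integral_mult_right[OF this, of l] show ?thesis
        using l by (simp add: F_def[abs_def])
    qed
    have F_mean: "has_bochner_integral lborel (\<lambda>y. y * F r y) ((a - r) / l)" for r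
    proof -
      have "has_bochner_integral lborel (\<lambda>x. (x * wt t x - r * wt t x) / Z) ((M1 t - r * Z) / Z)"
        using integrable_wt0[of t] integrable_wt1[of t]
        by (auto simp: has_bochner_integral_iff M1_def Phi_eq Z_def)
      moreover have "(M1 t - r * Z) / Z = a - r"
        using Z by (simp add: a_def tilt_mean_eq Z_def diff_divide_distrib)
      moreover have "(x * wt t x - r * wt t x) / Z = (x - r) * (wt t x / Z)" for x
        by (simp add: algebra_simps)
      ultimately have "has_bochner_integral lborel (\<lambda>x. (x - r) * (wt t x / Z)) (a - r)" by simp
      then have "has_bochner_integral lborel (\<lambda>y. (r + l * y - r) * (wt t (r + l * y) / Z)) ((a - r) /\<^sub>R \<bar>l\<bar>)"
        using l by (subst (asm) lborel_has_bochner_integral_real_affine_iff[of l _ _ r]) auto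
      then show ?thesis
        using l by (simp add: F_def mult_ac divide_inverse)
    qed
    have F_le: "F x0 y \<le> C * exp (- \<bar>y\<bar>)" for y
    proof -
      have "F x0 y \<le> l * (C / l * exp (- (\<bar>x0 + l * y - x0\<bar> / l)))"
        unfolding F_def Z_def using l by (intro mult_left_mono b) auto
      also have "\<dots> = C * exp (- \<bar>y\<bar>)" using l by (simp add: abs_mult)
      finally show ?thesis .
    qed
    define \<nu> where "\<nu> = (a - x0) / l"
    have \<nu>: "\<bar>\<nu>\<bar> \<le> 2 * C"
    proof -
      have "\<bar>\<nu>\<bar> = norm (LINT y|lborel. y * F x0 y)"
        using F_mean[of x0] by (simp add: has_bochner_integral_iff \<nu>_def)
      also have "\<dots> \<le> (LINT y|lborel. C * (\<bar>y\<bar> ^ 1 * exp (- \<bar>y\<bar>)))"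
      proof (rule Bochner_Integration.integral_norm_bound_integral)
        show "integrable lborel (\<lambda>y. y * F x0 y)" using F_mean[of x0] by (simp add: has_bochner_integral_iff)
        show "integrable lborel (\<lambda>y::real. C * (\<bar>y\<bar> ^ 1 * exp (- \<bar>y\<bar>)))"
          by (intro integrable_mult_right integrable_exp_abs_moment)
        fix y :: real
        have "\<bar>y\<bar> * F x0 y \<le> \<bar>y\<bar> * (C * exp (- \<bar>y\<bar>))" by (intro mult_left_mono F_le) auto
        then show "norm (y * F x0 y) \<le> C * (\<bar>y\<bar> ^ 1 * exp (- \<bar>y\<bar>))" using F0 by (simp add: abs_mult mult_ac)
      qed
      also have "\<dots> = C * (LINT y|lborel. \<bar>y\<bar> ^ 1 * exp (- \<bar>y\<bar>))" by (rule integral_mult_right_zero)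
      also have "\<dots> \<le> C * (2 * fact 1)" using C by (intro mult_left_mono exp_abs_moment_le) auto
      finally show ?thesis by simp
    qed
    have Fa_le: "F a y \<le> C2 * exp (- \<bar>y\<bar>)" for y
    proof -
      have "l * \<nu> = a - x0" using l by (simp add: \<nu>_def)
      then have "x0 + l * (\<nu> + y) = a + l * y" by (simp add: distrib_left)
      then have "F a y = F x0 (\<nu> + y)" by (simp only: F_def)
      also have "\<dots> \<le> C * exp (- \<bar>\<nu> + y\<bar>)" by (rule F_le)
      also have "\<dots> \<le> C * exp (2 * C - \<bar>y\<bar>)"
        using C \<nu> by (intro mult_left_mono) auto
      also have "\<dots> = C2 * exp (- \<bar>y\<bar>)" by (simp add: C2_def mult_exp_exp)
      finally show ?thesis .
    qed
    have i3: "integrable lborel (\<lambda>y::real. C2 * (\<bar>y\<bar> ^ 3 * exp (- \<bar>y\<bar>)))"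
      by (intro integrable_mult_right integrable_exp_abs_moment)
    have le3: "\<bar>y\<bar> ^ 3 * F a y \<le> C2 * (\<bar>y\<bar> ^ 3 * exp (- \<bar>y\<bar>))" for y
      using mult_left_mono[OF Fa_le[of y], of "\<bar>y\<bar> ^ 3"] by (simp add: mult_ac)
    have iF3: "integrable lborel (\<lambda>y. \<bar>y\<bar> ^ 3 * F a y)"
      by (rule Bochner_Integration.integrable_bound[OF i3])
        (use le3 F0 C2 in \<open>auto simp: abs_mult\<close>)
    have "centered_density (12 * C2) (F a)"
    proof
      show "0 \<le> F a y" for y by (rule F0)
      show "F a y \<le> 12 * C2" for y
      proof -
        have "F a y \<le> C2 * exp (- \<bar>y\<bar>)" by (rule Fa_le)
        also have "\<dots> \<le> C2 * 12" using C2 by (intro mult_left_mono) (auto intro: order_trans[of _ 1])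
        finally show ?thesis by simp
      qed
      show "Bochner_Integration.integrable lborel (F a)" "integral\<^sup>L lborel (F a) = 1"
        using F_int[of a] by (simp_all add: has_bochner_integral_iff)
      show "(LINT y|lborel. y * F a y) = 0" using F_mean[of a] by (simp add: has_bochner_integral_iff)
      show "integrable lborel (\<lambda>y. \<bar>y\<bar> ^ 3 * F a y)" by (rule iF3)
      have "(LINT y|lborel. \<bar>y\<bar> ^ 3 * F a y) \<le> (LINT y|lborel. C2 * (\<bar>y\<bar> ^ 3 * exp (- \<bar>y\<bar>)))"
        by (rule integral_mono[OF iF3 i3 le3])
      also have "\<dots> = C2 * (LINT y|lborel. \<bar>y\<bar> ^ 3 * exp (- \<bar>y\<bar>))" by (rule integral_mult_right_zero)
      also have "\<dots> \<le> C2 * (2 * fact 3)" using C2 by (intro mult_left_mono exp_abs_moment_le) auto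
      also have "\<dots> = 12 * C2" by (simp add: fact_numeral)
      finally show "(LINT y|lborel. \<bar>y\<bar> ^ 3 * F a y) \<le> 12 * C2" .
    qed simp
    then show ?thesis using l by (intro exI[of _ l]) (simp add: F_def[abs_def] wt_def a_def Z_def)
  qed
  then show ?thesis using C2 by (intro exI[of _ T] exI[of _ "12 * C2"]) auto
qed

end

section \<open>Regularly and rapidly varying exponents\<close>

lemma R0_repr_has_derivative:
  assumes "R0_repr l e e1 e2" and x: "1 < x"
  shows "(l has_real_derivative l x * (e x / x)) (at x)"
proof -
  define I where "I x = integral {1..x} (\<lambda>u. e u / u)" for x
  have l: "\<And>x. 1 \<le> x \<Longrightarrow> l x = exp (I x)"
    and e: "\<And>x. 1 \<le> x \<Longrightarrow> (e has_real_derivative e1 x) (at x within {1..})"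
    using assms(1) by (auto simp: R0_repr_def I_def)
  have "continuous_on {1..} e"
    using e by (auto simp: continuous_on_eq_continuous_within intro: has_field_derivative_imp_has_derivative
        has_derivative_continuous dest!: DERIV_continuous)
  then have "continuous_on {1..x + 1} (\<lambda>u. e u / u)"
    by (intro continuous_intros) (auto intro: continuous_on_subset)
  then have "(I has_real_derivative e x / x) (at x within {1..x + 1})"
    unfolding I_def by (rule integral_has_real_derivative) (use x in auto)
  moreover have "at x within {1..x + 1} = at x"
    by (rule at_within_interior) (use x in simp)
  ultimately have "(I has_real_derivative e x / x) (at x)"
    by (simp only:)
  then have "((\<lambda>x. exp (I x)) has_real_derivative exp (I x) * (e x / x)) (at x)"
    by (rule DERIV_fun_exp)
  then have "((\<lambda>x. exp (I x)) has_real_derivative l x * (e x / x)) (at x)"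
    using x by (simp add: l)
  then show ?thesis
    by (rule has_field_derivative_transform_within_open[of _ _ _ "{1<..}"]) (use x l in auto)
qed

text \<open>For positive index \<open>\<beta>\<close> the derivative of
  \<open>x powr \<beta> * l x\<close> is
  \<open>x powr (\<beta> - 1) * l x * (\<beta> + e x)\<close>, and \<open>e\<close> tends to 0; for
  the rapidly varying class monotonicity is part of the definition. This is what makes
  \<open>g\<close> convex in the tail.\<close>

lemma Rclass_eventually_mono:
  assumes "h \<in> Rclass"
  shows "\<exists>A>0. \<forall>x\<ge>A. \<forall>y\<ge>x. h x \<le> h y"
proof -
  consider \<beta> where "0 < \<beta>" "h \<in> Rbeta \<beta>" | "h \<in> Rinf" using assms by (auto simp: Rclass_def)
  then show ?thesis
  proof cases
    case 1
    then obtain l e e1 e2 where l: "R0_repr l e e1 e2" and h: "\<forall>\<^sub>F x in at_top. h x = x powr \<beta> * l x"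
      by (auto simp: Rbeta_def)
    have "(e \<longlongrightarrow> 0) at_top" using l by (simp add: R0_repr_def)
    then have "\<forall>\<^sub>F x in at_top. - \<beta> < e x" using 1 by (intro order_tendstoD) auto
    with h have "\<forall>\<^sub>F x in at_top. h x = x powr \<beta> * l x \<and> - \<beta> < e x" by (rule eventually_conj)
    then obtain x1 where x1: "\<And>x. x1 \<le> x \<Longrightarrow> h x = x powr \<beta> * l x \<and> - \<beta> < e x"
      unfolding eventually_at_top_linorder by blast
    define A where "A = max x1 2"
    have "h x \<le> h y" if "A \<le> x" "x \<le> y" for x y
    proof -
      have "x powr \<beta> * l x \<le> y powr \<beta> * l y"
      proof (rule DERIV_nonneg_imp_nondecreasing[OF that(2)])
        fix z assume z: "x \<le> z" "z \<le> y"
        have z1: "1 < z" and ez: "- \<beta> < e z" using z that x1[of z] by (auto simp: A_def)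
        have lz: "0 < l z" using l z1 by (simp add: R0_repr_def)
        have "((\<lambda>z. z powr \<beta> * l z) has_real_derivative \<beta> * z powr (\<beta> - 1) * l z + l z * (e z / z) * z powr \<beta>) (at z)"
          using z1 by (intro DERIV_mult has_real_derivative_powr R0_repr_has_derivative[OF l]) auto
        moreover have "\<beta> * z powr (\<beta> - 1) * l z + l z * (e z / z) * z powr \<beta> = z powr (\<beta> - 1) * l z * (\<beta> + e z)"
          using z1 by (simp add: powr_diff field_simps)
        moreover have "0 \<le> z powr (\<beta> - 1) * l z * (\<beta> + e z)" using lz ez by simp
        ultimately show "\<exists>w. ((\<lambda>z. z powr \<beta> * l z) has_real_derivative w) (at z) \<and> 0 \<le> w" by metis
      qed
      then show ?thesis using x1[of x] x1[of y] that by (simp add: A_def)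
    qed
    then show ?thesis by (intro exI[of _ A]) (auto simp: A_def)
  next
    case 2
    then have "strict_mono_on {0<..} h" by (simp add: Rinf_def)
    then have "h x \<le> h y" if "1 \<le> x" "x \<le> y" for x y
      using that by (cases "x = y") (auto dest!: strict_mono_onD[of _ _ x y])
    then show ?thesis by (intro exI[of _ 1]) auto
  qed
qed

theorem theorem5p3:
  fixes M :: "'s measure" and X :: "nat \<Rightarrow> 's \<Rightarrow> real"
    and p g q h :: "real \<Rightarrow> real" and c \<theta> :: real
    and a t :: "nat \<Rightarrow> real" and p\<^sub>a :: "nat \<Rightarrow> real \<Rightarrow> real"
  assumes "prob_space M"
    and "prob_space.indep_vars M (\<lambda>_. borel) X {1..}"
    and "\<And>i. i \<ge> 1 \<Longrightarrow> distributed M lborel (X i) (\<lambda>x. ennreal (p x))"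
    and "p \<in> borel_measurable borel"
    and "\<And>x. 0 \<le> p x"
    and "bounded (range p)"
    and "0 < c"
    and "\<And>x. x > 0 \<Longrightarrow> p x = c * exp (- (g x - q x))"
    and "\<And>x. x < 0 \<Longrightarrow> p x = 0"
    and "\<And>x. x > 0 \<Longrightarrow> 0 < g x"
    and "filterlim (\<lambda>x. g x / x) at_top at_top"
    and "\<And>x. x > 0 \<Longrightarrow> (g has_real_derivative h x) (at x)"
    and "0 < \<theta>"
    and "\<forall>\<^sub>F x in at_top. \<forall>v>0. \<bar>v - x\<bar> < \<theta> * x \<longrightarrow> \<bar>q v\<bar> \<le> 1 / sqrt (x * h x)"
    and "h \<in> Rclass"
    and "filterlim a at_top sequentially"
    and "\<And>n. n \<ge> 1 \<Longrightarrow> tilt_mean p (t n) = a n"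
    and "\<forall>\<^sub>F n in sequentially. psi h differentiable (at (t n)) \<and> 0 < deriv (psi h) (t n)"
    and "(\<lambda>n. (psi h (t n))\<^sup>2 / sqrt (real n * deriv (psi h) (t n))) \<longlonglongrightarrow> 0"
    and "\<And>n x. n \<ge> 2 \<Longrightarrow> 0 \<le> p\<^sub>a n x"
    and "\<And>n. n \<ge> 2 \<Longrightarrow>
      distributed (cond_law p n (real n * a n)) lborel (\<lambda>y. y 1) (\<lambda>x. ennreal (p\<^sub>a n x))"
  shows "\<exists>R :: nat \<Rightarrow> (nat \<Rightarrow> real) \<Rightarrow> real.
    (\<forall>n. R n \<in> borel_measurable (\<Pi>\<^sub>M i\<in>{1..n}. borel)) \<and>
    (\<forall>n\<ge>2. AE y in cond_law p n (real n * a n).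
       p\<^sub>a n (y 1) = tilted_density p (a n) (y 1) * (1 + R n y)) \<and>
    (\<forall>\<delta>>0. (\<lambda>n. measure (cond_law p n (real n * a n))
       {y \<in> space (cond_law p n (real n * a n)). \<bar>R n y\<bar> > \<delta> / sqrt (real n)}) \<longlonglongrightarrow> 0)"
proof -
  note pm [measurable] = assms(4)
  note p0 = assms(5) and p_form = assms(8) and g_super = assms(11) and g_deriv = assms(12)
    and tm = assms(17) and pa0 = assms(20) and pa_distr = assms(21)
  obtain A1 where A1: "0 < A1" "\<And>x y. A1 \<le> x \<Longrightarrow> x \<le> y \<Longrightarrow> h x \<le> h y"
    using Rclass_eventually_mono[OF \<open>h \<in> Rclass\<close>] by blast
  obtain A2 where A2: "\<And>x v. A2 \<le> x \<Longrightarrow> 0 < v \<Longrightarrow> \<bar>v - x\<bar> < \<theta> * x \<Longrightarrow> \<bar>q v\<bar> \<le> 1 / sqrt (x * h x)"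
    using assms(14) unfolding eventually_at_top_linorder by blast
  \<comment> \<open>otherwise \<open>g\<close> would grow at most linearly\<close>
  obtain A3 where A3: "A1 \<le> A3" "1 \<le> h A3"
  proof -
    have "\<exists>x\<ge>A1. 1 \<le> h x"
    proof (rule ccontr)
      assume "\<not> ?thesis"
      then have less: "h x < 1" if "A1 \<le> x" for x using that by force
      have "\<forall>\<^sub>F x in at_top. \<bar>g A1\<bar> + 2 \<le> g x / x" using g_super by (auto simp: filterlim_at_top)
      then obtain x1 where x1: "\<And>x. x1 \<le> x \<Longrightarrow> \<bar>g A1\<bar> + 2 \<le> g x / x"
        unfolding eventually_at_top_linorder by blast
      define x where "x = max (max x1 A1) 1"
      have x: "x1 \<le> x" "A1 \<le> x" "1 \<le> x" by (auto simp: x_def)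
      have "g x - x \<le> g A1 - A1"
      proof (rule DERIV_nonpos_imp_nonincreasing[OF x(2)])
        fix z assume "A1 \<le> z" "z \<le> x"
        then show "\<exists>y. ((\<lambda>x. g x - x) has_real_derivative y) (at z) \<and> y \<le> 0"
          using less[of z] A1(1) by (intro exI[of _ "h z - 1"] conjI DERIV_diff g_deriv DERIV_ident) auto
      qed
      then have "g x \<le> x + \<bar>g A1\<bar>" using A1(1) by linarith
      also have "\<dots> \<le> x + \<bar>g A1\<bar> * x" using mult_left_mono[OF x(3), of "\<bar>g A1\<bar>"] by simp
      also have "\<dots> < (\<bar>g A1\<bar> + 2) * x" using x(3) by (simp add: algebra_simps)
      also have "\<dots> \<le> g x" using x1[OF x(1)] x(3) by (simp add: field_simps)
      finally show False by simp
    qed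
    then show ?thesis using that by blast
  qed
  \<comment> \<open>Beyond \<open>A\<close> one has \<open>x * h x \<ge> 1\<close>, so the smallness
    condition on \<open>q\<close>, taken at \<open>v = x\<close>, gives
    \<open>\<bar>q x\<bar> \<le> 1\<close>.\<close>
  define A where "A = max (max A2 A3) 1"
  have A: "A2 \<le> A" "A3 \<le> A" "1 \<le> A" by (auto simp: A_def)
  have h1: "1 \<le> h x" if "A \<le> x" for x
    using A1(2)[of A3 x] A3 A that by linarith
  obtain P where P: "\<And>x. p x \<le> P"
  proof -
    obtain P where "\<And>x. \<bar>p x\<bar> \<le> P" using assms(6) by (auto simp: bounded_iff)
    then show thesis using that abs_le_D1 by blast
  qed
  interpret convex_tail p g q h c A P
  proof
    show "\<bar>q x\<bar> \<le> 1" if "A \<le> x" for x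
    proof -
      have "\<bar>q x\<bar> \<le> 1 / sqrt (x * h x)" using A that \<open>0 < \<theta>\<close> by (intro A2) auto
      also have "\<dots> \<le> 1"
      proof -
        have "1 * 1 \<le> x * h x" using h1[OF that] A that by (intro mult_mono) auto
        then show ?thesis by simp
      qed
      finally show ?thesis .
    qed
    show "h x \<le> h y" if "A \<le> x" "x \<le> y" for x y using that A A3 by (intro A1(2)) auto
    show "0 \<le> h x" if "A \<le> x" for x using h1[OF that] by simp
  qed (use p0 P assms A in auto)
  define \<pi> where "\<pi> n x = exp (t n * x) * p x / Phi p (t n)" for n x
  have tilted: "tilted_density p (a n) = \<pi> n" if "1 \<le> n" for n
    using tilted_density_eq[OF tm[OF that]] by (simp add: \<pi>_def fun_eq_iff)
  have [measurable]: "\<pi> n \<in> borel_measurable borel" for n unfolding \<pi>_def by measurable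
  have [measurable]: "p\<^sub>a n \<in> borel_measurable borel" if "2 \<le> n" for n
    using distributed_borel_measurable[OF pa_distr[OF that]] pa0[OF that] by (simp add: measurable_lborel1)
  \<comment> \<open>Division by zero gives 0, so \<open>R\<close> equals -1 where the tilted density
    vanishes; these points have conditional probability 0. For \<open>n < 2\<close> nothing is
    claimed about the conditional density, and 0 keeps \<open>R\<close> measurable.\<close>
  define R where "R n y = (if 2 \<le> n then p\<^sub>a n (y 1) / \<pi> n (y 1) - 1 else 0)" for n and y :: "nat \<Rightarrow> real"
  have meas: "R n \<in> borel_measurable (\<Pi>\<^sub>M i\<in>{1..n}. borel)" for n
  proof (cases "2 \<le> n")
    case True
    then have "(\<lambda>y. y 1) \<in> (\<Pi>\<^sub>M i\<in>{1..n}. (borel :: real measure)) \<rightarrow>\<^sub>M borel"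
      by (intro measurable_component_singleton) auto
    then have "(\<lambda>y. p\<^sub>a n (y 1) / \<pi> n (y 1) - 1) \<in> borel_measurable (\<Pi>\<^sub>M i\<in>{1..n}. (borel :: real measure))"
      using True by measurable
    then show ?thesis using True by (simp add: R_def[abs_def])
  qed (simp add: R_def[abs_def])
  have ae: "AE y in cond_law p n (real n * a n). p\<^sub>a n (y 1) = tilted_density p (a n) (y 1) * (1 + R n y)" if n: "2 \<le> n" for n
    using AE_cond_law_nonzero[OF pm p0 n, of "real n * a n"]
  proof eventually_elim
    case (elim y)
    have "\<pi> n (y 1) \<noteq> 0" using elim Phi_pos[of "t n"] by (simp add: \<pi>_def)
    then show ?case using n by (simp add: R_def tilted)
  qed
  have lim: "(\<lambda>n. measure (cond_law p n (real n * a n))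
       {y \<in> space (cond_law p n (real n * a n)). \<bar>R n y\<bar> > \<delta> / sqrt (real n)}) \<longlonglongrightarrow> 0" if \<delta>: "0 < \<delta>" for \<delta>
  proof -
    obtain T K where K: "0 < K" and
      dens: "\<And>t. T \<le> t \<Longrightarrow> \<exists>l>0. centered_density K (\<lambda>y. l * (exp (t * (tilt_mean p t + l * y)) * p (tilt_mean p t + l * y) / Phi p t))"
      using rescaled_tilt_centered_density by blast
    obtain N B where B: "0 < B" and ratio: "\<And>f n. centered_density K f \<Longrightarrow> N \<le> n \<Longrightarrow> \<exists>c>0. conv_pow f (n - 1) 0 = ennreal c \<and>
      (\<forall>y. \<exists>b\<ge>0. conv_pow f (n - 2) (- y) = ennreal b \<and> b \<le> B * c \<and> \<bar>b / c - 1\<bar> \<le> B * (1 + y\<^sup>2) / real n)"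
      using conv_pow_ratio[of K] by blast
    \<comment> \<open>The mean at \<open>T\<close> is a fixed number, so divergence of
      \<open>a\<close> and strict monotonicity of the tilted mean force \<open>t n \<ge> T\<close>
      for large \<open>n\<close>.\<close>
    have "\<forall>\<^sub>F n in sequentially. tilt_mean p T < a n"
      using assms(16) by (auto simp: filterlim_at_top_dense)
    then have large: "\<forall>\<^sub>F n in sequentially. tilt_mean p T < a n \<and> N \<le> n \<and> 2 \<le> n"
      by (intro eventually_conj eventually_ge_at_top)
    have upper: "\<forall>\<^sub>F n in sequentially. measure (cond_law p n (real n * a n))
       {y \<in> space (cond_law p n (real n * a n)). \<bar>R n y\<bar> > \<delta> / sqrt (real n)} \<le> B\<^sup>2 * (2 + K) / (\<delta> * sqrt (real n))"
      using large
    proof eventually_elim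
      case (elim n)
      then have n: "N \<le> n" "2 \<le> n" and an: "tilt_mean p (t n) = a n" using tm[of n] by auto
      have "T \<le> t n"
      proof (rule ccontr)
        assume "\<not> T \<le> t n"
        then have "tilt_mean p (t n) < tilt_mean p T" by (intro tilt_mean_less) simp
        then show False using elim an by simp
      qed
      from dens[OF this] obtain l where l: "0 < l"
        and d: "centered_density K (\<lambda>y. l * (exp (t n * (a n + l * y)) * p (a n + l * y) / Phi p (t n)))"
        unfolding an by blast
      from ratio[OF d n(1)] obtain c' where c': "0 < c'"
          "conv_pow (\<lambda>y. l * (exp (t n * (a n + l * y)) * p (a n + l * y) / Phi p (t n))) (n - 1) 0 = ennreal c'"
        and b: "\<And>y. \<exists>b\<ge>0. conv_pow (\<lambda>y. l * (exp (t n * (a n + l * y)) * p (a n + l * y) / Phi p (t n))) (n - 2) (- y) = ennreal b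
          \<and> b \<le> B * c' \<and> \<bar>b / c' - 1\<bar> \<le> B * (1 + y\<^sup>2) / real n" by blast
      show ?case
        using conditional_density_estimate[OF pm p0 Phi_pos l n(2) B \<delta> refl d c' b pa0[OF n(2)] pa_distr[OF n(2)]] n(2)
        by (simp only: R_def \<pi>_def if_True)
    qed
    have vanish: "(\<lambda>n. B\<^sup>2 * (2 + K) / (\<delta> * sqrt (real n))) \<longlonglongrightarrow> 0"
      using \<delta> by (intro tendsto_divide_0[OF tendsto_const] filterlim_at_top_imp_at_infinity
          filterlim_tendsto_pos_mult_at_top[OF tendsto_const \<delta>] filterlim_compose[OF sqrt_at_top filterlim_real_sequentially])
    show ?thesis
      by (rule tendsto_sandwich[OF _ upper tendsto_const vanish]) simp
  qed
  show ?thesis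
    by (intro exI[of _ R] conjI allI impI meas ae lim)
qed

end
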